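(* For any constant $\epsilon\in(0,1)$, there exists an $\widetilde{O}(n^{2/3}+D)$-round randomized $\mathsf{CONGEST}$ algorithm that solves $(1+\epsilon)$-Apx-RPaths in weighted directed graphs with high probability.
   Context: Let $G=(V,E)$ be a directed graph with $n=|V|$ whose edge weights are positive integers bounded by a polynomial in $n$; the length of a path is the sum of its edge weights. $G$ is also the communication network (communication over each edge in both directions); $D$ is the diameter of the underlying undirected unweighted graph. In the $\mathsf{CONGEST}$ model, computation proceeds in synchronous rounds; in each round every vertex may send an $O(\log n)$-bit message to each neighbour; vertices have unique $O(\log n)$-bit identifiers and unlimited local computation. "With high probability" means with probability $1-1/\operatorname{poly}(n)$; $\widetilde{O}$ hides polylogarithmic factors. Input: vertices $s,t$ and a shortest $s$-$t$ path $P=(s=v_0,\dots,v_{h_{st}}=t)$ with $h_{st}$ edges; initially the endpoints of each edge of $P$ know it belongs to $P$, $s$ knows it is the source, $t$ knows it is the target. $|st\diamond e|$ is the length of a shortest $s$-$t$ path in $G$ avoiding the edge $e$. The $(1+\epsilon)$-Apx-RPaths problem asks that, for each edge $e$ of $P$, its first endpoint computes a value $x$ with $|st\diamond e|\le x\le(1+\epsilon)|st\diamond e|$. *)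

theory Defs
  imports "HOL-Probability.Product_PMF" "HOL-Library.Extended_Nat"
begin

section \<open>Weighted directed graphs, paths, distances\<close>

text \<open>Vertices are natural numbers (which also serve as the unique identifiers);
  a graph is a vertex set V, a directed edge set E and a weight function w on edges.\<close>

definition edges_of :: "nat list \<Rightarrow> (nat \<times> nat) list" where
  "edges_of p = zip p (tl p)"

definition is_path :: "nat set \<Rightarrow> (nat \<times> nat) set \<Rightarrow> nat list \<Rightarrow> bool" where
  "is_path V E p \<longleftrightarrow> p \<noteq> [] \<and> distinct p \<and> set p \<subseteq> V \<and> set (edges_of p) \<subseteq> E"

definition path_len :: "(nat \<times> nat \<Rightarrow> nat) \<Rightarrow> nat list \<Rightarrow> nat" where
  "path_len w p = sum_list (map w (edges_of p))"

text \<open>Length of a shortest s-t path (infinity if none).\<close>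
definition sp_dist :: "nat set \<Rightarrow> (nat \<times> nat) set \<Rightarrow> (nat \<times> nat \<Rightarrow> nat) \<Rightarrow> nat \<Rightarrow> nat \<Rightarrow> enat" where
  "sp_dist V E w s t = Inf {enat (path_len w p) | p. is_path V E p \<and> hd p = s \<and> last p = t}"

text \<open>|st<>e|: length of a shortest s-t path avoiding the edge e (infinity if none).\<close>
definition repl_dist :: "nat set \<Rightarrow> (nat \<times> nat) set \<Rightarrow> (nat \<times> nat \<Rightarrow> nat) \<Rightarrow> nat \<Rightarrow> nat \<Rightarrow> nat \<times> nat \<Rightarrow> enat" where
  "repl_dist V E w s t e =
     Inf {enat (path_len w p) | p. is_path V E p \<and> hd p = s \<and> last p = t \<and> e \<notin> set (edges_of p)}"

text \<open>Underlying undirected (unweighted) communication graph.\<close>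
definition und_edges :: "(nat \<times> nat) set \<Rightarrow> (nat \<times> nat) set" where
  "und_edges E = E \<union> E\<inverse>"

definition nbrs :: "(nat \<times> nat) set \<Rightarrow> nat \<Rightarrow> nat set" where
  "nbrs E v = {u. (v, u) \<in> und_edges E}"

definition connected_und :: "nat set \<Rightarrow> (nat \<times> nat) set \<Rightarrow> bool" where
  "connected_und V E \<longleftrightarrow> (\<forall>u\<in>V. \<forall>v\<in>V. (u, v) \<in> (und_edges E)\<^sup>*)"

text \<open>Hop distance in the underlying undirected graph, and its diameter D.\<close>
definition hop_dist :: "(nat \<times> nat) set \<Rightarrow> nat \<Rightarrow> nat \<Rightarrow> nat" where
  "hop_dist E u v = (LEAST k. (u, v) \<in> (und_edges E) ^^ k)"

definition diameter :: "nat set \<Rightarrow> (nat \<times> nat) set \<Rightarrow> nat" where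
  "diameter V E = Max {hop_dist E u v | u v. u \<in> V \<and> v \<in> V}"

text \<open>Valid problem instance: n vertices, identifiers of O(log n) bits (< n^cI),
  positive integer weights bounded by n^cW, connected communication graph,
  P a shortest s-t path.\<close>
definition valid_instance ::
  "nat \<Rightarrow> nat \<Rightarrow> nat \<Rightarrow> nat set \<Rightarrow> (nat \<times> nat) set \<Rightarrow> (nat \<times> nat \<Rightarrow> nat)
     \<Rightarrow> nat \<Rightarrow> nat \<Rightarrow> nat list \<Rightarrow> bool" where
  "valid_instance n cW cI V E w s t P \<longleftrightarrow>
     finite V \<and> card V = n \<and> (\<forall>v\<in>V. v < n ^ cI) \<and>
     E \<subseteq> V \<times> V \<and> (\<forall>v. (v, v) \<notin> E) \<and>
     (\<forall>e\<in>E. 0 < w e \<and> w e \<le> n ^ cW) \<and>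
     connected_und V E \<and>
     s \<in> V \<and> t \<in> V \<and>
     is_path V E P \<and> hd P = s \<and> last P = t \<and>
     enat (path_len w P) = sp_dist V E w s t"

section \<open>The randomized CONGEST model\<close>

text \<open>Local input of a vertex v: (n, own identifier, outgoing edges with weights,
  incoming edges with weights, is source, is target, incident edges of P).\<close>
type_synonym linput =
  "nat \<times> nat \<times> (nat \<times> nat) set \<times> (nat \<times> nat) set \<times> bool \<times> bool \<times> (nat \<times> nat) set"

definition local_input ::
  "nat \<Rightarrow> (nat \<times> nat) set \<Rightarrow> (nat \<times> nat \<Rightarrow> nat) \<Rightarrow> nat \<Rightarrow> nat \<Rightarrow> nat list \<Rightarrow> nat \<Rightarrow> linput" where
  "local_input n E w s t P v =
     (n, v,
      {(u, w (v, u)) | u. (v, u) \<in> E},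
      {(u, w (u, v)) | u. (u, v) \<in> E},
      v = s, v = t,
      {e. e \<in> set (edges_of P) \<and> (fst e = v \<or> snd e = v)})"

text \<open>An algorithm: local states and messages are bit strings (unlimited local
  computation). Each round, every vertex sends a (possibly empty) message to each
  neighbour (addressed by identifier), receives the messages of its neighbours and
  performs a randomized local transition. Each vertex may irrevocably output a value
  (the first non-None output is its final output).\<close>
record congest_alg =
  alg_init :: "linput \<Rightarrow> bool list"
  alg_send :: "bool list \<Rightarrow> nat \<Rightarrow> bool list option"
  alg_step :: "bool list \<Rightarrow> (nat \<Rightarrow> bool list option) \<Rightarrow> bool list pmf"
  alg_out  :: "bool list \<Rightarrow> enat option"

type_synonym config = "nat \<Rightarrow> bool list"

text \<open>Messages are truncated to the bandwidth bw bits.\<close>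
definition inbox :: "congest_alg \<Rightarrow> nat \<Rightarrow> (nat \<times> nat) set \<Rightarrow> config \<Rightarrow> nat \<Rightarrow> nat \<Rightarrow> bool list option" where
  "inbox A bw E c v u =
     (if u \<in> nbrs E v then map_option (take bw) (alg_send A (c u) v) else None)"

text \<open>Distribution of the history (list of configurations after rounds 0..T).\<close>
fun run :: "congest_alg \<Rightarrow> nat \<Rightarrow> nat set \<Rightarrow> (nat \<times> nat) set \<Rightarrow> (nat \<Rightarrow> linput) \<Rightarrow> nat
             \<Rightarrow> config list pmf" where
  "run A bw V E inp 0 = return_pmf [(\<lambda>v. if v \<in> V then alg_init A (inp v) else [])]"
| "run A bw V E inp (Suc T) =
     bind_pmf (run A bw V E inp T)
       (\<lambda>h. map_pmf (\<lambda>c. h @ [c])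
              (Pi_pmf V [] (\<lambda>v. alg_step A (last h v) (inbox A bw E (last h) v))))"

text \<open>The irrevocable output of vertex v in a history (first non-None output).\<close>
definition committed :: "congest_alg \<Rightarrow> config list \<Rightarrow> nat \<Rightarrow> enat option" where
  "committed A h v =
     (case find (\<lambda>c. alg_out A (c v) \<noteq> None) h of None \<Rightarrow> None | Some c \<Rightarrow> alg_out A (c v))"

text \<open>x is a (1+eps)-approximation of d (d = infinity requires x = infinity).\<close>
definition approx_ok :: "real \<Rightarrow> enat \<Rightarrow> enat \<Rightarrow> bool" where
  "approx_ok eps d x \<longleftrightarrow>
     (if d = \<infinity> then x = \<infinity>
      else x \<noteq> \<infinity> \<and> d \<le> x \<and> real (the_enat x) \<le> (1 + eps) * real (the_enat d))"

text \<open>Success: for every edge e_i = (v_i, v_(i+1)) of P, its first endpoint v_i has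
  output a (1+eps)-approximation of |st<>e_i|.\<close>
definition rpaths_success ::
  "real \<Rightarrow> congest_alg \<Rightarrow> nat set \<Rightarrow> (nat \<times> nat) set \<Rightarrow> (nat \<times> nat \<Rightarrow> nat) \<Rightarrow> nat \<Rightarrow> nat
     \<Rightarrow> nat list \<Rightarrow> config list \<Rightarrow> bool" where
  "rpaths_success eps A V E w s t P h \<longleftrightarrow>
     (\<forall>i < length P - 1. \<exists>x. committed A h (P ! i) = Some x \<and>
         approx_ok eps (repl_dist V E w s t (P ! i, P ! Suc i)) x)"

end

theory Submission
  imports Defs
begin

text \<open>
  Write \<open>P = (v\<^sub>0, \<dots>, v\<^sub>h)\<close>. As \<open>P\<close> is a shortest path, the replacement length of its \<open>i\<close>-th edge is the
  minimum over \<open>a \<le> i < b\<close> of (prefix up to \<open>v\<^sub>a\<close>) + (distance from \<open>v\<^sub>a\<close> to \<open>v\<^sub>b\<close> without the edges of \<open>P\<close>) +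
  (suffix from \<open>v\<^sub>b\<close>). Random landmarks hit every \<open>n\<^bsup>2/3\<^esup>\<close> consecutive vertices of \<open>P\<close> and of one shortest
  detour per pair, and there are only about \<open>n\<^bsup>1/3\<^esup>\<close> of them. A detour therefore splits at landmarks into pieces
  of at most \<open>n\<^bsup>2/3\<^esup>\<close> edges, and after rounding the weights at every scale a piece has rounded cost \<open>O(n\<^bsup>2/3\<^esup>)\<close>.

  For the last piece every vertex learns, for each scale and rounded cost, the farthest point of \<open>P\<close> it
  reaches; farther is always better, since the suffix gets shorter and more edges are bypassed. For the other
  pieces every vertex learns its rounded distances to all landmarks, by a schedule in which a distance \<open>d\<close> is
  forwarded in round \<open>d\<close> plus its rank. The landmarks broadcast their tables, about \<open>n\<^bsup>2/3\<^esup>\<close> items in total.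

  Then \<open>v\<^sub>a\<close> knows, for each of logarithmically many total lengths \<open>y\<close>, the farthest \<open>v\<^sub>b\<close> for which leaving \<open>P\<close>
  at \<open>v\<^sub>a\<close> and returning at \<open>v\<^sub>b\<close> costs at most \<open>y\<close>. The answer for edge \<open>i\<close> is the least \<open>y\<close> for which the maximum
  of these over \<open>a \<le> i\<close> lies beyond \<open>v\<^sub>i\<close>, so that a single prefix maximum along \<open>P\<close> remains; it is computed inside
  the segments between landmarks and combined by a broadcast. Messages of polylogarithmic size are sent bit by bit.
\<close>

section \<open>Polylogarithmic bounds\<close>

text \<open>The exponent balances two costs. If landmarks hit every \<open>z\<close> consecutive
  vertices, about \<open>n / z\<close> of them suffice; distances within a piece take about
  \<open>z\<close> rounds, broadcasting all pairs of landmarks about \<open>(n / z) ^ 2\<close>, and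
  both agree at \<open>z = n powr (2/3)\<close>. The error has three sources: rounding up the
  weights of at most \<open>z\<close> edges, rounding a cost up to a multiple of \<open>z\<close> (a
  share of \<open>1 / e0\<close> each), and letting budgets run only through powers of
  \<open>rr\<close>. Every piece uses its own scale, so its error is relative to its own length and
  the number of pieces does not matter. The obstacle in the model is that no vertex knows
  \<open>D\<close>, while every phase must begin in the same round everywhere. Hence the
  eccentricity of the source is computed first, along with a common moment at which all vertices
  know it to be final; any two vertices are within twice this value. Probability is confined to one
  coin per vertex in the first round: correctness is a deterministic statement about instances whose
  landmarks are few and hit, and only the frequency of such landmarks is estimated.\<close>

definition plog :: "(nat \<Rightarrow> nat) \<Rightarrow> bool" where
  "plog f \<longleftrightarrow> (\<exists>C k. \<forall>n\<ge>2. real (f n) \<le> C * log 2 (real n) ^ k)"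

lemma log2_ge_1: "n \<ge> (2::nat) \<Longrightarrow> log 2 (real n) \<ge> 1"
  by simp

lemma plog_const: "plog (\<lambda>n. c)"
  unfolding plog_def by (rule exI[of _ "real c"], rule exI[of _ 0]) simp

text \<open>As \<open>log 2 n \<ge> 1\<close>, the exponent may be any \<open>m \<ge> k\<close>; two
  bounds can thus be brought to a common exponent before they are added.\<close>

lemma plogE:
  assumes "plog f"
  obtains C k where "C \<ge> 0" "\<And>n m. n \<ge> 2 \<Longrightarrow> m \<ge> k \<Longrightarrow> real (f n) \<le> C * log 2 (real n) ^ m"
proof -
  obtain C k where Ck: "\<forall>n\<ge>2. real (f n) \<le> C * log 2 (real n) ^ k"
    using assms unfolding plog_def by blast
  have C: "C \<ge> 0"
    using Ck[rule_format, of 2] by (simp add: order_trans[of 0 "real (f 2)"])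
  have "real (f n) \<le> C * log 2 (real n) ^ m" if "n \<ge> 2" "m \<ge> k" for n m
  proof -
    have "real (f n) \<le> C * log 2 (real n) ^ k" using Ck that by blast
    also have "\<dots> \<le> C * log 2 (real n) ^ m"
      using C that log2_ge_1[of n] by (intro mult_left_mono power_increasing) auto
    finally show ?thesis .
  qed
  with C show ?thesis using that by blast
qed

lemma plog_add: assumes "plog f" "plog g" shows "plog (\<lambda>n. f n + g n)"
proof -
  obtain C k where 1: "\<And>n m. n \<ge> 2 \<Longrightarrow> m \<ge> k \<Longrightarrow> real (f n) \<le> C * log 2 (real n) ^ m"
    using plogE[OF assms(1)] by metis
  obtain C' k' where 2: "\<And>n m. n \<ge> 2 \<Longrightarrow> m \<ge> k' \<Longrightarrow> real (g n) \<le> C' * log 2 (real n) ^ m"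
    using plogE[OF assms(2)] by metis
  have "real (f n + g n) \<le> (C + C') * log 2 (real n) ^ (max k k')" if "n \<ge> 2" for n
    using 1[OF that, of "max k k'"] 2[OF that, of "max k k'"] by (simp add: distrib_right)
  then show ?thesis unfolding plog_def by blast
qed

lemma plog_mult: assumes "plog f" "plog g" shows "plog (\<lambda>n. f n * g n)"
proof -
  obtain C k where 1: "C \<ge> 0" "\<And>n m. n \<ge> 2 \<Longrightarrow> m \<ge> k \<Longrightarrow> real (f n) \<le> C * log 2 (real n) ^ m"
    using plogE[OF assms(1)] by metis
  obtain C' k' where 2: "C' \<ge> 0" "\<And>n m. n \<ge> 2 \<Longrightarrow> m \<ge> k' \<Longrightarrow> real (g n) \<le> C' * log 2 (real n) ^ m"
    using plogE[OF assms(2)] by metis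
  have "real (f n * g n) \<le> (C * C') * log 2 (real n) ^ (k + k')" if "n \<ge> 2" for n
  proof -
    have "real (f n) * real (g n) \<le> (C * log 2 (real n) ^ k) * (C' * log 2 (real n) ^ k')"
      using 1 2 that log2_ge_1[OF that] by (intro mult_mono) auto
    then show ?thesis by (simp add: power_add mult_ac)
  qed
  then show ?thesis unfolding plog_def by blast
qed

lemma plog_real:
  assumes "\<And>n. n \<ge> 2 \<Longrightarrow> real (f n) \<le> a * log 2 (real n) + b"
  shows "plog f"
proof -
  have "real (f n) \<le> (\<bar>a\<bar> + \<bar>b\<bar>) * log 2 (real n) ^ 1" if "n \<ge> 2" for n
  proof -
    have "a * log 2 (real n) \<le> \<bar>a\<bar> * log 2 (real n)"
      using log2_ge_1[OF that] by (intro mult_right_mono) auto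
    moreover have "b \<le> \<bar>b\<bar> * log 2 (real n)"
      using mult_left_mono[OF log2_ge_1[OF that], of "\<bar>b\<bar>"] by simp
    ultimately show ?thesis using assms[OF that] by (simp add: distrib_right)
  qed
  then show ?thesis unfolding plog_def by blast
qed

definition lg :: "nat \<Rightarrow> nat" where "lg n = nat \<lceil>log 2 (real n)\<rceil>"

lemma plog_lg: "plog lg"
  by (rule plog_real[of _ 1 1]) (use log2_ge_1 in \<open>simp add: lg_def\<close>; linarith)

lemma le_power_lg: "n \<ge> 1 \<Longrightarrow> n \<le> 2 ^ lg n"
proof -
  assume n: "n \<ge> 1"
  have "real n = 2 powr (log 2 (real n))" using n by simp
  also have "\<dots> \<le> 2 powr (real (lg n))"
    using n by (intro powr_mono) (auto simp: lg_def intro: order_trans[OF le_of_int_ceiling])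
  also have "\<dots> = real (2 ^ lg n)" by (simp add: powr_realpow)
  finally show ?thesis by linarith
qed

section \<open>Message alphabets whose symbols fit into polylogarithmically many bits\<close>

definition small :: "(nat \<Rightarrow> 'm set) \<Rightarrow> bool" where
  "small S \<longleftrightarrow> (\<exists>W. plog W \<and> (\<forall>n\<ge>2. finite (S n) \<and> card (S n) \<le> 2 ^ W n))"

lemma smallI: "plog W \<Longrightarrow> (\<And>n. n \<ge> 2 \<Longrightarrow> finite (S n)) \<Longrightarrow> (\<And>n. n \<ge> 2 \<Longrightarrow> card (S n) \<le> 2 ^ W n)
  \<Longrightarrow> small S"
  unfolding small_def by blast

lemma smallE: assumes "small S"
  obtains W where "plog W" "\<And>n. n \<ge> 2 \<Longrightarrow> finite (S n)" "\<And>n. n \<ge> 2 \<Longrightarrow> card (S n) \<le> 2 ^ W n"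
  using assms unfolding small_def by blast

lemma small_image: assumes "small S" shows "small (\<lambda>n. g n ` S n)"
proof -
  obtain W where W: "plog W" "\<And>n. n \<ge> 2 \<Longrightarrow> finite (S n)" "\<And>n. n \<ge> 2 \<Longrightarrow> card (S n) \<le> 2 ^ W n"
    using smallE[OF assms] by metis
  show ?thesis
    by (rule smallI[OF W(1)]) (use W in \<open>auto intro: order_trans[OF card_image_le]\<close>)
qed

lemma small_Un: assumes "small S" "small S'" shows "small (\<lambda>n. S n \<union> S' n)"
proof -
  obtain W where W: "plog W" "\<And>n. n \<ge> 2 \<Longrightarrow> finite (S n)" "\<And>n. n \<ge> 2 \<Longrightarrow> card (S n) \<le> 2 ^ W n"
    using smallE[OF assms(1)] by metis
  obtain U where U: "plog U" "\<And>n. n \<ge> 2 \<Longrightarrow> finite (S' n)" "\<And>n. n \<ge> 2 \<Longrightarrow> card (S' n) \<le> 2 ^ U n"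
    using smallE[OF assms(2)] by metis
  have "card (S n \<union> S' n) \<le> 2 ^ (W n + U n + 1)" if "n \<ge> 2" for n
  proof -
    have "card (S n \<union> S' n) \<le> 2 ^ W n + 2 ^ U n"
      using W(3)[OF that] U(3)[OF that] card_Un_le[of "S n" "S' n"] by linarith
    also have "\<dots> \<le> 2 ^ (W n + U n) + 2 ^ (W n + U n)"
      by (intro add_mono power_increasing) auto
    finally show ?thesis by simp
  qed
  then show ?thesis
    by (intro smallI[of "\<lambda>n. W n + U n + 1"] plog_add plog_const W U) (use W U in auto)
qed

lemma small_Times: assumes "small S" "small S'" shows "small (\<lambda>n. S n \<times> S' n)"
proof -
  obtain W where W: "plog W" "\<And>n. n \<ge> 2 \<Longrightarrow> finite (S n)" "\<And>n. n \<ge> 2 \<Longrightarrow> card (S n) \<le> 2 ^ W n"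
    using smallE[OF assms(1)] by metis
  obtain U where U: "plog U" "\<And>n. n \<ge> 2 \<Longrightarrow> finite (S' n)" "\<And>n. n \<ge> 2 \<Longrightarrow> card (S' n) \<le> 2 ^ U n"
    using smallE[OF assms(2)] by metis
  show ?thesis
    by (rule smallI[OF plog_add[OF W(1) U(1)]])
       (use W U in \<open>auto simp: card_cartesian_product power_add intro!: mult_mono\<close>)
qed

lemma small_single: "small (\<lambda>n. {c n})"
  by (rule smallI[OF plog_const[of 0]]) auto

lemma small_atMost_poly: "small (\<lambda>n. {..C * n ^ K})"
proof (rule smallI)
  show "plog (\<lambda>n. K * lg n + Suc C)" by (intro plog_add plog_mult plog_const plog_lg)
  fix n :: nat assume n: "n \<ge> 2"
  have "n ^ K \<le> (2 ^ lg n) ^ K" using le_power_lg[of n] n by (intro power_mono) auto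
  then have "n ^ K \<le> 2 ^ (K * lg n)" by (simp add: power_mult[symmetric] mult.commute)
  moreover have "Suc C \<le> 2 ^ C" using less_exp[of C] by (simp add: Suc_leI)
  ultimately have "Suc C * n ^ K \<le> 2 ^ C * 2 ^ (K * lg n)" by (intro mult_mono) auto
  moreover have "n ^ K \<ge> 1" using n by simp
  moreover have "card {..C * n ^ K} = C * n ^ K + 1" by simp
  ultimately have "card {..C * n ^ K} \<le> 2 ^ C * 2 ^ (K * lg n)" by (simp add: algebra_simps)
  also have "\<dots> \<le> 2 ^ (K * lg n + Suc C)" by (simp add: power_add)
  finally show "card {..C * n ^ K} \<le> 2 ^ (K * lg n + Suc C)" .
qed simp

text \<open>For messages that carry one entry per scale or per budget level.\<close>

lemma small_lists: assumes "small S" "plog l"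
  shows "small (\<lambda>n. {xs. set xs \<subseteq> S n \<and> length xs \<le> l n})"
proof -
  obtain W where W: "plog W" "\<And>n. n \<ge> 2 \<Longrightarrow> finite (S n)" "\<And>n. n \<ge> 2 \<Longrightarrow> card (S n) \<le> 2 ^ W n"
    using smallE[OF assms(1)] by metis
  have "card {xs. set xs \<subseteq> S n \<and> length xs \<le> l n} \<le> 2 ^ (l n + W n * l n)" if n: "n \<ge> 2" for n
  proof -
    have "card {xs. set xs \<subseteq> S n \<and> length xs \<le> l n} = (\<Sum>i\<le>l n. card (S n) ^ i)"
      by (rule card_lists_length_le) (use W n in auto)
    also have "\<dots> \<le> (\<Sum>i\<le>l n. (2 ^ W n) ^ l n)"
    proof (rule sum_mono)
      fix i assume i: "i \<in> {..l n}"
      have "card (S n) ^ i \<le> (2 ^ W n) ^ i" using W(3)[OF n] by (intro power_mono) auto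
      also have "\<dots> \<le> (2 ^ W n) ^ l n" using i by (intro power_increasing) auto
      finally show "card (S n) ^ i \<le> (2 ^ W n) ^ l n" .
    qed
    also have "\<dots> = Suc (l n) * 2 ^ (W n * l n)" by (simp add: power_mult)
    also have "\<dots> \<le> 2 ^ l n * 2 ^ (W n * l n)"
      using less_exp[of "l n"] by (intro mult_mono) (auto simp: Suc_leI)
    finally show ?thesis by (simp add: power_add)
  qed
  then show ?thesis
    by (intro smallI[of "\<lambda>n. l n + W n * l n"] plog_add plog_mult W assms)
       (use W in \<open>auto intro: finite_lists_length_le\<close>)
qed

section \<open>Knowledge computable by a synchronous protocol\<close>

text \<open>The outcome \<open>LL\<close> of the coin tosses is part of the instance, so that everything after the first round is
  deterministic.\<close>

record inst =
  nn :: nat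
  VV :: "nat set"
  EE :: "(nat \<times> nat) set"
  ww :: "nat \<times> nat \<Rightarrow> nat"
  ss :: nat
  tt :: nat
  PP :: "nat list"
  LL :: "nat set"

text \<open>Local data are kept as lists because states must be of a countable type to be coded as
  bit strings; which enumeration is chosen is immaterial.\<close>

definition list_of :: "'a set \<Rightarrow> 'a list" where "list_of A = (SOME xs. set xs = A)"

lemma set_lst [simp]: "finite A \<Longrightarrow> set (list_of A) = A"
  unfolding list_of_def by (rule someI_ex) (rule finite_list)

type_synonym loc = "nat \<times> nat \<times> (nat \<times> nat) list \<times> (nat \<times> nat) list \<times> bool \<times> bool \<times> (nat \<times> nat) list \<times> bool"

definition locof :: "linput \<Rightarrow> bool \<Rightarrow> loc" where
  "locof = (\<lambda>(n, v, Os, Is, a, b, pe) c. (n, v, list_of Os, list_of Is, a, b, list_of pe, c))"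

definition loc :: "inst \<Rightarrow> nat \<Rightarrow> loc" where
  "loc I v = locof (local_input (nn I) (EE I) (ww I) (ss I) (tt I) (PP I) v) (v \<in> LL I)"

fun exec :: "(nat \<Rightarrow> nat \<Rightarrow> nat) \<Rightarrow> (nat \<Rightarrow> (nat \<Rightarrow> nat option) \<Rightarrow> nat) \<Rightarrow> (nat \<Rightarrow> nat)
    \<Rightarrow> (nat \<times> nat) set \<Rightarrow> nat \<Rightarrow> nat \<Rightarrow> nat" where
  "exec send upd i0 E 0 v = i0 v"
| "exec send upd i0 E (Suc j) v = upd (exec send upd i0 E j v)
     (\<lambda>u. if u \<in> nbrs E v then Some (send (exec send upd i0 E j u) v) else None)"

text \<open>Nothing is asked of messages from round \<open>T I\<close> on: by then a later phase has
  taken over or the output is committed.\<close>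

definition good_protocol where
  "good_protocol G T X ini send upd hlt out Ms \<longleftrightarrow> small Ms \<and>
    (\<forall>I\<in>G. \<forall>v\<in>VV I.
       (\<forall>j<T I. \<not> hlt (exec send upd (\<lambda>v. ini (loc I v)) (EE I) j v) \<and>
          (\<forall>u. send (exec send upd (\<lambda>v. ini (loc I v)) (EE I) j v) u \<in> Ms (nn I))) \<and>
       hlt (exec send upd (\<lambda>v. ini (loc I v)) (EE I) (T I) v) \<and>
       out (exec send upd (\<lambda>v. ini (loc I v)) (EE I) (T I) v) = X I v)"

text \<open>All vertices hold the local knowledge \<open>X I v\<close> after exactly \<open>T I\<close> synchronous rounds and
  recognise that moment; this is what allows protocols to be run one after the other although the
  number of rounds depends on the diameter.\<close>

definition computable :: "inst set \<Rightarrow> (inst \<Rightarrow> nat) \<Rightarrow> (inst \<Rightarrow> nat \<Rightarrow> 'x) \<Rightarrow> bool" where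
  "computable G T X \<longleftrightarrow> (\<exists>ini send upd hlt out Ms. good_protocol G T X ini send upd hlt out Ms)"

definition wf_net :: "inst set \<Rightarrow> bool" where
  "wf_net G \<longleftrightarrow> (\<forall>I\<in>G. EE I \<subseteq> VV I \<times> VV I)"

lemma wf_netD: "wf_net G \<Longrightarrow> I \<in> G \<Longrightarrow> u \<in> nbrs (EE I) v \<Longrightarrow> u \<in> VV I"
  unfolding wf_net_def nbrs_def und_edges_def by blast

lemma computable_loc: "computable G (\<lambda>I. 0) loc"
  unfolding computable_def good_protocol_def
  by (rule exI[of _ to_nat], rule exI[of _ "\<lambda>_ _. 0"], rule exI[of _ "\<lambda>_ _. 0"],
      rule exI[of _ "\<lambda>_. True"], rule exI[of _ from_nat], rule exI[of _ "\<lambda>_. {0}"])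
     (use small_single[of "\<lambda>_. 0"] in auto)

lemma computable_map:
  assumes "computable G T X" and "\<And>I v. I \<in> G \<Longrightarrow> v \<in> VV I \<Longrightarrow> Y I v = g (X I v)"
  shows "computable G T Y"
proof -
  obtain ini send upd hlt out Ms where "good_protocol G T X ini send upd hlt out Ms"
    using assms(1) unfolding computable_def by blast
  then have "good_protocol G T Y ini send upd hlt (g \<circ> out) Ms"
    unfolding good_protocol_def using assms(2) by auto
  then show ?thesis unfolding computable_def by blast
qed

text \<open>The phases need no synchronising signal: all vertices reach a halting state in the same
  round \<open>T I\<close>, and \<open>conv\<close> replaces that state by the start of the second
  phase within the same update. The left summand means that the first phase still runs, so the phase
  of the receiver tells how to decode a message. The length \<open>R I\<close> need not be known
  beforehand; it is recognised by \<open>h\<close>.\<close>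

lemma computable_halt:
  fixes X :: "inst \<Rightarrow> nat \<Rightarrow> 'x" and Y :: "inst \<Rightarrow> nat \<Rightarrow> nat \<Rightarrow> 'y::countable"
    and M :: "nat \<Rightarrow> 'm::countable set"
  assumes wf: "wf_net G" and X: "computable G T X"
    and Y0: "\<And>I v. I \<in> G \<Longrightarrow> v \<in> VV I \<Longrightarrow> Y I 0 v = yi (X I v)"
    and YS: "\<And>I v j. I \<in> G \<Longrightarrow> v \<in> VV I \<Longrightarrow> j < R I \<Longrightarrow> Y I (Suc j) v =
       up (Y I j v) (\<lambda>u. if u \<in> nbrs (EE I) v then Some (sd (Y I j u) v) else None)"
    and H: "\<And>I v j. I \<in> G \<Longrightarrow> v \<in> VV I \<Longrightarrow> j < R I \<Longrightarrow> \<not> h (Y I j v)"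
      "\<And>I v. I \<in> G \<Longrightarrow> v \<in> VV I \<Longrightarrow> h (Y I (R I) v)"
    and M: "small M" "\<And>I v j u. I \<in> G \<Longrightarrow> v \<in> VV I \<Longrightarrow> j < R I \<Longrightarrow> sd (Y I j v) u \<in> M (nn I)"
  shows "computable G (\<lambda>I. T I + R I) (\<lambda>I v. Y I (R I) v)"
proof -
  obtain ini send upd hlt out Ms where gp: "good_protocol G T X ini send upd hlt out Ms"
    using X unfolding computable_def by blast
  let ?st = "\<lambda>I. exec send upd (\<lambda>v. ini (loc I v)) (EE I)"
  define conv :: "nat \<Rightarrow> nat + 'y" where "conv s = (if hlt s then Inr (yi (out s)) else Inl s)" for s
  define ini' where "ini' l = to_nat (conv (ini l))" for l
  define send' where "send' s u = (case from_nat s of Inl a \<Rightarrow> send a u | Inr (y::'y) \<Rightarrow> to_nat (sd y u))"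
    for s u
  define upd' where "upd' s ib = (case from_nat s of Inl a \<Rightarrow> to_nat (conv (upd a ib))
     | Inr (y::'y) \<Rightarrow> to_nat (Inr (up y (\<lambda>u. map_option from_nat (ib u))) :: nat + 'y))" for s ib
  define hlt' where "hlt' s = (case from_nat s :: nat + 'y of Inl a \<Rightarrow> False | Inr y \<Rightarrow> h y)" for s
  define out' where "out' s = (case from_nat s :: nat + 'y of Inl a \<Rightarrow> undefined | Inr y \<Rightarrow> y)" for s
  have updl: "upd' (to_nat (Inl a :: nat + 'y)) ib = to_nat (conv (upd a ib))" for a ib
    by (simp add: upd'_def)
  have updr: "upd' (to_nat (Inr y :: nat + 'y)) ib = to_nat (Inr (up y (\<lambda>u. map_option from_nat (ib u))) :: nat + 'y)" for y ib
    by (simp add: upd'_def)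
  let ?st' = "\<lambda>I. exec send' upd' (\<lambda>v. ini' (loc I v)) (EE I)"
  have hl: "\<not> hlt (?st I j v)" "send (?st I j v) u \<in> Ms (nn I)"
    if "I \<in> G" "v \<in> VV I" "j < T I" for I v j u
    using gp that unfolding good_protocol_def by blast+
  have hT: "hlt (?st I (T I) v)" "out (?st I (T I) v) = X I v"
    if "I \<in> G" "v \<in> VV I" for I v
    using gp that unfolding good_protocol_def by blast+
  have sMs: "small Ms" using gp unfolding good_protocol_def by blast
  have A: "?st' I j v = to_nat (conv (?st I j v))"
    if I: "I \<in> G" and "v \<in> VV I" "j \<le> T I" for I v j
    using that(2,3)
  proof (induction j arbitrary: v)
    case 0
    then show ?case by (simp add: ini'_def)
  next
    case (Suc j)
    have e: "?st' I j x = to_nat (Inl (?st I j x) :: nat + 'y)" if "x \<in> VV I" for x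
      using Suc.IH[OF that] Suc.prems hl(1)[OF I that, of j] by (simp add: conv_def)
    have "(\<lambda>u. if u \<in> nbrs (EE I) v then Some (send' (?st' I j u) v) else None)
        = (\<lambda>u. if u \<in> nbrs (EE I) v then Some (send (?st I j u) v) else None)"
      by (rule ext) (use wf_netD[OF wf I] e in \<open>auto simp: send'_def\<close>)
    then show ?case using e[OF Suc.prems(1)] by (simp add: updl)
  qed
  have B: "?st' I (T I + j) v = to_nat (Inr (Y I j v) :: nat + 'y)"
    if I: "I \<in> G" and "v \<in> VV I" "j \<le> R I" for I v j
    using that(2,3)
  proof (induction j arbitrary: v)
    case 0
    then show ?case using A[OF I 0(1), of "T I"] hT[OF I 0(1)] Y0[OF I 0(1)] by (simp add: conv_def)
  next
    case (Suc j)
    have e: "?st' I (T I + j) x = to_nat (Inr (Y I j x) :: nat + 'y)" if "x \<in> VV I" for x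
      using Suc.IH[OF that] Suc.prems by simp
    have "(\<lambda>u. map_option from_nat (if u \<in> nbrs (EE I) v then Some (send' (?st' I (T I + j) u) v) else None))
        = (\<lambda>u. if u \<in> nbrs (EE I) v then Some (sd (Y I j u) v) else None)"
      by (rule ext) (use wf_netD[OF wf I] e in \<open>auto simp: send'_def\<close>)
    then show ?case using e[OF Suc.prems(1)] YS[OF I Suc.prems(1), of j] Suc.prems
      by (simp add: updr)
  qed
  have "good_protocol G (\<lambda>I. T I + R I) (\<lambda>I v. Y I (R I) v) ini' send' upd' hlt' out'
      (\<lambda>n. Ms n \<union> to_nat ` M n)"
    unfolding good_protocol_def
  proof (intro conjI ballI allI impI)
    show "small (\<lambda>n. Ms n \<union> to_nat ` M n)"
      by (intro small_Un sMs small_image M)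
    fix I v assume I: "I \<in> G" and v: "v \<in> VV I"
    show "hlt' (?st' I (T I + R I) v)" "out' (?st' I (T I + R I) v) = Y I (R I) v"
      using B[OF I v, of "R I"] H(2)[OF I v] by (simp_all add: hlt'_def out'_def)
    fix j assume j: "j < T I + R I"
    have "\<not> hlt' (?st' I j v) \<and> send' (?st' I j v) u \<in> Ms (nn I) \<union> to_nat ` M (nn I)" for u
    proof (cases "j < T I")
      case True
      then show ?thesis using A[OF I v, of j] hl(1)[OF I v True] hl(2)[OF I v True, of u] by (simp add: conv_def hlt'_def send'_def)
    next
      case False
      then obtain i where i: "j = T I + i" "i < R I" using j by (metis add_diff_inverse_nat nat_add_left_cancel_less)
      then show ?thesis using B[OF I v, of i] H(1)[OF I v, of i] M(2)[OF I v, of i u]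
        by (simp add: hlt'_def send'_def)
    qed
    then show "\<not> hlt' (?st' I j v)" "\<And>u. send' (?st' I j v) u \<in> Ms (nn I) \<union> to_nat ` M (nn I)" by blast+
  qed
  then show ?thesis unfolding computable_def by blast
qed

text \<open>When all vertices can compute the length of the phase from what they know, a round
  counter in the state serves as halting condition; it is also passed to the transition and to the
  message function.\<close>

lemma computable_rounds:
  fixes X :: "inst \<Rightarrow> nat \<Rightarrow> 'x::countable" and Y :: "inst \<Rightarrow> nat \<Rightarrow> nat \<Rightarrow> 'y::countable"
    and M :: "nat \<Rightarrow> 'm::countable set"
  assumes wf: "wf_net G" and X: "computable G T X"
    and R: "\<And>I v. I \<in> G \<Longrightarrow> v \<in> VV I \<Longrightarrow> R I = r (X I v)"
    and Y0: "\<And>I v. I \<in> G \<Longrightarrow> v \<in> VV I \<Longrightarrow> Y I 0 v = yi (X I v)"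
    and YS: "\<And>I v j. I \<in> G \<Longrightarrow> v \<in> VV I \<Longrightarrow> j < R I \<Longrightarrow> Y I (Suc j) v =
       up j (X I v) (Y I j v) (\<lambda>u. if u \<in> nbrs (EE I) v then Some (sd j (X I u) (Y I j u) v) else None)"
    and M: "small M"
      "\<And>I v j u. I \<in> G \<Longrightarrow> v \<in> VV I \<Longrightarrow> j < R I \<Longrightarrow> sd j (X I v) (Y I j v) u \<in> M (nn I)"
  shows "computable G (\<lambda>I. T I + R I) (\<lambda>I v. (X I v, Y I (R I) v))"
proof -
  let ?Y = "\<lambda>I j v. (j, X I v, Y I j v)"
  have "computable G (\<lambda>I. T I + R I) (\<lambda>I v. ?Y I (R I) v)"
    by (rule computable_halt[where Y = ?Y and yi = "\<lambda>x. (0, x, yi x)" and h = "\<lambda>(j, x, y). j = r x"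
          and up = "\<lambda>(j, x, y) ib. (Suc j, x, up j x y ib)" and sd = "\<lambda>(j, x, y) u. sd j x y u", OF wf X])
       (use Y0 YS R M in auto)
  then show ?thesis by (rule computable_map[where g = snd]) simp
qed

section \<open>Bitwise simulation in the CONGEST model\<close>

text \<open>A unary code: the model does not limit the size of states, so only decodability
  counts.\<close>

definition to_bits :: "'a::countable \<Rightarrow> bool list" where "to_bits x = replicate (to_nat x) True"
definition of_bits :: "bool list \<Rightarrow> 'a::countable" where "of_bits b = from_nat (length b)"

lemma of_bits_to_bits [simp]: "of_bits (to_bits x) = x"
  by (simp add: of_bits_def to_bits_def)

text \<open>Neighbours, \<open>n\<close>, simulated state, number of bits of the current message
  already exchanged, and the bits received so far, one association list per bit.\<close>

type_synonym sim_state = "nat list \<times> nat \<times> nat \<times> nat \<times> (nat \<times> bool) list list"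

definition sim_step :: "(nat \<Rightarrow> nat) \<Rightarrow> (nat \<Rightarrow> bool list \<Rightarrow> nat) \<Rightarrow> (nat \<Rightarrow> (nat \<Rightarrow> nat option) \<Rightarrow> nat)
    \<Rightarrow> sim_state \<Rightarrow> (nat \<Rightarrow> bool list option) \<Rightarrow> sim_state" where
  "sim_step W dec upd = (\<lambda>(nb, n, s, c, buf) ib.
     let buf' = buf @ [map (\<lambda>u. (u, ib u = Some [True])) nb] in
     if Suc c = W n
     then (nb, n, upd s (\<lambda>u. if u \<in> set nb then Some (dec n (map (\<lambda>al. the (map_of al u)) buf')) else None), 0, [])
     else (nb, n, s, Suc c, buf'))"

definition nbl :: "loc \<Rightarrow> nat list" where
  "nbl = (\<lambda>(n, v, os, is, a, b, pe, c). map fst os @ map fst is)"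

definition sim_start :: "(loc \<Rightarrow> nat) \<Rightarrow> loc \<Rightarrow> sim_state" where
  "sim_start ini l = (nbl l, fst l, ini l, 0, [])"

definition set_coin :: "loc \<Rightarrow> bool \<Rightarrow> loc" where
  "set_coin = (\<lambda>(n, v, os, is, a, b, pe, _) c. (n, v, os, is, a, b, pe, c))"

text \<open>\<open>alg_init\<close> is deterministic, so the coin is tossed in the first transition.
  The left summand is the state before it: nothing is sent, and the coin slot of \<open>loc\<close>
  holds the placeholder \<open>False\<close> until \<open>set_coin\<close> fills it.\<close>

definition sim_alg :: "(nat \<Rightarrow> real) \<Rightarrow> (nat \<Rightarrow> nat) \<Rightarrow> (nat \<Rightarrow> nat \<Rightarrow> bool list) \<Rightarrow> (nat \<Rightarrow> bool list \<Rightarrow> nat)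
   \<Rightarrow> (loc \<Rightarrow> nat) \<Rightarrow> (nat \<Rightarrow> nat \<Rightarrow> nat) \<Rightarrow> (nat \<Rightarrow> (nat \<Rightarrow> nat option) \<Rightarrow> nat) \<Rightarrow> (nat \<Rightarrow> bool) \<Rightarrow> (nat \<Rightarrow> enat)
   \<Rightarrow> congest_alg" where
  "sim_alg p W enc dec ini send upd hlt out = \<lparr>
     alg_init = (\<lambda>l. to_bits (Inl (locof l False) :: loc + sim_state)),
     alg_send = (\<lambda>b v. case of_bits b :: loc + sim_state of Inl _ \<Rightarrow> None
        | Inr (nb, n, s, c, buf) \<Rightarrow> Some [enc n (send s v) ! c]),
     alg_step = (\<lambda>b ib. case of_bits b :: loc + sim_state of
          Inl l \<Rightarrow> map_pmf (\<lambda>c. to_bits (Inr (sim_start ini (set_coin l c)) :: loc + sim_state)) (bernoulli_pmf (p (fst l)))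
        | Inr m \<Rightarrow> return_pmf (to_bits (Inr (sim_step W dec upd m ib) :: loc + sim_state))),
     alg_out = (\<lambda>b. case of_bits b :: loc + sim_state of Inl _ \<Rightarrow> None
        | Inr (nb, n, s, c, buf) \<Rightarrow> if hlt s then Some (out s) else None) \<rparr>"

lemma set_nbl_loc:
  assumes "finite (EE I)"
  shows "set (nbl (loc I v)) = nbrs (EE I) v"
proof -
  have "{(u, ww I (v, u)) |u. (v, u) \<in> EE I} = (\<lambda>e. (snd e, ww I e)) ` {e \<in> EE I. fst e = v}"
    by force
  moreover have "{(u, ww I (u, v)) |u. (u, v) \<in> EE I} = (\<lambda>e. (fst e, ww I e)) ` {e \<in> EE I. snd e = v}"
    by force
  ultimately have "finite {(u, ww I (v, u)) |u. (v, u) \<in> EE I}" "finite {(u, ww I (u, v)) |u. (u, v) \<in> EE I}"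
    using assms by simp_all
  then show ?thesis
    by (auto simp: nbl_def loc_def locof_def local_input_def nbrs_def und_edges_def image_iff)
qed

lemma map_of_graph_Some: "u \<in> set xs \<Longrightarrow> map_of (map (\<lambda>u. (u, g u)) xs) u = Some (g u)"
  by (induction xs) auto

text \<open>\<open>the_elem\<close> yields the successor state: once the coins are tossed, every
  transition is a point mass.\<close>

fun sim_config where
  "sim_config A V E bw c0 0 = c0"
| "sim_config A V E bw c0 (Suc k) =
    (\<lambda>v. if v \<in> V then the_elem (set_pmf (alg_step A (sim_config A V E bw c0 k v)
        (inbox A bw E (sim_config A V E bw c0 k) v))) else [])"

text \<open>All that follows the coin round is determined by the coin vector \<open>f\<close>, so
  the distribution of histories is the image of independent coins under \<open>hist\<close>; the
  probability of success becomes that of a property of the landmark set. The message alphabet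
  injects into bit strings of length \<open>W n\<close>, whence \<open>W n\<close> rounds per
  simulated round, plus one round for the coins.\<close>

theorem computable_simulation:
  fixes X :: "inst \<Rightarrow> nat \<Rightarrow> enat"
  assumes wf: "wf_net G" and X: "computable G T X" and p01: "\<And>n. 0 \<le> p n \<and> p n \<le> 1"
  shows "\<exists>A W. plog W \<and> (\<forall>n V E w s t P bw T'. n \<ge> 2 \<longrightarrow> finite V \<longrightarrow> E \<subseteq> V \<times> V \<longrightarrow> bw \<ge> 1 \<longrightarrow>
     (\<exists>hist. run A bw V E (local_input n E w s t P) T' =
            map_pmf hist (Pi_pmf V False (\<lambda>_. bernoulli_pmf (p n))) \<and>
        (\<forall>f I. I = \<lparr>nn = n, VV = V, EE = E, ww = w, ss = s, tt = t, PP = P, LL = {v \<in> V. f v}\<rparr> \<longrightarrow>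
           I \<in> G \<longrightarrow> 1 + W n * T I \<le> T' \<longrightarrow> (\<forall>v\<in>V. committed A (hist f) v = Some (X I v)))))"
proof -
  obtain ini send upd hlt out Ms where gp: "good_protocol G T X ini send upd hlt out Ms"
    using X unfolding computable_def by blast
  have "small Ms" using gp unfolding good_protocol_def by blast
  then obtain W0 where W0: "plog W0" "\<And>n. n \<ge> 2 \<Longrightarrow> finite (Ms n)" "\<And>n. n \<ge> 2 \<Longrightarrow> card (Ms n) \<le> 2 ^ W0 n"
    using smallE by metis
  \<comment> \<open>The extra bit makes \<open>W n\<close> positive, so that a simulated round takes
    at least one real round even for a one-letter alphabet.\<close>
  define W where "W n = Suc (W0 n)" for n
  have "\<exists>g. inj_on g (Ms n) \<and> (\<forall>m\<in>Ms n. length (g m :: bool list) = W n)" if "n \<ge> 2" for n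
  proof -
    have fin: "finite {bs :: bool list. length bs = W n}"
      using finite_lists_length_eq[of "UNIV :: bool set" "W n"] by simp
    have "card {bs :: bool list. length bs = W n} = 2 ^ W n"
      using card_lists_length_eq[of "UNIV :: bool set" "W n"] by simp
    then have "card (Ms n) \<le> card {bs :: bool list. length bs = W n}"
      using W0(3)[OF that] by (simp add: W_def)
    from card_le_inj[OF W0(2)[OF that] fin this] show ?thesis by blast
  qed
  then obtain enc where enc: "\<And>n. n \<ge> 2 \<Longrightarrow> inj_on (enc n) (Ms n)"
      "\<And>n m. n \<ge> 2 \<Longrightarrow> m \<in> Ms n \<Longrightarrow> length (enc n m :: bool list) = W n" by metis
  define dec where "dec n = inv_into (Ms n) (enc n)" for n
  have dec: "dec n (enc n m) = m" if "n \<ge> 2" "m \<in> Ms n" for n m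
    using enc(1)[OF that(1)] that(2) by (simp add: dec_def)
  define A where "A = sim_alg p W enc dec ini send upd hlt out"
  have A_init: "alg_init A l = to_bits (Inl (locof l False) :: loc + sim_state)" for l
    by (simp add: A_def sim_alg_def)
  have A_sendL: "alg_send A (to_bits (Inl l :: loc + sim_state)) v = None" for l v
    by (simp add: A_def sim_alg_def)
  have A_sendR: "alg_send A (to_bits (Inr (nb, n, s, c, buf) :: loc + sim_state)) v = Some [enc n (send s v) ! c]"
    for nb n s c buf v by (simp add: A_def sim_alg_def)
  have A_stepL: "alg_step A (to_bits (Inl l :: loc + sim_state)) ib =
      map_pmf (\<lambda>c. to_bits (Inr (sim_start ini (set_coin l c)) :: loc + sim_state)) (bernoulli_pmf (p (fst l)))"
    for l ib by (simp add: A_def sim_alg_def)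
  have A_stepR: "alg_step A (to_bits (Inr m :: loc + sim_state)) ib =
      return_pmf (to_bits (Inr (sim_step W dec upd m ib) :: loc + sim_state))" for m ib
    by (simp add: A_def sim_alg_def)
  have A_outL: "alg_out A (to_bits (Inl l :: loc + sim_state)) = None" for l
    by (simp add: A_def sim_alg_def)
  have A_outR: "alg_out A (to_bits (Inr (nb, n, s, c, buf) :: loc + sim_state)) = (if hlt s then Some (out s) else None)"
    for nb n s c buf by (simp add: A_def sim_alg_def)
  note A_simps = A_init A_sendL A_sendR A_stepL A_stepR A_outL A_outR
  show ?thesis
  proof (rule exI[of _ A], rule exI[of _ W], intro conjI allI impI)
    show "plog W" unfolding W_def using plog_add[OF W0(1) plog_const[of 1]] by simp
    fix n bw T' s t :: nat and V :: "nat set" and E :: "(nat \<times> nat) set" and w :: "nat \<times> nat \<Rightarrow> nat" and P :: "nat list"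
    assume n: "n \<ge> (2::nat)" and finV: "finite V" and E: "E \<subseteq> V \<times> V" and bw: "bw \<ge> (1::nat)"
    have finE: "finite E" using finV E finite_subset by blast
    define inp where "inp = local_input n E w s t P"
    define c0 where "c0 = (\<lambda>v. if v \<in> V then alg_init A (inp v) else [])"
    define c1 where "c1 f = (\<lambda>v. if v \<in> V then
       to_bits (Inr (sim_start ini (locof (inp v) (f v))) :: loc + sim_state) else [])" for f
    define cf where "cf f = sim_config A V E bw (c1 f)" for f
    let ?D = "Pi_pmf V False (\<lambda>_. bernoulli_pmf (p n))"
    have Inr: "\<exists>m :: sim_state. cf f k v = to_bits (Inr m :: loc + sim_state)" if "v \<in> V" for f k v
      using that
    proof (induction k)
      case (Suc k)
      then obtain m :: sim_state where "cf f k v = to_bits (Inr m :: loc + sim_state)" by blast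
      then have "cf f (Suc k) v = to_bits (Inr (sim_step W dec upd m (inbox A bw E (cf f k) v)) :: loc + sim_state)"
        using Suc.prems by (simp add: cf_def A_simps)
      then show ?case by blast
    next
      case 0
      then have "cf f 0 v = to_bits (Inr (sim_start ini (locof (inp v) (f v))) :: loc + sim_state)"
        by (simp add: cf_def c1_def)
      then show ?case by blast
    qed
    have step: "Pi_pmf V [] (\<lambda>v. alg_step A (cf f k v) (inbox A bw E (cf f k) v)) = return_pmf (cf f (Suc k))"
      for f k
    proof -
      have "Pi_pmf V [] (\<lambda>v. alg_step A (cf f k v) (inbox A bw E (cf f k) v)) =
        Pi_pmf V [] (\<lambda>v. return_pmf (the_elem (set_pmf (alg_step A (cf f k v) (inbox A bw E (cf f k) v)))))"
      proof (rule Pi_pmf_cong)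
        fix v assume "v \<in> V"
        then obtain m :: sim_state where "cf f k v = to_bits (Inr m :: loc + sim_state)" using Inr by blast
        then show "alg_step A (cf f k v) (inbox A bw E (cf f k) v) =
          return_pmf (the_elem (set_pmf (alg_step A (cf f k v) (inbox A bw E (cf f k) v))))"
          by (simp add: A_simps)
      qed auto
      also have "\<dots> = return_pmf (cf f (Suc k))" using finV by (simp add: cf_def)
      finally show ?thesis .
    qed
    have first: "Pi_pmf V [] (\<lambda>v. alg_step A (c0 v) (inbox A bw E c0 v)) = map_pmf c1 ?D"
    proof -
      have "Pi_pmf V [] (\<lambda>v. alg_step A (c0 v) (inbox A bw E c0 v)) =
        Pi_pmf V [] (\<lambda>v. bind_pmf (bernoulli_pmf (p n))
          (\<lambda>c. return_pmf (to_bits (Inr (sim_start ini (locof (inp v) c)) :: loc + sim_state))))"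
        by (rule Pi_pmf_cong)
           (auto simp: c0_def A_simps inp_def locof_def local_input_def set_coin_def map_pmf_def)
      also have "\<dots> = bind_pmf ?D (\<lambda>f. Pi_pmf V [] (\<lambda>v. return_pmf
           (to_bits (Inr (sim_start ini (locof (inp v) (f v))) :: loc + sim_state))))"
        by (rule Pi_pmf_bind[OF finV])
      also have "\<dots> = map_pmf c1 ?D"
        using finV by (simp add: map_pmf_def c1_def[abs_def])
      finally show ?thesis .
    qed
    define hist where "hist f = c0 # map (cf f) [0..<T']" for f
    have run: "run A bw V E inp k = map_pmf (\<lambda>f. c0 # map (cf f) [0..<k]) ?D" for k
    proof (induction k)
      case 0
      then show ?case by (simp add: c0_def)
    next
      case (Suc k)
      show ?case
      proof (cases k)
        case 0
        have "run A bw V E inp (Suc k) = map_pmf (\<lambda>c. [c0, c]) (map_pmf c1 ?D)"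
          unfolding 0 by (simp add: bind_return_pmf first c0_def[symmetric])
        then show ?thesis by (simp add: 0 map_pmf_comp cf_def)
      next
        case (Suc k')
        have "run A bw V E inp (Suc k) = bind_pmf ?D (\<lambda>f.
            map_pmf (\<lambda>c. (c0 # map (cf f) [0..<k]) @ [c])
              (Pi_pmf V [] (\<lambda>v. alg_step A (cf f k' v) (inbox A bw E (cf f k') v))))"
          unfolding run.simps Suc.IH by (simp add: bind_map_pmf \<open>k = Suc k'\<close>)
        then show ?thesis by (simp add: step map_pmf_def \<open>k = Suc k'\<close> bind_return_pmf)
      qed
    qed
    have committed: "committed A (hist f) v = Some (X I v)"
      if I: "I = \<lparr>nn = n, VV = V, EE = E, ww = w, ss = s, tt = t, PP = P, LL = {v \<in> V. f v}\<rparr>"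
        and IG: "I \<in> G" and T': "1 + W n * T I \<le> T'" and v: "v \<in> V" for f I v
    proof -
      have If: "nn I = n" "VV I = V" "EE I = E" using I by auto
      let ?st = "exec send upd (\<lambda>v. ini (loc I v)) E"
      have locv: "locof (inp v) (f v) = loc I v" if "v \<in> V" for v
        using that by (simp add: loc_def I inp_def)
      have nb: "set (nbl (loc I v)) = nbrs E v" for v using set_nbl_loc[of I v] finE by (simp add: If)
      have nbV: "u \<in> V" if "u \<in> nbrs E v" for u v using wf_netD[OF wf IG] that by (simp add: If)
      have hl: "\<not> hlt (?st j v)" "send (?st j v) u \<in> Ms n"
        if "v \<in> V" "j < T I" for v j u
        using gp IG that unfolding good_protocol_def If[symmetric] by blast+
      have hT: "hlt (?st (T I) v)" "out (?st (T I) v) = X I v" if "v \<in> V" for v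
        using gp IG that unfolding good_protocol_def If[symmetric] by blast+
      define B where "B i c v = map (\<lambda>c'. map (\<lambda>u. (u, enc n (send (?st i u) v) ! c')) (nbl (loc I v))) [0..<c]" for i c v
      \<comment> \<open>Invariant: \<open>i\<close> rounds are simulated and the first
        \<open>c\<close> bits of the next messages have arrived.\<close>
      define S where "S i c \<longleftrightarrow> (\<forall>v\<in>V. cf f (i * W n + c) v =
          to_bits (Inr (nbl (loc I v), n, ?st i v, c, B i c v) :: loc + sim_state))" for i c
      have S0: "S 0 0" unfolding S_def
        by (auto simp: cf_def c1_def sim_start_def locv B_def) (simp add: loc_def locof_def local_input_def If)
      have one: "if Suc c < W n then S i (Suc c) else S (Suc i) 0" if S: "S i c" and i: "i < T I" and c: "c < W n" for i c
      proof -
        have ib: "inbox A bw E (cf f (i * W n + c)) v u =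
            (if u \<in> nbrs E v then Some [enc n (send (?st i u) v) ! c] else None)" for v u
          using S nbV[of u v] bw unfolding S_def by (auto simp: inbox_def A_simps)
        have nx: "cf f (Suc (i * W n + c)) v = to_bits (Inr (sim_step W dec upd
             (nbl (loc I v), n, ?st i v, c, B i c v) (inbox A bw E (cf f (i * W n + c)) v)) :: loc + sim_state)"
          if "v \<in> V" for v
          using S that unfolding S_def by (simp add: cf_def A_simps)
        have Bs: "B i c v @ [map (\<lambda>u. (u, inbox A bw E (cf f (i * W n + c)) v u = Some [True])) (nbl (loc I v))]
            = B i (Suc c) v" for v
          by (auto simp: B_def ib nb)
        show ?thesis
        proof (cases "Suc c < W n")
          case True
          then show ?thesis using nx by (auto simp: S_def sim_step_def Bs)
        next
          case False
          then have cW: "Suc c = W n" using c by simp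
          have m: "dec n (map (\<lambda>al. the (map_of al u)) (B i (Suc c) v)) = send (?st i u) v" if "u \<in> nbrs E v" for u v
          proof -
            have "map (\<lambda>al. the (map_of al u)) (B i (Suc c) v) = map (\<lambda>c'. enc n (send (?st i u) v) ! c') [0..<W n]"
              using that by (simp add: B_def o_def nb map_of_graph_Some cW del: upt_Suc)
            also have "\<dots> = enc n (send (?st i u) v)"
              using enc(2)[OF n hl(2)[OF nbV[OF that] i, of v]] by (metis map_nth)
            finally show ?thesis using dec[OF n hl(2)[OF nbV[OF that] i, of v]] by simp
          qed
          have "sim_step W dec upd (nbl (loc I v), n, ?st i v, c, B i c v) (inbox A bw E (cf f (i * W n + c)) v)
              = (nbl (loc I v), n, ?st (Suc i) v, 0, [])" for v
          proof -
            have "(\<lambda>u. if u \<in> nbrs E v then Some (dec n (map (\<lambda>al. the (map_of al u)) (B i (Suc c) v))) else None)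
               = (\<lambda>u. if u \<in> nbrs E v then Some (send (?st i u) v) else None)"
              by (rule ext) (use m in auto)
            then show ?thesis unfolding sim_step_def Let_def prod.case Bs nb by (simp add: cW)
          qed
          note ss = this
          have ix: "Suc i * W n + 0 = Suc (i * W n + c)" using cW by simp
          have B0: "B (Suc i) 0 v = []" for v by (simp add: B_def)
          have "S (Suc i) 0" unfolding S_def
          proof
            fix v assume "v \<in> V"
            from nx[OF this] show "cf f (Suc i * W n + 0) v =
              to_bits (Inr (nbl (loc I v), n, ?st (Suc i) v, 0, B (Suc i) 0 v) :: loc + sim_state)"
              by (simp only: ix ss B0)
          qed
          then show ?thesis using False by simp
        qed
      qed
      have Sall: "i \<le> T I \<Longrightarrow> c < W n \<Longrightarrow> (i = T I \<longrightarrow> c = 0) \<Longrightarrow> S i c" for i c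
      proof (induction i arbitrary: c)
        case 0
        then show ?case
        proof (induction c)
          case (Suc c) then show ?case using one[of 0 c] by auto
        qed (rule S0)
      next
        case (Suc i)
        have "S i (W n - 1)" by (rule Suc.IH) (use Suc.prems in \<open>auto simp: W_def\<close>)
        then have base: "S (Suc i) 0" using one[of i "W n - 1"] Suc.prems by (auto simp: W_def)
        from Suc.prems(2,3) show ?case
        proof (induction c)
          case (Suc c') then show ?case using one[of "Suc i" c'] \<open>Suc i \<le> T I\<close> by auto
        qed (rule base)
      qed
      \<comment> \<open>Entry \<open>0\<close> of the history precedes the coin toss, hence the
        shift by one.\<close>
      let ?k = "Suc (T I * W n)"
      let ?P = "\<lambda>c. alg_out A (c v) \<noteq> None"
      have len: "?k < length (hist f)" using T' by (simp add: hist_def mult.commute)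
      have at: "hist f ! Suc j = cf f j" if "j \<le> T I * W n" for j
        using that T' by (simp add: hist_def mult.commute)
      have out: "alg_out A (cf f (T I * W n) v) = Some (X I v)"
        using Sall[of "T I" 0] v hT[OF v] by (simp add: S_def W_def A_simps)
      have "\<not> ?P (hist f ! j)" if "j < ?k" for j
      proof (cases j)
        case 0
        then show ?thesis using v by (simp add: hist_def c0_def A_simps)
      next
        case (Suc j')
        then have j': "j' < T I * W n" using that by simp
        let ?i = "j' div W n" and ?c = "j' mod W n"
        have "?i < T I" using j' by (simp add: less_mult_imp_div_less)
        moreover have "?c < W n" by (simp add: W_def)
        ultimately have "S ?i ?c" "\<not> hlt (?st ?i v)" using Sall[of ?i ?c] hl(1)[OF v] by auto
        then show ?thesis using v at[of j'] j' Suc by (simp add: S_def A_simps)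
      qed
      then have "find ?P (hist f) = Some (hist f ! ?k)"
        unfolding find_Some_iff using len at[of "T I * W n"] out by (intro exI[of _ ?k]) auto
      then show ?thesis using at[of "T I * W n"] out by (simp add: committed_def)
    qed
    show "\<exists>hist. run A bw V E (local_input n E w s t P) T' = map_pmf hist ?D \<and>
        (\<forall>f I. I = \<lparr>nn = n, VV = V, EE = E, ww = w, ss = s, tt = t, PP = P, LL = {v \<in> V. f v}\<rparr> \<longrightarrow>
           I \<in> G \<longrightarrow> 1 + W n * T I \<le> T' \<longrightarrow> (\<forall>v\<in>V. committed A (hist f) v = Some (X I v)))"
      by (rule exI[of _ hist]) (use run[of T'] committed in \<open>auto simp: inp_def hist_def[abs_def]\<close>)
  qed
qed

section \<open>Eccentricity of the source\<close>

definition sdist :: "inst \<Rightarrow> nat \<Rightarrow> nat" where "sdist I v = hop_dist (EE I) (ss I) v"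
definition ecc :: "inst \<Rightarrow> nat" where "ecc I = Max (sdist I ` VV I)"

definition conn_inst :: "inst \<Rightarrow> bool" where
  "conn_inst I \<longleftrightarrow> nn I \<ge> 2 \<and> finite (VV I) \<and> card (VV I) = nn I \<and> EE I \<subseteq> VV I \<times> VV I \<and>
     connected_und (VV I) (EE I) \<and> ss I \<in> VV I"

lemma und_edges_sym: "(u, v) \<in> und_edges E \<longleftrightarrow> (v, u) \<in> und_edges E"
  unfolding und_edges_def by auto

lemma und_edges_relpow_sym: "(u, v) \<in> und_edges E ^^ k \<Longrightarrow> (v, u) \<in> und_edges E ^^ k"
proof (induction k arbitrary: v)
  case (Suc k)
  then obtain x where "(u, x) \<in> und_edges E ^^ k" "(x, v) \<in> und_edges E" by auto
  then show ?case using Suc.IH[of x] by (meson und_edges_sym relpow_Suc_I2)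
qed simp

lemma hop_dist_le: "(u, v) \<in> und_edges E ^^ k \<Longrightarrow> hop_dist E u v \<le> k"
  unfolding hop_dist_def by (rule Least_le)

context
  fixes I assumes I: "conn_inst I"
begin

lemma conn_instD: "nn I \<ge> 2" "finite (VV I)" "card (VV I) = nn I" "EE I \<subseteq> VV I \<times> VV I" "ss I \<in> VV I"
  "finite (EE I)" "\<And>v. finite (nbrs (EE I) v)" "\<And>u v. u \<in> nbrs (EE I) v \<Longrightarrow> u \<in> VV I"
proof -
  show *: "nn I \<ge> 2" "finite (VV I)" "card (VV I) = nn I" "EE I \<subseteq> VV I \<times> VV I" "ss I \<in> VV I"
    using I unfolding conn_inst_def by auto
  then show "finite (EE I)" using finite_subset by blast
  show **: "\<And>u v. u \<in> nbrs (EE I) v \<Longrightarrow> u \<in> VV I"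
    using * unfolding nbrs_def und_edges_def by blast
  show "finite (nbrs (EE I) v)" for v using * ** by (meson finite_subset subsetI)
qed

lemma sdist_walk: "v \<in> VV I \<Longrightarrow> (ss I, v) \<in> und_edges (EE I) ^^ sdist I v"
proof -
  assume "v \<in> VV I"
  then have "(ss I, v) \<in> (und_edges (EE I))\<^sup>*"
    using I unfolding conn_inst_def connected_und_def by blast
  then obtain k where "(ss I, v) \<in> und_edges (EE I) ^^ k" using rtrancl_imp_relpow by blast
  then show ?thesis unfolding sdist_def hop_dist_def by (rule LeastI)
qed

lemma sdist_s: "sdist I v = 0 \<Longrightarrow> v \<in> VV I \<Longrightarrow> v = ss I"
  using sdist_walk[of v] by auto

lemma sdist_s0 [simp]: "sdist I (ss I) = 0"
  unfolding sdist_def by (metis hop_dist_le le_zero_eq relpow_0_I)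

lemma sdist_adj: "u \<in> VV I \<Longrightarrow> (u, v) \<in> und_edges (EE I) \<Longrightarrow> sdist I v \<le> Suc (sdist I u)"
  using sdist_walk[of u] unfolding sdist_def by (intro hop_dist_le) auto

lemma sdist_pred:
  assumes "v \<in> VV I" "sdist I v = Suc k"
  obtains u where "u \<in> nbrs (EE I) v" "sdist I u = k"
proof -
  obtain u where u: "(ss I, u) \<in> und_edges (EE I) ^^ k" "(u, v) \<in> und_edges (EE I)"
    using sdist_walk[OF assms(1)] assms(2) by auto
  have un: "u \<in> nbrs (EE I) v" using u(2) und_edges_sym unfolding nbrs_def by auto
  have "sdist I u \<le> k" using hop_dist_le[OF u(1)] by (simp add: sdist_def)
  moreover have "sdist I v \<le> Suc (sdist I u)" using sdist_adj[OF conn_instD(8)[OF un] u(2)] .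
  ultimately show ?thesis using that[OF un] assms(2) by simp
qed

lemma ex_sdist_below: "v \<in> VV I \<Longrightarrow> k \<le> sdist I v \<Longrightarrow> \<exists>u\<in>VV I. sdist I u = k"
proof (induction "sdist I v" arbitrary: v)
  case (Suc d)
  show ?case
  proof (cases "k = Suc d")
    case False
    obtain u where "u \<in> nbrs (EE I) v" "sdist I u = d" using sdist_pred[OF Suc.prems(1) Suc.hyps(2)[symmetric]] .
    then show ?thesis using Suc.hyps(1)[of u] conn_instD(8) False Suc.prems Suc.hyps(2) by auto
  qed (use Suc in auto)
qed auto

lemma sdist_le_ecc: "v \<in> VV I \<Longrightarrow> sdist I v \<le> ecc I"
  unfolding ecc_def using conn_instD by auto

lemma ex_sdist: "k \<le> ecc I \<Longrightarrow> \<exists>u\<in>VV I. sdist I u = k"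
proof -
  assume "k \<le> ecc I"
  moreover have "ecc I \<in> sdist I ` VV I" unfolding ecc_def using conn_instD by (intro Max_in) auto
  ultimately show ?thesis using ex_sdist_below by auto
qed

text \<open>Every distance up to the eccentricity is attained, so there are more than
  \<open>ecc I\<close> vertices. This keeps the messages of the eccentricity protocol polynomially
  bounded.\<close>

lemma ecc_less: "ecc I < nn I"
proof -
  have "{..ecc I} \<subseteq> sdist I ` VV I" using ex_sdist by blast
  then have "card {..ecc I} \<le> card (VV I)"
    using card_mono[of "sdist I ` VV I"] card_image_le[of "VV I" "sdist I"] conn_instD(2)
    by (meson finite_imageI order_trans)
  then show ?thesis using conn_instD by simp
qed

lemma ecc_le_diameter: "ecc I \<le> diameter (VV I) (EE I)"
proof -
  have "{hop_dist (EE I) u v |u v. u \<in> VV I \<and> v \<in> VV I} = (\<lambda>(u, v). hop_dist (EE I) u v) ` (VV I \<times> VV I)"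
    by auto
  then have "finite {hop_dist (EE I) u v |u v. u \<in> VV I \<and> v \<in> VV I}" using conn_instD by simp
  moreover obtain v where "v \<in> VV I" "sdist I v = ecc I" using ex_sdist[of "ecc I"] by blast
  then have "ecc I \<in> {hop_dist (EE I) u v |u v. u \<in> VV I \<and> v \<in> VV I}"
    using conn_instD(5) unfolding sdist_def mem_Collect_eq by metis
  ultimately show ?thesis unfolding diameter_def by (rule Max_ge)
qed

lemma walk_via_s: "u \<in> VV I \<Longrightarrow> v \<in> VV I \<Longrightarrow> (u, v) \<in> und_edges (EE I) ^^ (sdist I u + sdist I v)"
  using sdist_walk und_edges_relpow_sym by (metis relcomp.relcompI relpow_add)

end

text \<open>The value \<open>0\<close> stands for a vertex not yet reached from the source, and \<open>Suc m\<close> for a vertex that has heard of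
  distances up to \<open>m\<close>. In round \<open>j \<ge> 3 * m + 2\<close> such a vertex can stop: a vertex at distance \<open>m + 1\<close> would
  have made itself heard by then.\<close>

fun ecc_msg :: "inst \<Rightarrow> nat \<Rightarrow> nat \<Rightarrow> nat" where
  "ecc_msg I 0 v = (if v = ss I then 1 else 0)"
| "ecc_msg I (Suc j) v = (let x = Max (insert (ecc_msg I j v) (ecc_msg I j ` nbrs (EE I) v)) in
     if ecc_msg I j v = 0 \<and> x > 0 then j + 2 else x)"

declare ecc_msg.simps(2) [simp del]

context
  fixes I assumes I: "conn_inst I"
begin


definition ecc_msg_max :: "nat \<Rightarrow> nat \<Rightarrow> nat" where
  "ecc_msg_max j v = Max (insert (ecc_msg I j v) (ecc_msg I j ` nbrs (EE I) v))"

lemma ecc_msg_max_ge: "ecc_msg I j v \<le> ecc_msg_max j v" "u \<in> nbrs (EE I) v \<Longrightarrow> ecc_msg I j u \<le> ecc_msg_max j v"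
  unfolding ecc_msg_max_def using conn_instD(7)[OF I] by (auto intro!: Max_ge)

lemma ecc_msg_max_in: "ecc_msg_max j v = ecc_msg I j v \<or> (\<exists>u\<in>nbrs (EE I) v. ecc_msg_max j v = ecc_msg I j u)"
  unfolding ecc_msg_max_def using Max_in[of "insert (ecc_msg I j v) (ecc_msg I j ` nbrs (EE I) v)"] conn_instD(7)[OF I, of v] by blast

lemma ecc_msg_Suc: "ecc_msg I (Suc j) v = (if ecc_msg I j v = 0 \<and> ecc_msg_max j v > 0 then j + 2 else ecc_msg_max j v)"
  by (simp only: ecc_msg.simps(2) Let_def ecc_msg_max_def)

lemma ecc_msg_pos: "v \<in> VV I \<Longrightarrow> ecc_msg I j v > 0 \<longleftrightarrow> sdist I v \<le> j"
proof (induction j arbitrary: v)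
  case 0
  show ?case
  proof (cases "v = ss I")
    case False
    then have "sdist I v \<noteq> 0" using sdist_s[OF I] 0 by blast
    then show ?thesis using False by simp
  qed (simp add: sdist_s0[OF I])
next
  case (Suc j)
  have "ecc_msg I (Suc j) v > 0 \<longleftrightarrow> ecc_msg_max j v > 0" by (simp add: ecc_msg_Suc)
  also have "\<dots> \<longleftrightarrow> ecc_msg I j v > 0 \<or> (\<exists>u\<in>nbrs (EE I) v. ecc_msg I j u > 0)"
  proof
    assume "ecc_msg_max j v > 0"
    from ecc_msg_max_in[of j v] show "ecc_msg I j v > 0 \<or> (\<exists>u\<in>nbrs (EE I) v. ecc_msg I j u > 0)"
    proof
      assume "\<exists>u\<in>nbrs (EE I) v. ecc_msg_max j v = ecc_msg I j u"
      then obtain u where "u \<in> nbrs (EE I) v" "ecc_msg_max j v = ecc_msg I j u" by blast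
      then show ?thesis using \<open>ecc_msg_max j v > 0\<close> by auto
    qed (use \<open>ecc_msg_max j v > 0\<close> in simp)
  next
    assume "ecc_msg I j v > 0 \<or> (\<exists>u\<in>nbrs (EE I) v. ecc_msg I j u > 0)"
    then obtain x where "x = v \<or> x \<in> nbrs (EE I) v" "ecc_msg I j x > 0" by blast
    moreover have "ecc_msg I j x \<le> ecc_msg_max j v" using ecc_msg_max_ge(1)[of j v] ecc_msg_max_ge(2)[of x v j] calculation(1) by blast
    ultimately show "ecc_msg_max j v > 0" by simp
  qed
  also have "\<dots> \<longleftrightarrow> sdist I v \<le> j \<or> (\<exists>u\<in>nbrs (EE I) v. sdist I u \<le> j)"
    using Suc.IH[OF Suc.prems] Suc.IH[OF conn_instD(8)[OF I]] by blast
  also have "\<dots> \<longleftrightarrow> sdist I v \<le> Suc j"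
  proof
    assume "sdist I v \<le> j \<or> (\<exists>u\<in>nbrs (EE I) v. sdist I u \<le> j)"
    then show "sdist I v \<le> Suc j"
    proof
      assume "\<exists>u\<in>nbrs (EE I) v. sdist I u \<le> j"
      then obtain u where u: "u \<in> nbrs (EE I) v" "sdist I u \<le> j" by blast
      then have "(u, v) \<in> und_edges (EE I)" using und_edges_sym[of u v] by (simp add: nbrs_def)
      then show ?thesis using sdist_adj[OF I conn_instD(8)[OF I u(1)], of v] u(2) by simp
    qed simp
  next
    assume a: "sdist I v \<le> Suc j"
    show "sdist I v \<le> j \<or> (\<exists>u\<in>nbrs (EE I) v. sdist I u \<le> j)"
    proof (cases "sdist I v = Suc j")
      case True
      then obtain u where "u \<in> nbrs (EE I) v" "sdist I u = j" using sdist_pred[OF I Suc.prems] by blast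
      then show ?thesis by blast
    qed (use a in simp)
  qed
  finally show ?case .
qed

lemma ecc_msg_le: "v \<in> VV I \<Longrightarrow> ecc_msg I j v \<le> Suc (ecc I)"
proof (induction j arbitrary: v)
  case (Suc j)
  show ?case
  proof (cases "ecc_msg I j v = 0 \<and> ecc_msg_max j v > 0")
    case True
    then have e: "ecc_msg I (Suc j) v = j + 2" by (simp add: ecc_msg_Suc)
    have "\<not> sdist I v \<le> j" using ecc_msg_pos[OF Suc.prems, of j] True by simp
    moreover have "sdist I v \<le> Suc j" using ecc_msg_pos[OF Suc.prems, of "Suc j"] e by simp
    ultimately show ?thesis using e sdist_le_ecc[OF I Suc.prems] by simp
  next
    case False
    then have "ecc_msg I (Suc j) v = ecc_msg_max j v" by (simp only: ecc_msg_Suc if_False)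
    moreover obtain x where "x = v \<or> x \<in> nbrs (EE I) v" "ecc_msg_max j v = ecc_msg I j x" using ecc_msg_max_in[of j v] by blast
    moreover have "ecc_msg I j x \<le> Suc (ecc I)"
      using Suc.IH[of x] Suc.prems conn_instD(8)[OF I, of x v] calculation(2) by blast
    ultimately show ?thesis by simp
  qed
qed simp

text \<open>The distance of \<open>u\<close> is announced as soon as \<open>u\<close> is reached, in
  round \<open>sdist I u\<close>, and from then on travels one edge per round; larger values may
  overwrite it but never smaller ones.\<close>

lemma ecc_msg_ge:
  assumes u: "u \<in> VV I"
  shows "(u, v) \<in> und_edges (EE I) ^^ i \<Longrightarrow> sdist I u + i \<le> j \<Longrightarrow> Suc (sdist I u) \<le> ecc_msg I j v"
proof (induction j arbitrary: i v)
  case 0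
  then have "u = ss I" "v = u" using sdist_s[OF I _ u] by auto
  then show ?case using sdist_s0[OF I] by simp
next
  case (Suc j)
  have *: "Suc (sdist I u) \<le> ecc_msg I (Suc j) v" if "Suc (sdist I u) \<le> ecc_msg_max j v" "sdist I u \<le> Suc j"
    using that by (simp add: ecc_msg_Suc)
  have le: "sdist I u \<le> Suc j" using Suc.prems by simp
  show ?case
  proof (cases i)
    case 0
    then have uv: "u = v" using Suc.prems by simp
    show ?thesis
    proof (cases "sdist I u \<le> j")
      case True
      then have "Suc (sdist I u) \<le> ecc_msg I j v" using Suc.IH[of v 0] uv by simp
      then show ?thesis using * ecc_msg_max_ge(1)[of j v] le by simp
    next
      case False
      then have "ecc_msg I j v = 0" "ecc_msg I (Suc j) v > 0" "sdist I u = Suc j"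
        using ecc_msg_pos[OF u] uv le by auto
      then show ?thesis by (simp add: ecc_msg_Suc split: if_splits)
    qed
  next
    case (Suc i')
    then obtain x where x: "(u, x) \<in> und_edges (EE I) ^^ i'" "(x, v) \<in> und_edges (EE I)"
      using Suc.prems by auto
    have "Suc (sdist I u) \<le> ecc_msg I j x" using Suc.IH[OF x(1)] Suc.prems(2) \<open>i = Suc i'\<close> by simp
    moreover have "x \<in> nbrs (EE I) v" using x(2) und_edges_sym[of x v] by (simp add: nbrs_def)
    ultimately have "Suc (sdist I u) \<le> ecc_msg_max j v" using ecc_msg_max_ge(2)[of x v j] by simp
    then show ?thesis using * le by simp
  qed
qed

text \<open>If \<open>m < ecc I\<close>, some vertex has distance \<open>m + 1\<close> from the
  source. Its announcement starts in round \<open>m + 1\<close> and crosses at most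
  \<open>(m + 1) + m\<close> edges via the source, hence arrives by round \<open>3 * m + 2\<close>;
  a vertex that still holds \<open>m\<close> then may take it as final.\<close>

lemma ecc_msg_halt:
  assumes v: "v \<in> VV I"
  shows "j < 3 * ecc I + 2 \<Longrightarrow> \<not> (ecc_msg I j v > 0 \<and> Suc j \<ge> 3 * ecc_msg I j v)"
    and "ecc_msg I (3 * ecc I + 2) v = Suc (ecc I)"
proof -
  obtain u where u: "u \<in> VV I" "sdist I u = ecc I" using ex_sdist[OF I] by blast
  have "Suc (sdist I u) \<le> ecc_msg I (3 * ecc I + 2) v"
    by (rule ecc_msg_ge[OF u(1) walk_via_s[OF I u(1) v]]) (use u sdist_le_ecc[OF I v] in simp)
  then show "ecc_msg I (3 * ecc I + 2) v = Suc (ecc I)" using ecc_msg_le[OF v] u by (simp add: antisym)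
  assume j: "j < 3 * ecc I + 2"
  show "\<not> (ecc_msg I j v > 0 \<and> Suc j \<ge> 3 * ecc_msg I j v)"
  proof
    assume a: "ecc_msg I j v > 0 \<and> Suc j \<ge> 3 * ecc_msg I j v"
    obtain m where m: "ecc_msg I j v = Suc m" using a gr0_implies_Suc by blast
    have vj: "sdist I v \<le> j" using a ecc_msg_pos[OF v] by blast
    have "Suc (sdist I v) \<le> ecc_msg I j v" using ecc_msg_ge[OF v, of v 0 j] vj by simp
    then have vm: "sdist I v \<le> m" using m by simp
    have "Suc m \<le> ecc I" using j m a by simp
    then obtain x where x: "x \<in> VV I" "sdist I x = Suc m" using ex_sdist[OF I] by blast
    have "Suc (sdist I x) \<le> ecc_msg I j v"
      by (rule ecc_msg_ge[OF x(1) walk_via_s[OF I x(1) v]]) (use x vm a m in simp)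
    then show False using x m by simp
  qed
qed

end

definition base :: "inst \<Rightarrow> nat \<Rightarrow> loc \<times> nat" where "base I v = (loc I v, ecc I)"

lemma set_nbl: "conn_inst I \<Longrightarrow> set (nbl (loc I v)) = nbrs (EE I) v"
  using set_nbl_loc conn_instD by blast

lemma fst_loc [simp]: "fst (loc I v) = nn I"
  by (simp add: loc_def locof_def local_input_def)

section \<open>Knowledge in connected networks once the eccentricity of the source is known\<close>

locale net =
  fixes G :: "inst set"
  assumes conn: "\<And>I. I \<in> G \<Longrightarrow> conn_inst I"
begin

lemma wf: "wf_net G"
  unfolding wf_net_def using conn conn_instD by blast

lemma computable_base: "computable G (\<lambda>I. 3 * ecc I + 2) base"
proof -
  let ?Y = "\<lambda>I j v. (j, loc I v, ecc_msg I j v)"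
  have "computable G (\<lambda>I. 0 + (3 * ecc I + 2)) (\<lambda>I v. ?Y I (3 * ecc I + 2) v)"
  proof (rule computable_halt[where M = "\<lambda>n. {..1 * n ^ 1}" and Y = ?Y and yi = "\<lambda>l. (0, l, if fst (snd (snd (snd (snd l)))) then 1 else 0)"
        and h = "\<lambda>(j, l, m). m > 0 \<and> Suc j \<ge> 3 * m"
        and sd = "\<lambda>(j, l, m) u. m"
        and up = "\<lambda>(j, l, m) ib. (Suc j, l, let x = Max (insert m ((\<lambda>u. the (ib u)) ` set (nbl l))) in
            if m = 0 \<and> x > 0 then j + 2 else x)", OF wf computable_loc])
    fix I v assume IG: "I \<in> G" and v: "v \<in> VV I"
    note I = conn[OF IG]
    show "?Y I 0 v = (0, loc I v, if fst (snd (snd (snd (snd (loc I v))))) then 1 else 0)"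
      by (simp add: loc_def locof_def local_input_def)
    show "case ?Y I (3 * ecc I + 2) v of (j, l, m) \<Rightarrow> m > 0 \<and> Suc j \<ge> 3 * m"
      using ecc_msg_halt(2)[OF I v] by simp
    fix j assume j: "j < 3 * ecc I + 2"
    show "\<not> (case ?Y I j v of (j, l, m) \<Rightarrow> m > 0 \<and> Suc j \<ge> 3 * m)"
      using ecc_msg_halt(1)[OF I v j] by simp
    have "(\<lambda>u. the (if u \<in> nbrs (EE I) v then Some (ecc_msg I j u) else None)) ` nbrs (EE I) v = ecc_msg I j ` nbrs (EE I) v"
      by (rule image_cong) auto
    then show "?Y I (Suc j) v = (case ?Y I j v of (j, l, m) \<Rightarrow> \<lambda>ib. (Suc j, l, let x = Max (insert m ((\<lambda>u. the (ib u)) ` set (nbl l))) in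
            if m = 0 \<and> x > 0 then j + 2 else x))
       (\<lambda>u. if u \<in> nbrs (EE I) v then Some ((case ?Y I j u of (j, l, m) \<Rightarrow> \<lambda>u. m) v) else None)"
      by (simp add: set_nbl[OF I] ecc_msg.simps(2))
    show "(case ?Y I j v of (j, l, m) \<Rightarrow> \<lambda>u. m) u \<in> {..1 * nn I ^ 1}" for u
      using ecc_msg_le[OF I v, of j] ecc_less[OF I] by simp
  qed (rule small_atMost_poly)
  then have "computable G (\<lambda>I. 3 * ecc I + 2) (\<lambda>I v. ?Y I (3 * ecc I + 2) v)" by simp
  then show ?thesis
    by (rule computable_map[where g = "\<lambda>(j, l, m). (l, m - 1)"])
       (simp add: base_def ecc_msg_halt(2) conn del: add_2_eq_Suc')
qed

text \<open>The base is carried along so that every later phase can fix its length as a function of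
  \<open>nn\<close> and \<open>ecc\<close>, which all vertices know.\<close>

definition knows :: "(inst \<Rightarrow> nat) \<Rightarrow> (inst \<Rightarrow> nat \<Rightarrow> 'x) \<Rightarrow> bool" where
  "knows T x \<longleftrightarrow> computable G T (\<lambda>I v. (base I v, x I v))"

lemma knows_start: "knows (\<lambda>I. 3 * ecc I + 2) (\<lambda>I v. ())"
  unfolding knows_def by (rule computable_map[OF computable_base, where g = "\<lambda>b. (b, ())"]) simp

lemma knows_map:
  assumes "knows T x" "\<And>I v. I \<in> G \<Longrightarrow> v \<in> VV I \<Longrightarrow> y I v = g (base I v) (x I v)"
  shows "knows T y"
  using assms(1) unfolding knows_def
  by (rule computable_map[where g = "\<lambda>(b, x). (b, g b x)"]) (simp add: assms)

lemma knows_rounds: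
  fixes x :: "inst \<Rightarrow> nat \<Rightarrow> 'x::countable" and Y :: "inst \<Rightarrow> nat \<Rightarrow> nat \<Rightarrow> 'y::countable"
    and M :: "nat \<Rightarrow> 'm::countable set"
  assumes x: "knows T x"
    and Y0: "\<And>I v. I \<in> G \<Longrightarrow> v \<in> VV I \<Longrightarrow> Y I 0 v = yi (base I v) (x I v)"
    and YS: "\<And>I v j. I \<in> G \<Longrightarrow> v \<in> VV I \<Longrightarrow> j < r (nn I) (ecc I) \<Longrightarrow> Y I (Suc j) v =
       up j (base I v) (x I v) (Y I j v)
         (\<lambda>u. if u \<in> nbrs (EE I) v then Some (sd j (base I u) (x I u) (Y I j u) v) else None)"
    and M: "small M"
      "\<And>I v j u. I \<in> G \<Longrightarrow> v \<in> VV I \<Longrightarrow> j < r (nn I) (ecc I) \<Longrightarrow> sd j (base I v) (x I v) (Y I j v) u \<in> M (nn I)"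
  shows "knows (\<lambda>I. T I + r (nn I) (ecc I)) (\<lambda>I v. (x I v, Y I (r (nn I) (ecc I)) v))"
proof -
  have "computable G (\<lambda>I. T I + r (nn I) (ecc I)) (\<lambda>I v. ((base I v, x I v), Y I (r (nn I) (ecc I)) v))"
    by (rule computable_rounds[where r = "\<lambda>(b, x). r (fst (fst b)) (snd b)" and yi = "\<lambda>(b, x). yi b x"
          and up = "\<lambda>j (b, x). up j b x" and sd = "\<lambda>j (b, x). sd j b x" and M = M, OF wf x[unfolded knows_def]])
       (use Y0 YS M in \<open>auto simp: base_def\<close>)
  then show ?thesis unfolding knows_def
    by (rule computable_map[where g = "\<lambda>((b, x), y). (b, x, y)"]) simp
qed

end

section \<open>Broadcast by flooding\<close>

text \<open>A state \<open>(K, S)\<close> consists of the items known and of those already sent. The order of sending is irrelevant.\<close>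

definition pick :: "nat set \<times> nat set \<Rightarrow> nat option" where
  "pick = (\<lambda>(K, S). if K \<subseteq> S then None else Some (Min (K - S)))"

fun flood :: "(nat \<times> nat) set \<Rightarrow> (nat \<Rightarrow> nat set) \<Rightarrow> nat \<Rightarrow> nat \<Rightarrow> nat set \<times> nat set" where
  "flood E S 0 v = (S v, {})"
| "flood E S (Suc j) v = (fst (flood E S j v) \<union> {x. \<exists>u\<in>nbrs E v. pick (flood E S j u) = Some x},
     snd (flood E S j v) \<union> set_option (pick (flood E S j v)))"

context
  fixes V :: "nat set" and E :: "(nat \<times> nat) set" and S :: "nat \<Rightarrow> nat set"
  assumes E: "E \<subseteq> V \<times> V" and finU: "finite (\<Union>v\<in>V. S v)"
begin

abbreviation known where "known j v \<equiv> fst (flood E S j v)"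
abbreviation sent where "sent j v \<equiv> snd (flood E S j v)"

lemma nbrs_V: "u \<in> nbrs E v \<Longrightarrow> u \<in> V" "u \<in> nbrs E v \<Longrightarrow> v \<in> V"
  using E unfolding nbrs_def und_edges_def by blast+

lemma flood_inv: "v \<in> V \<Longrightarrow> known j v \<subseteq> (\<Union>v\<in>V. S v) \<and> sent j v \<subseteq> known j v"
proof (induction j arbitrary: v)
  case (Suc j)
  have pk: "pick (flood E S j u) = Some x \<Longrightarrow> x \<in> known j u - sent j u" if "u \<in> V" for u x
  proof -
    assume a: "pick (flood E S j u) = Some x"
    have "finite (known j u)" using Suc.IH[OF that] finU finite_subset by blast
    then have "Min (known j u - sent j u) \<in> known j u - sent j u" if "\<not> known j u \<subseteq> sent j u"
      using that by (intro Min_in) auto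
    then show ?thesis using a unfolding pick_def by (auto split: prod.splits if_splits)
  qed
  have "pick (flood E S j u) = Some x \<Longrightarrow> x \<in> (\<Union>v\<in>V. S v)" if "u \<in> V" for u x
    using pk[OF that, of x] Suc.IH[OF that] by blast
  then have "{x. \<exists>u\<in>nbrs E v. pick (flood E S j u) = Some x} \<subseteq> (\<Union>v\<in>V. S v)"
    using nbrs_V(1) by blast
  moreover have "set_option (pick (flood E S j v)) \<subseteq> known j v" using pk[OF Suc.prems] by auto
  ultimately show ?case using Suc.IH[OF Suc.prems] by auto
qed auto

lemma known_finite: "v \<in> V \<Longrightarrow> finite (known j v)" "v \<in> V \<Longrightarrow> finite (sent j v)"
  using flood_inv finU finite_subset by metis+

lemma pick_Some: "v \<in> V \<Longrightarrow> \<not> known j v \<subseteq> sent j v \<Longrightarrow> \<exists>x\<in>known j v - sent j v. pick (flood E S j v) = Some x"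
  using Min_in[of "known j v - sent j v"] known_finite[of v j] unfolding pick_def by (auto split: prod.splits)

lemma known_mono: "i \<le> j \<Longrightarrow> known i v \<subseteq> known j v"
  by (rule lift_Suc_mono_le[where f = "\<lambda>j. known j v"]) auto

lemma sent_known: "u \<in> nbrs E v \<Longrightarrow> sent j u \<subseteq> known j v"
proof (induction j)
  case (Suc j)
  have "set_option (pick (flood E S j u)) \<subseteq> known (Suc j) v" using Suc.prems by auto
  then show ?case using Suc by auto
qed simp

text \<open>An item that is late at distance \<open>d\<close> has been overtaken by sufficiently many other items.\<close>

lemma flood_late:
  "r \<in> V \<Longrightarrow> x \<in> S r \<Longrightarrow> (r, v) \<in> und_edges E ^^ d \<Longrightarrow> x \<notin> known j v \<Longrightarrow> card (known j v) + d \<ge> j + 1"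
proof (induction d arbitrary: v j)
  case 0
  then show ?case using known_mono[of 0 j r] by auto
next
  case (Suc d)
  then obtain u where u: "(r, u) \<in> und_edges E ^^ d" "(u, v) \<in> und_edges E" by auto
  then have un: "u \<in> nbrs E v" using und_edges_sym by (auto simp: nbrs_def)
  note uV = nbrs_V(1)[OF un] and vV = nbrs_V(2)[OF un]
  have outer_IH: "\<And>j. x \<notin> known j u \<Longrightarrow> card (known j u) + d \<ge> j + 1"
    using Suc.IH[OF Suc.prems(1,2) u(1)] .
  \<comment> \<open>While \<open>u\<close> is busy, its set of sent items grows by one per round. In
    an idle round it has sent all it knows, so \<open>x\<close> is still unknown to \<open>u\<close>
    and the outer hypothesis counts the items for it.\<close>
  have "card (sent j u) + Suc d \<ge> j + 1" using Suc.prems(4)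
  proof (induction j)
    case (Suc j)
    have nk: "x \<notin> known j v" using Suc.prems known_mono[of j "Suc j" v] by auto
    have ih: "card (sent j u) + Suc d \<ge> j + 1" using Suc.IH[OF nk] .
    show ?case
    proof (cases "known j u \<subseteq> sent j u")
      case False
      then obtain y where "y \<in> known j u - sent j u" "pick (flood E S j u) = Some y"
        using pick_Some[OF uV] by blast
      then have "card (sent (Suc j) u) = Suc (card (sent j u))"
        using known_finite(2)[OF uV, of j] by simp
      then show ?thesis using ih by simp
    next
      case True
      then have eq: "sent j u = known j u" using flood_inv[OF uV] by blast
      then have "x \<notin> known j u" using sent_known[OF un, of j] nk by blast
      then have "card (known j u) + d \<ge> j + 1" using outer_IH by blast
      moreover have "card (sent j u) \<le> card (sent (Suc j) u)"
        by (rule card_mono) (use known_finite(2)[OF uV, of "Suc j"] in auto)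
      ultimately show ?thesis using eq by simp
    qed
  qed simp
  moreover have "card (sent j u) \<le> card (known j v)"
    by (rule card_mono[OF known_finite(1)[OF vV] sent_known[OF un]])
  ultimately show ?case by simp
qed

lemma flood_complete:
  assumes "v \<in> V" "j \<ge> card (\<Union>v\<in>V. S v) + D" "\<And>r. r \<in> V \<Longrightarrow> \<exists>d\<le>D. (r, v) \<in> und_edges E ^^ d"
  shows "known j v = (\<Union>v\<in>V. S v)"
proof (rule ccontr)
  assume "known j v \<noteq> (\<Union>v\<in>V. S v)"
  then obtain r x where x: "r \<in> V" "x \<in> S r" "x \<notin> known j v" and ss: "known j v \<subset> (\<Union>v\<in>V. S v)"
    using flood_inv[OF assms(1), of j] by blast
  obtain d where d: "d \<le> D" "(r, v) \<in> und_edges E ^^ d" using assms(3)[OF x(1)] by blast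
  have "card (known j v) < card (\<Union>v\<in>V. S v)" using ss finU by (rule psubset_card_mono[rotated])
  then show False using flood_late[OF x(1,2) d(2) x(3)] d(1) assms(2) by simp
qed

end

context net
begin

text \<open>Any two vertices are joined via the source by at most \<open>2 * ecc I\<close> edges,
  and overtaking costs one round per distinct item; an item held by several vertices counts once.
  Items are coded as naturals so that \<open>pick\<close> can take a minimum.\<close>

lemma knows_broadcast:
  fixes x :: "inst \<Rightarrow> nat \<Rightarrow> 'x::countable" and M :: "nat \<Rightarrow> 'm::countable set"
  assumes x: "knows T x"
    and its: "\<And>I v. I \<in> G \<Longrightarrow> v \<in> VV I \<Longrightarrow> items I v = itf (base I v) (x I v)"
    and M: "small M" "\<And>I v. I \<in> G \<Longrightarrow> v \<in> VV I \<Longrightarrow> items I v \<subseteq> M (nn I)"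
    and N: "\<And>I. I \<in> G \<Longrightarrow> card (\<Union>v\<in>VV I. items I v) \<le> N (nn I)"
  shows "knows (\<lambda>I. T I + (N (nn I) + 2 * ecc I)) (\<lambda>I v. (x I v, list_of (\<Union>v\<in>VV I. items I v)))"
proof -
  define S where "S I v = to_nat ` items I v" for I v
  define Y where "Y I j v = (let (K, S) = flood (EE I) (S I) j v in (list_of K, list_of S))" for I j v
  have fin: "finite (items I v)" if "I \<in> G" "v \<in> VV I" for I v
    using M(1) smallE M(2)[OF that] conn_instD(1)[OF conn[OF that(1)]] finite_subset by metis
  have finU: "finite (\<Union>v\<in>VV I. S I v)" if "I \<in> G" for I
    using fin[OF that] conn_instD(2)[OF conn[OF that]] by (auto simp: S_def)
  note E = conn_instD(4)[OF conn]
  note fk = known_finite[OF E finU] and fi = flood_inv[OF E finU]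
  have Yset: "map_prod set set (Y I j v) = flood (EE I) (S I) j v" if "I \<in> G" "v \<in> VV I" for I v j
    using fk[OF that(1) that(1) that(2), of j] unfolding Y_def by (auto split: prod.splits)
  have "knows (\<lambda>I. T I + (N (nn I) + 2 * ecc I)) (\<lambda>I v. (x I v, Y I (N (nn I) + 2 * ecc I) v))"
  proof (rule knows_rounds[where r = "\<lambda>n m. N n + 2 * m" and Y = Y and yi = "\<lambda>b x. (list_of (to_nat ` itf b x), list_of {})"
        and sd = "\<lambda>j b x y u. pick (map_prod set set y)"
        and M = "\<lambda>n. {None} \<union> Some ` to_nat ` M n"
        and up = "\<lambda>j b x y ib. (list_of (set (fst y) \<union> {z. \<exists>u\<in>set (nbl (fst b)). ib u = Some (Some z)}),
           list_of (set (snd y) \<union> set_option (pick (map_prod set set y))))", OF x])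
    show "small (\<lambda>n. {None} \<union> Some ` to_nat ` M n)"
      by (intro small_Un small_image small_single M)
    fix I v assume IG: "I \<in> G" and v: "v \<in> VV I"
    show "Y I 0 v = (list_of (to_nat ` itf (base I v) (x I v)), list_of {})"
      using its[OF IG v] by (simp add: Y_def S_def)
    fix j
    show "pick (map_prod set set (Y I j v)) \<in> {None} \<union> Some ` to_nat ` M (nn I)"
    proof -
      have "pick (flood (EE I) (S I) j v) \<in> {None} \<union> Some ` known (EE I) (S I) j v"
      proof (cases "known (EE I) (S I) j v \<subseteq> sent (EE I) (S I) j v")
        case False
        then show ?thesis using pick_Some[OF E[OF IG] finU[OF IG] v, of j] by auto
      qed (simp add: pick_def case_prod_beta)
      moreover have "known (EE I) (S I) j v \<subseteq> to_nat ` M (nn I)"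
        using fi[OF IG IG v, of j] M(2)[OF IG] unfolding S_def by blast
      ultimately show ?thesis by (simp add: Yset[OF IG v]) blast
    qed
    have Y1: "set (fst (Y I j v)) = known (EE I) (S I) j v" "set (snd (Y I j v)) = sent (EE I) (S I) j v"
      using Yset[OF IG v, of j] by (metis fst_map_prod, metis snd_map_prod)
    have "{z. \<exists>u\<in>nbrs (EE I) v. (if u \<in> nbrs (EE I) v then Some (pick (map_prod set set (Y I j u))) else None) = Some (Some z)}
      = {z. \<exists>u\<in>nbrs (EE I) v. pick (flood (EE I) (S I) j u) = Some z}"
      using Yset[OF IG conn_instD(8)[OF conn[OF IG]]] by auto
    then show "Y I (Suc j) v = (list_of (set (fst (Y I j v)) \<union> {z. \<exists>u\<in>set (nbl (fst (base I v))).
           (if u \<in> nbrs (EE I) v then Some (pick (map_prod set set (Y I j u))) else None) = Some (Some z)}),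
           list_of (set (snd (Y I j v)) \<union> set_option (pick (map_prod set set (Y I j v)))))"
      unfolding Y1 Yset[OF IG v] by (simp add: Y_def base_def set_nbl[OF conn[OF IG]])
  qed
  then show ?thesis
  proof (rule knows_map[where g = "\<lambda>b (x, y). (x, list_of (from_nat ` set (fst y)))"])
    fix I v assume IG: "I \<in> G" and v: "v \<in> VV I"
    note c = conn[OF IG]
    have "known (EE I) (S I) (N (nn I) + 2 * ecc I) v = (\<Union>v\<in>VV I. S I v)"
    proof (rule flood_complete[OF E[OF IG] finU[OF IG] v, where D = "2 * ecc I"])
      have "card (\<Union>v\<in>VV I. S I v) = card (to_nat ` (\<Union>v\<in>VV I. items I v))"
        by (simp add: S_def image_UN)
      also have "\<dots> = card (\<Union>v\<in>VV I. items I v)" by (rule card_image) simp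
      finally show "card (\<Union>v\<in>VV I. S I v) + 2 * ecc I \<le> N (nn I) + 2 * ecc I" using N[OF IG] by simp
      fix r assume r: "r \<in> VV I"
      show "\<exists>d\<le>2 * ecc I. (r, v) \<in> und_edges (EE I) ^^ d"
        using walk_via_s[OF c r v] sdist_le_ecc[OF c r] sdist_le_ecc[OF c v]
        by (intro exI[of _ "sdist I r + sdist I v"]) auto
    qed
    then have "set (fst (Y I (N (nn I) + 2 * ecc I) v)) = (\<Union>v\<in>VV I. S I v)"
      using Yset[OF IG v] by (metis fst_map_prod)
    then have "from_nat ` set (fst (Y I (N (nn I) + 2 * ecc I) v)) = (\<Union>v\<in>VV I. items I v)"
      by (simp add: S_def image_UN image_image)
    then show "(x I v, list_of (\<Union>v\<in>VV I. items I v)) = (case (x I v, Y I (N (nn I) + 2 * ecc I) v) of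
         (x, y) \<Rightarrow> (x, list_of (from_nat ` set (fst y))))" by simp
  qed
qed

end

section \<open>Prefix sums along the path\<close>

definition l_id :: "loc \<Rightarrow> nat" where "l_id = (\<lambda>(n, v, os, is, a, b, pe, c). v)"
definition l_out :: "loc \<Rightarrow> (nat \<times> nat) set" where "l_out = (\<lambda>(n, v, os, is, a, b, pe, c). set os)"
definition l_in :: "loc \<Rightarrow> (nat \<times> nat) set" where "l_in = (\<lambda>(n, v, os, is, a, b, pe, c). set is)"
definition l_src :: "loc \<Rightarrow> bool" where "l_src = (\<lambda>(n, v, os, is, a, b, pe, c). a)"
definition l_trg :: "loc \<Rightarrow> bool" where "l_trg = (\<lambda>(n, v, os, is, a, b, pe, c). b)"
definition l_pe :: "loc \<Rightarrow> (nat \<times> nat) set" where "l_pe = (\<lambda>(n, v, os, is, a, b, pe, c). set pe)"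
definition l_L :: "loc \<Rightarrow> bool" where "l_L = (\<lambda>(n, v, os, is, a, b, pe, c). c)"

lemma l_simps [simp]:
  "l_id (loc I v) = v" "l_src (loc I v) = (v = ss I)" "l_trg (loc I v) = (v = tt I)"
  "l_L (loc I v) = (v \<in> LL I)"
  "l_pe (loc I v) = {e \<in> set (edges_of (PP I)). fst e = v \<or> snd e = v}"
  by (simp_all add: l_id_def l_src_def l_trg_def l_L_def l_pe_def loc_def locof_def local_input_def)

lemma l_out_in:
  assumes "conn_inst I"
  shows "l_out (loc I v) = {(u, ww I (v, u)) |u. (v, u) \<in> EE I}"
    "l_in (loc I v) = {(u, ww I (u, v)) |u. (u, v) \<in> EE I}"
proof -
  have "{(u, ww I (v, u)) |u. (v, u) \<in> EE I} = (\<lambda>e. (snd e, ww I e)) ` {e \<in> EE I. fst e = v}"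
    by force
  moreover have "{(u, ww I (u, v)) |u. (u, v) \<in> EE I} = (\<lambda>e. (fst e, ww I e)) ` {e \<in> EE I. snd e = v}"
    by force
  ultimately have "finite {(u, ww I (v, u)) |u. (v, u) \<in> EE I}" "finite {(u, ww I (u, v)) |u. (u, v) \<in> EE I}"
    using conn_instD(6)[OF assms] by simp_all
  then show "l_out (loc I v) = {(u, ww I (v, u)) |u. (v, u) \<in> EE I}"
    "l_in (loc I v) = {(u, ww I (u, v)) |u. (u, v) \<in> EE I}"
    by (simp_all add: l_out_def l_in_def loc_def locof_def local_input_def)
qed

lemma fst_base [simp]: "fst (base I v) = loc I v" and snd_base [simp]: "snd (base I v) = ecc I"
  by (simp_all add: base_def)

lemma in_edges_of: "(u, v) \<in> set (edges_of p) \<longleftrightarrow> (\<exists>i. Suc i < length p \<and> u = p ! i \<and> v = p ! Suc i)"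
proof -
  have "(u, v) \<in> set (edges_of p) \<longleftrightarrow> (\<exists>i<length p - 1. u = p ! i \<and> v = tl p ! i)"
    unfolding edges_of_def in_set_zip by auto
  also have "\<dots> \<longleftrightarrow> (\<exists>i. Suc i < length p \<and> u = p ! i \<and> v = p ! Suc i)"
  proof -
    have "(i < length p - 1 \<and> u = p ! i \<and> v = tl p ! i) = (Suc i < length p \<and> u = p ! i \<and> v = p ! Suc i)" for i
      by (auto simp: nth_tl)
    then show ?thesis by (simp only:)
  qed
  finally show ?thesis .
qed

definition path_inst :: "nat \<Rightarrow> inst \<Rightarrow> bool" where
  "path_inst cI I \<longleftrightarrow> conn_inst I \<and> PP I \<noteq> [] \<and> distinct (PP I) \<and> set (PP I) \<subseteq> VV I \<and>
     set (edges_of (PP I)) \<subseteq> EE I \<and> PP I ! 0 = ss I \<and> last (PP I) = tt I \<and> LL I \<subseteq> VV I \<and>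
     (\<forall>v\<in>VV I. v < nn I ^ cI)"

text \<open>Vacuous for lists shorter than \<open>z\<close>: such a path forms a single piece
  anyway.\<close>

definition hits :: "nat \<Rightarrow> nat set \<Rightarrow> nat list \<Rightarrow> bool" where
  "hits z L xs \<longleftrightarrow> (\<forall>i. i + z \<le> length xs \<longrightarrow> (\<exists>j. i \<le> j \<and> j < i + z \<and> xs ! j \<in> L))"

definition idx :: "inst \<Rightarrow> nat \<Rightarrow> nat" where "idx I v = (THE i. i < length (PP I) \<and> PP I ! i = v)"

lemma idx_nth [simp]: "distinct (PP I) \<Longrightarrow> i < length (PP I) \<Longrightarrow> idx I (PP I ! i) = i"
  unfolding idx_def by (rule the_equality) (auto simp: nth_eq_iff_index_eq)

text \<open>Segments of \<open>P\<close> begin at the source, whose label is \<open>None\<close>, and at the landmarks.\<close>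

fun lstart :: "inst \<Rightarrow> nat \<Rightarrow> nat" where
  "lstart I 0 = 0"
| "lstart I (Suc i) = (if PP I ! Suc i \<in> LL I then Suc i else lstart I i)"

definition lab :: "inst \<Rightarrow> nat \<Rightarrow> nat option" where "lab I i = (if i = 0 then None else Some (PP I ! i))"

lemma lstart_le: "lstart I i \<le> i" by (induction i) auto

lemma lstart_ge: "j \<le> i \<Longrightarrow> PP I ! j \<in> LL I \<Longrightarrow> j \<le> lstart I i"
  by (induction i) (auto simp: le_Suc_eq)

lemma lstart_L: "lstart I i > 0 \<Longrightarrow> PP I ! lstart I i \<in> LL I"
  by (induction i) auto

lemma lstart_near:
  assumes "hits z (LL I) (PP I)" "i < length (PP I)"
  shows "i < lstart I i + z"
proof (rule ccontr)
  assume "\<not> i < lstart I i + z"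
  then have "Suc (lstart I i) + z \<le> length (PP I)" using assms(2) by simp
  then obtain j where "Suc (lstart I i) \<le> j" "j < Suc (lstart I i) + z" "PP I ! j \<in> LL I"
    using assms(1) unfolding hits_def by blast
  then show False using lstart_ge[of j i I] \<open>\<not> i < lstart I i + z\<close> by simp
qed

section \<open>Folds over segments and over prefixes of the path\<close>

context
  fixes opr :: "'y \<Rightarrow> 'y \<Rightarrow> 'y"
begin

fun seg_fold :: "inst \<Rightarrow> (nat \<Rightarrow> 'y) \<Rightarrow> nat \<Rightarrow> 'y" where
  "seg_fold I y 0 = y (PP I ! 0)"
| "seg_fold I y (Suc i) = (if PP I ! Suc i \<in> LL I then y (PP I ! Suc i) else opr (seg_fold I y i) (y (PP I ! Suc i)))"

fun prefix_fold :: "inst \<Rightarrow> (nat \<Rightarrow> 'y) \<Rightarrow> nat \<Rightarrow> 'y" where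
  "prefix_fold I y 0 = y (PP I ! 0)"
| "prefix_fold I y (Suc i) = opr (prefix_fold I y i) (y (PP I ! Suc i))"

text \<open>What a vertex passes on along \<open>P\<close>: the label of its segment and the fold
  over the segment up to itself. Segment starts know it at once, all others wait for their
  predecessor. The source is tested first, so its label is \<open>None\<close> even when it is a
  landmark.\<close>

definition seg_out :: "bool \<Rightarrow> bool \<Rightarrow> nat \<Rightarrow> 'y \<Rightarrow> (nat option \<times> 'y) option \<Rightarrow> (nat option \<times> 'y) option" where
  "seg_out src lm v yv m = (if src then Some (None, yv) else if lm then Some (Some v, yv)
     else (case m of None \<Rightarrow> None | Some (q, f) \<Rightarrow> Some (q, opr f yv)))"

fun seg_in :: "inst \<Rightarrow> (nat \<Rightarrow> 'y) \<Rightarrow> nat \<Rightarrow> nat \<Rightarrow> (nat option \<times> 'y) option" where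
  "seg_in I y 0 i = None"
| "seg_in I y (Suc j) 0 = None"
| "seg_in I y (Suc j) (Suc i) = seg_out (i = 0) (PP I ! i \<in> LL I) (PP I ! i) (y (PP I ! i)) (seg_in I y j i)"

text \<open>Values travel one edge per round from the segment start, so after \<open>j\<close>
  rounds exactly the vertices within \<open>j\<close> edges of it are served.\<close>

lemma seg_out_inI:
  "seg_out (i = 0) (PP I ! i \<in> LL I) (PP I ! i) (y (PP I ! i)) (seg_in I y j i) =
    (if i \<le> lstart I i + j then Some (lab I (lstart I i), seg_fold I y i) else None)"
proof (induction i arbitrary: j)
  case 0
  then show ?case by (simp add: seg_out_def lab_def)
next
  case (Suc i)
  show ?case
  proof (cases "PP I ! Suc i \<in> LL I")
    case True
    then show ?thesis by (simp add: seg_out_def lab_def)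
  next
    case False
    show ?thesis
    proof (cases j)
      case 0
      then show ?thesis using False lstart_le[of I i] by (simp add: seg_out_def)
    next
      case (Suc j')
      then show ?thesis using False Suc.IH[of j'] by (auto simp: seg_out_def split: if_splits)
    qed
  qed
qed

text \<open>Positions on \<open>P\<close> are not known to the vertices, so segments are chained by
  labels: an item holds the label of a segment, the landmark that follows it and the fold over it.
  \<open>g\<close> is the fold over everything strictly before \<open>q\<close>.\<close>

inductive start_fold :: "(nat option \<times> nat \<times> 'y) set \<Rightarrow> nat \<Rightarrow> 'y \<Rightarrow> bool" for It where
  "(None, q, f) \<in> It \<Longrightarrow> start_fold It q f"
| "(Some q, q', f) \<in> It \<Longrightarrow> start_fold It q g \<Longrightarrow> start_fold It q' (opr g f)"

definition seg_items :: "inst \<Rightarrow> (nat \<Rightarrow> 'y) \<Rightarrow> (nat option \<times> nat \<times> 'y) set" where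
  "seg_items I y = {(lab I (lstart I i), PP I ! Suc i, seg_fold I y i) |i. Suc i < length (PP I) \<and> PP I ! Suc i \<in> LL I}"

context
  assumes assoc: "\<And>a b c. opr (opr a b) c = opr a (opr b c)"
begin

text \<open>Associativity splits a prefix at the last segment start. There is no neutral element, so
  the first segment, with nothing before it, is a case of its own.\<close>

lemma prefix_fold_segf:
  "prefix_fold I y i = (if lstart I i = 0 then seg_fold I y i else opr (prefix_fold I y (lstart I i - 1)) (seg_fold I y i))"
proof (induction i)
  case (Suc i)
  then show ?case by (auto simp: assoc)
qed simp

lemma start_fold_sound:
  assumes "distinct (PP I)" "start_fold (seg_items I y) q g"
  shows "\<exists>i. Suc i < length (PP I) \<and> q = PP I ! Suc i \<and> g = prefix_fold I y i"
  using assms(2)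
proof (induction rule: start_fold.induct)
  case (1 q f)
  then obtain i where i: "Suc i < length (PP I)" "lab I (lstart I i) = None" "q = PP I ! Suc i" "f = seg_fold I y i"
    by (auto simp: seg_items_def)
  then have "f = prefix_fold I y i" using prefix_fold_segf[of I y i] by (simp add: lab_def split: if_splits)
  then show ?case using i by blast
next
  case (2 q q' f g)
  then obtain i where i: "Suc i < length (PP I)" "PP I ! Suc i \<in> LL I" "lab I (lstart I i) = Some q"
    "q' = PP I ! Suc i" "f = seg_fold I y i" by (auto simp: seg_items_def)
  obtain k where k: "Suc k < length (PP I)" "q = PP I ! Suc k" "g = prefix_fold I y k" using 2 by blast
  have ls: "lstart I i \<noteq> 0" "PP I ! lstart I i = q" using i(3) by (auto simp: lab_def split: if_splits)
  then have "lstart I i = Suc k" using k assms(1) lstart_le[of I i] i(1)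
    by (metis Suc_lessD le_less_trans nth_eq_iff_index_eq)
  then have "opr g f = prefix_fold I y i" using prefix_fold_segf[of I y i] k i(5) by simp
  then show ?case using i by blast
qed

lemma start_fold_complete:
  "Suc i < length (PP I) \<Longrightarrow> PP I ! Suc i \<in> LL I \<Longrightarrow> start_fold (seg_items I y) (PP I ! Suc i) (prefix_fold I y i)"
proof (induction i rule: less_induct)
  case (less i)
  have it: "(lab I (lstart I i), PP I ! Suc i, seg_fold I y i) \<in> seg_items I y"
    using less.prems by (auto simp: seg_items_def)
  show ?case
  proof (cases "lstart I i")
    case 0
    then show ?thesis using it prefix_fold_segf[of I y i] by (auto simp: lab_def intro: start_fold.intros)
  next
    case (Suc k)
    have "start_fold (seg_items I y) (PP I ! Suc k) (prefix_fold I y k)"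
      using less.IH[of k] lstart_le[of I i] lstart_L[of I i] Suc less.prems by simp
    then show ?thesis using it start_fold.intros(2)[of "PP I ! Suc k" "PP I ! Suc i"] prefix_fold_segf[of I y i] Suc
      by (simp add: lab_def)
  qed
qed

lemma start_fold_the:
  assumes "distinct (PP I)" "Suc i < length (PP I)" "PP I ! Suc i \<in> LL I"
  shows "(THE g. start_fold (seg_items I y) (PP I ! Suc i) g) = prefix_fold I y i"
proof (rule the_equality)
  show "start_fold (seg_items I y) (PP I ! Suc i) (prefix_fold I y i)" using start_fold_complete assms by blast
  fix g assume "start_fold (seg_items I y) (PP I ! Suc i) g"
  then obtain k where "Suc k < length (PP I)" "PP I ! Suc i = PP I ! Suc k" "g = prefix_fold I y k"
    using start_fold_sound[OF assms(1)] by blast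
  then show "g = prefix_fold I y i" using assms by (simp add: nth_eq_iff_index_eq)
qed

end

end

definition onP :: "loc \<Rightarrow> bool" where "onP l \<longleftrightarrow> l_src l \<or> (\<exists>u. (u, l_id l) \<in> l_pe l)"

lemma onP_loc:
  assumes "path_inst cI I" shows "onP (loc I v) \<longleftrightarrow> v \<in> set (PP I)"
proof -
  have "PP I \<noteq> []" "PP I ! 0 = ss I" using assms by (auto simp: path_inst_def)
  then have "v \<in> set (PP I) \<longleftrightarrow> v = ss I \<or> (\<exists>i. Suc i < length (PP I) \<and> v = PP I ! Suc i)"
  proof (intro iffI)
    assume "v \<in> set (PP I)"
    then obtain i where "i < length (PP I)" "v = PP I ! i" by (auto simp: in_set_conv_nth)
    then show "v = ss I \<or> (\<exists>i. Suc i < length (PP I) \<and> v = PP I ! Suc i)"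
      using \<open>PP I ! 0 = ss I\<close> by (cases i) auto
  next
    assume "v = ss I \<or> (\<exists>i. Suc i < length (PP I) \<and> v = PP I ! Suc i)"
    then show "v \<in> set (PP I)" using \<open>PP I ! 0 = ss I\<close> \<open>PP I \<noteq> []\<close> nth_mem[of 0 "PP I"] by auto
  qed
  then show ?thesis by (auto simp: onP_def in_edges_of)
qed

text \<open>The deterministic part sees the random set \<open>LL\<close> only as a few vertices that
  hit; \<open>z\<close> and \<open>kk\<close> stay parameters, to be instantiated by
  \<open>seg_len\<close> and \<open>lm_bound\<close>.\<close>

locale pnet = net G for G +
  fixes cI :: nat and z kk :: "nat \<Rightarrow> nat"
  assumes pin: "\<And>I. I \<in> G \<Longrightarrow> path_inst cI I"
    and hitsP: "\<And>I. I \<in> G \<Longrightarrow> hits (z (nn I)) (LL I) (PP I)"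
    and cardL: "\<And>I. I \<in> G \<Longrightarrow> card (LL I) \<le> kk (nn I)"
    and z_pos: "\<And>n. z n \<ge> 1"
begin

lemma pinD:
  assumes "I \<in> G"
  shows "PP I \<noteq> []" "distinct (PP I)" "set (PP I) \<subseteq> VV I" "set (edges_of (PP I)) \<subseteq> EE I"
    "PP I ! 0 = ss I" "last (PP I) = tt I" "LL I \<subseteq> VV I" "\<And>v. v \<in> VV I \<Longrightarrow> v < nn I ^ cI"
  using pin[OF assms] unfolding path_inst_def by auto

lemma ids_small: "small (\<lambda>n. {..n ^ cI})"
  using small_atMost_poly[of 1 cI] by simp

text \<open>A direct scan would take as many rounds as \<open>P\<close> has edges. Scanning each
  segment takes \<open>z\<close> rounds, and one item per landmark is broadcast, from which every
  vertex combines what precedes its own segment. It serves twice: for prefix lengths with addition,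
  and for the final prefix maximum with \<open>vmax\<close>.\<close>

theorem knows_scan:
  fixes x :: "inst \<Rightarrow> nat \<Rightarrow> 'x::countable" and opr :: "'y::countable \<Rightarrow> 'y \<Rightarrow> 'y"
  assumes x: "knows T x"
    and assoc: "\<And>a b c. opr (opr a b) c = opr a (opr b c)"
    and y: "\<And>I v. I \<in> G \<Longrightarrow> v \<in> set (PP I) \<Longrightarrow> y I v = yf (base I v) (x I v)"
    and M: "small M" "\<And>I i. I \<in> G \<Longrightarrow> i < length (PP I) \<Longrightarrow> seg_fold opr I (y I) i \<in> M (nn I)"
  shows "knows (\<lambda>I. T I + z (nn I) + (kk (nn I) + 2 * ecc I))
    (\<lambda>I v. (x I v, if v \<in> set (PP I) then prefix_fold opr I (y I) (idx I v) else undefined))"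
proof -
  let ?ids = "\<lambda>n. {None} \<union> Some ` {..n ^ cI}"
  define Y where "Y I j v = (if v \<in> set (PP I) then seg_in opr I (y I) j (idx I v) else None)" for I j v
  define own where "own b x m = seg_out opr (l_src (fst b)) (l_L (fst b)) (l_id (fst b)) (yf b x) m"
    for b :: "loc \<times> nat" and x m
  have own: "own (base I (PP I ! i)) (x I (PP I ! i)) (Y I j (PP I ! i)) =
      (if i \<le> lstart I i + j then Some (lab I (lstart I i), seg_fold opr I (y I) i) else None)"
    if IG: "I \<in> G" and i: "i < length (PP I)" for I i j
  proof -
    have "(PP I ! i = ss I) = (i = 0)"
      using pinD(1,2,5)[OF IG] i by (metis length_greater_0_conv nth_eq_iff_index_eq)
    then show ?thesis
      using seg_out_inI[of opr i I "y I" j] y[OF IG, of "PP I ! i"] pinD[OF IG] i by (simp add: own_def Y_def)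
  qed
  have lab: "lab I i \<in> ?ids (nn I)" if "I \<in> G" "i < length (PP I)" for I i
  proof -
    have "PP I ! i \<in> VV I" using pinD(3)[OF that(1)] that(2) by auto
    then show ?thesis using pinD(8)[OF that(1)] by (auto simp: lab_def intro: less_imp_le)
  qed
  have one: "knows (\<lambda>I. T I + z (nn I)) (\<lambda>I v. (x I v, Y I (z (nn I)) v))"
  proof (rule knows_rounds[where r = "\<lambda>n _. z n" and Y = Y and yi = "\<lambda>b x. None"
        and sd = "\<lambda>j b x m u. if (l_id (fst b), u) \<in> l_pe (fst b) then own b x m else None"
        and up = "\<lambda>j b x m ib. if \<exists>u. (u, l_id (fst b)) \<in> l_pe (fst b)
             then the (ib (THE u. (u, l_id (fst b)) \<in> l_pe (fst b))) else None"
        and M = "\<lambda>n. {None} \<union> Some ` (?ids n \<times> M n)", OF x])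
    show "small (\<lambda>n. {None} \<union> Some ` (?ids n \<times> M n))"
      by (intro small_Un small_image small_single small_Times M ids_small)
    fix I v assume IG: "I \<in> G" and v: "v \<in> VV I"
    note D = pinD[OF IG]
    show "Y I 0 v = None" by (simp add: Y_def)
    fix j
    show "(if (l_id (fst (base I v)), u) \<in> l_pe (fst (base I v)) then own (base I v) (x I v) (Y I j v) else None)
       \<in> {None} \<union> Some ` (?ids (nn I) \<times> M (nn I))" for u
    proof (cases "(v, u) \<in> set (edges_of (PP I))")
      case True
      then obtain i where i: "Suc i < length (PP I)" "v = PP I ! i" by (auto simp: in_edges_of)
      then show ?thesis using own[OF IG, of i j] lab[OF IG, of "lstart I i"] lstart_le[of I i] M(2)[OF IG, of i]
        by auto
    qed simp
    show "Y I (Suc j) v = (if \<exists>u. (u, l_id (fst (base I v))) \<in> l_pe (fst (base I v))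
             then the ((\<lambda>u. if u \<in> nbrs (EE I) v then Some (if (l_id (fst (base I u)), v) \<in> l_pe (fst (base I u))
                then own (base I u) (x I u) (Y I j u) else None) else None)
                 (THE u. (u, l_id (fst (base I v))) \<in> l_pe (fst (base I v)))) else None)"
    proof (cases "\<exists>u. (u, v) \<in> set (edges_of (PP I))")
      case True
      then obtain i where i: "Suc i < length (PP I)" "v = PP I ! Suc i" by (auto simp: in_edges_of)
      have e: "(PP I ! i, v) \<in> set (edges_of (PP I))" using i by (auto simp: in_edges_of)
      have the: "(THE u. (u, v) \<in> set (edges_of (PP I))) = PP I ! i"
        using e i D(2) by (intro the_equality) (auto simp: in_edges_of nth_eq_iff_index_eq)
      have "PP I ! i \<in> nbrs (EE I) v" using e D(4) by (auto simp: nbrs_def und_edges_def)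
      moreover have "Y I (Suc j) v = own (base I (PP I ! i)) (x I (PP I ! i)) (Y I j (PP I ! i))"
        using i D(2) own[OF IG, of i j] seg_out_inI[of opr i I "y I" j] by (simp add: Y_def)
      ultimately show ?thesis using True e the by simp
    next
      case False
      then have "Y I (Suc j) v = None"
      proof (cases "v \<in> set (PP I)")
        case True
        then obtain i where i: "i < length (PP I)" "v = PP I ! i" by (auto simp: in_set_conv_nth)
        have "i = 0" using False i by (cases i) (auto simp: in_edges_of)
        then show ?thesis using i D(2) by (simp add: Y_def)
      qed (simp add: Y_def)
      then show ?thesis using False by simp
    qed
  qed
  define items where "items I v = (if v \<in> LL I \<and> v \<noteq> ss I then
      (case Y I (z (nn I)) v of None \<Rightarrow> {} | Some (l, f) \<Rightarrow> {(l, v, f)}) else {})" for I v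
  \<comment> \<open>\<open>Y\<close> is what has arrived from the predecessor, so a landmark holds
    the fold over the segment that ends just before it.\<close>
  have Yz: "Y I (z (nn I)) (PP I ! Suc i) = Some (lab I (lstart I i), seg_fold opr I (y I) i)"
    if IG: "I \<in> G" and i: "Suc i < length (PP I)" for I i
  proof -
    obtain z' where z': "z (nn I) = Suc z'" using z_pos[of "nn I"] by (cases "z (nn I)") auto
    have "i \<le> lstart I i + z'" using lstart_near[OF hitsP[OF IG], of i] i z' by simp
    then show ?thesis using i pinD(2)[OF IG] seg_out_inI[of opr i I "y I" z'] by (simp add: Y_def z')
  qed
  have items: "(\<Union>v\<in>VV I. items I v) = seg_items opr I (y I)" if IG: "I \<in> G" for I
  proof
    note D = pinD[OF IG]
    show "seg_items opr I (y I) \<subseteq> (\<Union>v\<in>VV I. items I v)"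
    proof
      fix e assume "e \<in> seg_items opr I (y I)"
      then obtain i where i: "Suc i < length (PP I)" "PP I ! Suc i \<in> LL I"
        "e = (lab I (lstart I i), PP I ! Suc i, seg_fold opr I (y I) i)" by (auto simp: seg_items_def)
      have "PP I ! Suc i \<noteq> ss I" using D(1,2,5) i by (metis length_greater_0_conv nat.distinct(1) nth_eq_iff_index_eq)
      then have "e \<in> items I (PP I ! Suc i)" using i Yz[OF IG i(1)] by (simp add: items_def)
      then show "e \<in> (\<Union>v\<in>VV I. items I v)" using i D(7) by blast
    qed
    show "(\<Union>v\<in>VV I. items I v) \<subseteq> seg_items opr I (y I)"
    proof
      fix e assume "e \<in> (\<Union>v\<in>VV I. items I v)"
      then obtain v where v: "v \<in> VV I" "e \<in> items I v" by blast
      then have vL: "v \<in> LL I" "v \<noteq> ss I" and "Y I (z (nn I)) v \<noteq> None"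
        by (auto simp: items_def split: if_splits option.splits)
      then have "v \<in> set (PP I)" by (auto simp: Y_def split: if_splits)
      then obtain k where k: "k < length (PP I)" "v = PP I ! k" by (auto simp: in_set_conv_nth)
      then obtain i where i: "k = Suc i" using vL D(5) by (cases k) auto
      then show "e \<in> seg_items opr I (y I)"
        using v vL k Yz[OF IG, of i] by (auto simp: items_def seg_items_def)
    qed
  qed
  have two: "knows (\<lambda>I. T I + z (nn I) + (kk (nn I) + 2 * ecc I))
      (\<lambda>I v. ((x I v, Y I (z (nn I)) v), list_of (\<Union>v\<in>VV I. items I v)))"
  proof (rule knows_broadcast[where N = kk and M = "\<lambda>n. ?ids n \<times> {..n ^ cI} \<times> M n"
        and itf = "\<lambda>b (x, m). if l_L (fst b) \<and> \<not> l_src (fst b) then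
          (case m of None \<Rightarrow> {} | Some (l, f) \<Rightarrow> {(l, l_id (fst b), f)}) else {}", OF one])
    show "small (\<lambda>n. ?ids n \<times> {..n ^ cI} \<times> M n)"
      by (intro small_Un small_image small_single small_Times M ids_small)
    fix I assume IG: "I \<in> G"
    note D = pinD[OF IG]
    show "items I v \<subseteq> ?ids (nn I) \<times> {..nn I ^ cI} \<times> M (nn I)" if "v \<in> VV I" for v
    proof -
      have "items I v \<subseteq> seg_items opr I (y I)" using items[OF IG] that by blast
      also have "\<dots> \<subseteq> ?ids (nn I) \<times> {..nn I ^ cI} \<times> M (nn I)"
      proof
        fix e assume "e \<in> seg_items opr I (y I)"
        then obtain i where i: "Suc i < length (PP I)" "PP I ! Suc i \<in> LL I"
          "e = (lab I (lstart I i), PP I ! Suc i, seg_fold opr I (y I) i)" by (auto simp: seg_items_def)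
        have "PP I ! Suc i \<le> nn I ^ cI" using D(7,8) i by (meson less_imp_le subsetD)
        then show "e \<in> ?ids (nn I) \<times> {..nn I ^ cI} \<times> M (nn I)"
          using i lab[OF IG, of "lstart I i"] lstart_le[of I i] M(2)[OF IG, of i] by simp
      qed
      finally show ?thesis .
    qed
    have finL: "finite (LL I)" using D(7) conn_instD(2)[OF conn[OF IG]] finite_subset by blast
    have "seg_items opr I (y I) \<subseteq> (\<lambda>v. (lab I (lstart I (idx I v - 1)), v, seg_fold opr I (y I) (idx I v - 1))) ` LL I"
    proof
      fix e assume "e \<in> seg_items opr I (y I)"
      then obtain i where i: "Suc i < length (PP I)" "PP I ! Suc i \<in> LL I"
        "e = (lab I (lstart I i), PP I ! Suc i, seg_fold opr I (y I) i)" by (auto simp: seg_items_def)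
      then show "e \<in> (\<lambda>v. (lab I (lstart I (idx I v - 1)), v, seg_fold opr I (y I) (idx I v - 1))) ` LL I"
        using D(2) by (intro image_eqI[of _ _ "PP I ! Suc i"]) auto
    qed
    then have "card (seg_items opr I (y I)) \<le> card (LL I)" using surj_card_le[OF finL] by blast
    then show "card (\<Union>v\<in>VV I. items I v) \<le> kk (nn I)" using items[OF IG] cardL[OF IG] by simp
  qed (simp add: items_def split: option.split)
  show ?thesis
  proof (rule knows_map[OF two, where g = "\<lambda>b ((x, m), It). (x, if onP (fst b) then
      (case own b x m of Some (None, f) \<Rightarrow> f | Some (Some q, f) \<Rightarrow> opr (THE g. start_fold opr (set It) q g) f)
      else undefined)"], goal_cases)
    case (1 I v)
    then have IG: "I \<in> G" by simp
    note D = pinD[OF IG]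
    have "finite (seg_items opr I (y I))"
      by (rule finite_subset[of _ "(\<lambda>i. (lab I (lstart I i), PP I ! Suc i, seg_fold opr I (y I) i)) ` {..<length (PP I)}"])
         (auto simp: seg_items_def)
    then have It: "set (list_of (\<Union>v\<in>VV I. items I v)) = seg_items opr I (y I)" by (simp add: items[OF IG])
    show ?case
    proof (cases "v \<in> set (PP I)")
      case True
      then obtain i where i: "i < length (PP I)" "v = PP I ! i" by (auto simp: in_set_conv_nth)
      have ow: "own (base I v) (x I v) (Y I (z (nn I)) v) = Some (lab I (lstart I i), seg_fold opr I (y I) i)"
        using own[OF IG i(1)] lstart_near[OF hitsP[OF IG] i(1)] i by simp
      have "prefix_fold opr I (y I) i = (case lab I (lstart I i) of None \<Rightarrow> seg_fold opr I (y I) i |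
         Some q \<Rightarrow> opr (THE g. start_fold opr (seg_items opr I (y I)) q g) (seg_fold opr I (y I) i))"
      proof (cases "lstart I i")
        case 0
        then show ?thesis using prefix_fold_segf[OF assoc, of I "y I" i] by (simp add: lab_def)
      next
        case (Suc k)
        have "(THE g. start_fold opr (seg_items opr I (y I)) (PP I ! Suc k) g) = prefix_fold opr I (y I) k"
          by (rule start_fold_the[OF assoc D(2)]) (use lstart_le[of I i] lstart_L[of I i] i Suc in auto)
        then show ?thesis using prefix_fold_segf[OF assoc, of I "y I" i] Suc by (simp add: lab_def)
      qed
      then show ?thesis using ow It True i D(2) onP_loc[OF pin[OF IG], of v]
        by (auto split: option.splits)
    next
      case False
      then show ?thesis using onP_loc[OF pin[OF IG], of v] by simp
    qed
  qed
qed

end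

section \<open>Bounded-cost walks\<close>

inductive walk :: "(nat \<times> nat) set \<Rightarrow> (nat \<times> nat \<Rightarrow> nat) \<Rightarrow> nat \<Rightarrow> nat \<Rightarrow> nat \<Rightarrow> bool" for E c where
  walk_refl: "walk E c v v 0"
| walk_step: "(v, x) \<in> E \<Longrightarrow> walk E c x b d \<Longrightarrow> walk E c v b (c (v, x) + d)"

lemma walk_V: "walk E c v b d \<Longrightarrow> E \<subseteq> V \<times> V \<Longrightarrow> v \<in> V \<Longrightarrow> b \<in> V"
  by (induction rule: walk.induct) auto

text \<open>Maxima are compared through their upper bounds, which avoids exhibiting maximal
  elements.\<close>

lemma nat_eq_by_ub: "(\<And>y::nat. a \<le> y \<longleftrightarrow> b \<le> y) \<Longrightarrow> a = b"
  by (metis order_antisym order_refl)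

text \<open>The value \<open>0\<close> means that no vertex with positive \<open>val\<close> is reachable at cost \<open>d\<close>.\<close>

definition far :: "(nat \<times> nat) set \<Rightarrow> (nat \<times> nat \<Rightarrow> nat) \<Rightarrow> (nat \<Rightarrow> nat) \<Rightarrow> nat \<Rightarrow> nat \<Rightarrow> nat" where
  "far E c val d v = Max (insert 0 {val b |b d'. walk E c v b d' \<and> d' \<le> d})"

context
  fixes V :: "nat set" and E :: "(nat \<times> nat) set" and c :: "nat \<times> nat \<Rightarrow> nat" and val :: "nat \<Rightarrow> nat"
  assumes fV: "finite V" and E: "E \<subseteq> V \<times> V"
begin

lemma far_fin: "v \<in> V \<Longrightarrow> finite {val b |b d'. walk E c v b d' \<and> d' \<le> d}"
  by (rule finite_subset[of _ "val ` V"]) (use fV E walk_V in auto)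

lemma far_le_iff: "v \<in> V \<Longrightarrow> far E c val d v \<le> y \<longleftrightarrow> (\<forall>b d'. walk E c v b d' \<and> d' \<le> d \<longrightarrow> val b \<le> y)"
  unfolding far_def using far_fin[of v d] by (subst Max_le_iff) auto

lemma far_ge: "v \<in> V \<Longrightarrow> walk E c v b d' \<Longrightarrow> d' \<le> d \<Longrightarrow> val b \<le> far E c val d v"
  using far_le_iff[of v d "far E c val d v"] by blast

lemma far_attained: "v \<in> V \<Longrightarrow> far E c val d v > 0 \<Longrightarrow> \<exists>b d'. walk E c v b d' \<and> d' \<le> d \<and> far E c val d v = val b"
proof -
  assume v: "v \<in> V" and pos: "far E c val d v > 0"
  have "far E c val d v \<in> insert 0 {val b |b d'. walk E c v b d' \<and> d' \<le> d}"
    unfolding far_def using far_fin[OF v, of d] by (intro Max_in) auto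
  then show ?thesis using pos by auto
qed

text \<open>A walk is empty or starts with an edge out of \<open>v\<close>. With positive costs the
  right-hand side refers to smaller budgets only, so budgets can be treated one per round.\<close>

lemma far_rec:
  assumes v: "v \<in> V"
  shows "far E c val d v = Max (insert (val v)
     ((\<lambda>x. if c (v, x) \<le> d then far E c val (d - c (v, x)) x else 0) ` {x. (v, x) \<in> E}))"
proof (rule nat_eq_by_ub)
  fix y
  have fin: "finite {x. (v, x) \<in> E}" by (rule finite_subset[OF _ fV]) (use E in auto)
  have xV: "x \<in> V" if "(v, x) \<in> E" for x using that E by auto
  have "far E c val d v \<le> y \<longleftrightarrow> val v \<le> y \<and>
     (\<forall>x. (v, x) \<in> E \<longrightarrow> c (v, x) \<le> d \<longrightarrow> far E c val (d - c (v, x)) x \<le> y)"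
    unfolding far_le_iff[OF v]
  proof (intro iffI conjI allI impI)
    assume a: "\<forall>b d'. walk E c v b d' \<and> d' \<le> d \<longrightarrow> val b \<le> y"
    then show "val v \<le> y" using walk_refl by blast
    fix x assume x: "(v, x) \<in> E" "c (v, x) \<le> d"
    show "far E c val (d - c (v, x)) x \<le> y"
      unfolding far_le_iff[OF xV[OF x(1)]]
    proof (intro allI impI)
      fix b d' assume "walk E c x b d' \<and> d' \<le> d - c (v, x)"
      then have "walk E c v b (c (v, x) + d')" "c (v, x) + d' \<le> d" using walk_step[OF x(1)] x(2) by auto
      then show "val b \<le> y" using a by blast
    qed
  next
    fix b d'
    assume a: "val v \<le> y \<and> (\<forall>x. (v, x) \<in> E \<longrightarrow> c (v, x) \<le> d \<longrightarrow> far E c val (d - c (v, x)) x \<le> y)"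
      and b: "walk E c v b d' \<and> d' \<le> d"
    from b have "walk E c v b d'" by blast
    then show "val b \<le> y"
    proof cases
      case walk_refl then show ?thesis using a by simp
    next
      case (walk_step x d1)
      then have "c (v, x) \<le> d" "d1 \<le> d - c (v, x)" using b by auto
      then show ?thesis using a walk_step far_le_iff[OF xV[OF walk_step(2)]] by blast
    qed
  qed
  also have "\<dots> \<longleftrightarrow> Max (insert (val v)
     ((\<lambda>x. if c (v, x) \<le> d then far E c val (d - c (v, x)) x else 0) ` {x. (v, x) \<in> E})) \<le> y"
    using fin by (subst Max_le_iff) auto
  finally show "far E c val d v \<le> y \<longleftrightarrow> Max (insert (val v)
     ((\<lambda>x. if c (v, x) \<le> d then far E c val (d - c (v, x)) x else 0) ` {x. (v, x) \<in> E})) \<le> y" .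
qed

end

section \<open>Pipelined distances to many targets\<close>

text \<open>The sets of pairs only grow; a pair superseded by a smaller distance to the same target
  stays but is no longer scheduled.\<close>

definition cur :: "(nat \<times> nat) set \<Rightarrow> (nat \<times> nat) set" where
  "cur A = {(d, l) \<in> A. \<forall>d'. (d', l) \<in> A \<longrightarrow> d \<le> d'}"

definition lexl :: "nat \<times> nat \<Rightarrow> nat \<times> nat \<Rightarrow> bool" where
  "lexl p q \<longleftrightarrow> fst p < fst q \<or> fst p = fst q \<and> snd p < snd q"

lemma lexl_trans: "lexl p q \<Longrightarrow> lexl q r \<Longrightarrow> lexl p r" unfolding lexl_def by auto
lemma lexl_irrefl: "\<not> lexl p p" unfolding lexl_def by auto
lemma lexl_total: "p \<noteq> q \<Longrightarrow> lexl p q \<or> lexl q p" unfolding lexl_def by (auto simp: prod_eq_iff)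

definition cur_rank :: "(nat \<times> nat) set \<Rightarrow> nat \<times> nat \<Rightarrow> nat" where
  "cur_rank A p = card {q \<in> cur A. lexl q p}"

definition sched_pick :: "nat \<Rightarrow> (nat \<times> nat) set \<Rightarrow> (nat \<times> nat) option" where
  "sched_pick j A = (if \<exists>p\<in>cur A. fst p + cur_rank A p = j then Some (THE p. p \<in> cur A \<and> fst p + cur_rank A p = j) else None)"

text \<open>Along the lexicographic order the distance does not drop and the rank grows strictly, so
  no two current pairs are due in the same round: one pair per edge and round suffices.\<close>

lemma sched_pick_unique:
  assumes "finite A" "p \<in> cur A" "fst p + cur_rank A p = j"
  shows "sched_pick j A = Some p"
proof -
  have fin: "finite (cur A)" using assms(1) by (rule finite_subset[rotated]) (auto simp: cur_def)
  have mono: "fst p + cur_rank A p < fst q + cur_rank A q" if "lexl p q" "p \<in> cur A" for p q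
  proof -
    have "{r \<in> cur A. lexl r p} \<subset> {r \<in> cur A. lexl r q}"
      using that lexl_trans lexl_irrefl by blast
    then have "cur_rank A p < cur_rank A q" unfolding cur_rank_def using fin by (intro psubset_card_mono) auto
    moreover have "fst p \<le> fst q" using that by (auto simp: lexl_def)
    ultimately show ?thesis by simp
  qed
  have "(THE p. p \<in> cur A \<and> fst p + cur_rank A p = j) = p"
  proof (rule the_equality)
    fix q assume q: "q \<in> cur A \<and> fst q + cur_rank A q = j"
    show "q = p"
    proof (rule ccontr)
      assume "q \<noteq> p"
      then consider "lexl p q" | "lexl q p" using lexl_total by blast
      then show False using mono[of p q] mono[of q p] assms q by cases simp_all
    qed
  qed (use assms in blast)
  then show ?thesis unfolding sched_pick_def using assms by auto
qed

lemma sched_pick_cur: "finite A \<Longrightarrow> sched_pick j A = Some p \<Longrightarrow> p \<in> cur A \<and> fst p + cur_rank A p = j"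
proof -
  assume A: "finite A" and s: "sched_pick j A = Some p"
  then obtain q where q: "q \<in> cur A" "fst q + cur_rank A q = j" unfolding sched_pick_def by (auto split: if_splits)
  then show ?thesis using sched_pick_unique[OF A q] s by simp
qed

fun tdist :: "(nat \<times> nat) set \<Rightarrow> (nat \<times> nat \<Rightarrow> nat) \<Rightarrow> nat set \<Rightarrow> nat \<Rightarrow> nat \<Rightarrow> (nat \<times> nat) set" where
  "tdist E c L 0 v = (if v \<in> L then {(0, v)} else {})"
| "tdist E c L (Suc j) v = tdist E c L j v \<union>
     (\<lambda>x. case sched_pick j (tdist E c L j x) of Some (d, l) \<Rightarrow> (d + c (v, x), l)) `
       {x. (v, x) \<in> E \<and> sched_pick j (tdist E c L j x) \<noteq> None}"

context
  fixes E :: "(nat \<times> nat) set" and c :: "nat \<times> nat \<Rightarrow> nat" and L :: "nat set"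
  assumes fE: "finite E" and fL: "finite L" and cpos: "\<And>e. e \<in> E \<Longrightarrow> c e > 0"
begin

lemma tdist_fin: "finite (tdist E c L j v)"
proof (induction j)
  case (Suc j)
  have "finite {x. (v, x) \<in> E}" by (rule finite_subset[of _ "snd ` E"]) (use fE in force)+
  then show ?case using Suc by simp
qed simp

lemma tdist_sound: "(d, l) \<in> tdist E c L j v \<Longrightarrow> l \<in> L \<and> walk E c v l d"
proof (induction j arbitrary: v d)
  case 0
  then show ?case by (auto split: if_splits intro: walk_refl)
next
  case (Suc j)
  show ?case
  proof (cases "(d, l) \<in> tdist E c L j v")
    case False
    then obtain x d' where x: "(v, x) \<in> E" "sched_pick j (tdist E c L j x) = Some (d', l)" "d = d' + c (v, x)"
      using Suc.prems by (auto split: option.splits)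
    have "(d', l) \<in> tdist E c L j x" using sched_pick_cur[OF tdist_fin x(2)] by (auto simp: cur_def)
    then show ?thesis using Suc.IH walk_step[OF x(1), of c l d'] x(3) by (simp add: add.commute)
  qed (rule Suc.IH)
qed

lemma tdist_mono: "i \<le> j \<Longrightarrow> tdist E c L i v \<subseteq> tdist E c L j v"
  by (rule lift_Suc_mono_le[where f = "\<lambda>j. tdist E c L j v"]) auto

definition reach where "reach v l \<longleftrightarrow> (\<exists>d. walk E c v l d)"
definition walk_dist where "walk_dist v l = (LEAST d. walk E c v l d)"
definition true_rank where "true_rank v l = card {l' \<in> L. reach v l' \<and> lexl (walk_dist v l', l') (walk_dist v l, l)}"

lemma walk_dist_wk: "reach v l \<Longrightarrow> walk E c v l (walk_dist v l)"
  unfolding reach_def walk_dist_def by (rule LeastI_ex)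

lemma walk_dist_le: "walk E c v l d \<Longrightarrow> walk_dist v l \<le> d"
  unfolding walk_dist_def by (rule Least_le)

lemma true_rank_le: "true_rank v l \<le> card L"
  unfolding true_rank_def by (rule card_mono[OF fL]) auto

lemma walk_dist_step:
  assumes "reach v l" "v \<noteq> l"
  obtains x where "(v, x) \<in> E" "reach x l" "walk_dist v l = c (v, x) + walk_dist x l"
proof -
  from walk_dist_wk[OF assms(1)] show ?thesis
  proof cases
    case walk_refl then show ?thesis using assms by simp
  next
    case (walk_step x d)
    have r: "reach x l" using walk_step unfolding reach_def by blast
    have "walk_dist v l \<le> c (v, x) + walk_dist x l" using walk_dist_le[OF walk.walk_step[OF walk_step(2) walk_dist_wk[OF r]]] .
    moreover have "walk_dist x l \<le> d" using walk_dist_le[OF walk_step(3)] .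
    ultimately show ?thesis using that walk_step r by simp
  qed
qed

text \<open>The pair of target \<open>l\<close> is forwarded by \<open>v\<close> in round \<open>walk_dist v l + true_rank v l\<close>; this time strictly decreases
  towards \<open>l\<close> along a shortest walk, because extending by an edge preserves lexicographic smaller pairs.\<close>

lemma tdist_complete:
  "l \<in> L \<Longrightarrow> reach v l \<Longrightarrow> walk_dist v l + true_rank v l \<le> j \<Longrightarrow> (walk_dist v l, l) \<in> tdist E c L j v"
proof (induction j arbitrary: v l rule: less_induct)
  case (less j)
  show ?case
  proof (cases "v = l")
    case True
    have "walk_dist v l = 0" using walk_dist_le[of v l 0] True walk_refl by simp
    then have "(walk_dist v l, l) \<in> tdist E c L 0 v" using True less.prems by simp
    then show ?thesis using tdist_mono[of 0 j v] by blast
  next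
    case False
    obtain x where x: "(v, x) \<in> E" "reach x l" "walk_dist v l = c (v, x) + walk_dist x l"
      using walk_dist_step[OF less.prems(2) False] .
    have "{l' \<in> L. reach x l' \<and> lexl (walk_dist x l', l') (walk_dist x l, l)} \<subseteq> {l' \<in> L. reach v l' \<and> lexl (walk_dist v l', l') (walk_dist v l, l)}"
    proof
      fix l' assume l': "l' \<in> {l' \<in> L. reach x l' \<and> lexl (walk_dist x l', l') (walk_dist x l, l)}"
      then have "walk E c v l' (c (v, x) + walk_dist x l')" using walk_step[OF x(1)] walk_dist_wk by blast
      then have "reach v l'" "walk_dist v l' \<le> c (v, x) + walk_dist x l'" using walk_dist_le unfolding reach_def by auto
      then show "l' \<in> {l' \<in> L. reach v l' \<and> lexl (walk_dist v l', l') (walk_dist v l, l)}"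
        using l' x(3) by (auto simp: lexl_def)
    qed
    then have "true_rank x l \<le> true_rank v l" unfolding true_rank_def using fL by (intro card_mono) auto
    then have lt: "walk_dist x l + true_rank x l < j" using x(3) cpos[OF x(1)] less.prems(3) by simp
    define t where "t = walk_dist x l + true_rank x l"
    let ?A = "tdist E c L t x" and ?p = "(walk_dist x l, l)"
    \<comment> \<open>Every pair that precedes \<open>?p\<close> at \<open>x\<close> is due no later
      than \<open>t\<close>, so by then it is present with its true distance. Hence the rank that
      \<open>x\<close> computes for \<open>?p\<close> in round \<open>t\<close> is the true one, and
      \<open>?p\<close> is sent exactly then.\<close>
    have inA: "(walk_dist x l', l') \<in> ?A" if "l' \<in> L" "reach x l'" "l' = l \<or> lexl (walk_dist x l', l') ?p" for l'
    proof (rule less.IH)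
      show "t < j" using lt t_def by simp
      have "{k \<in> L. reach x k \<and> lexl (walk_dist x k, k) (walk_dist x l', l')} \<subseteq> {k \<in> L. reach x k \<and> lexl (walk_dist x k, k) ?p}"
        using that(3) lexl_trans by blast
      then have "true_rank x l' \<le> true_rank x l" unfolding true_rank_def using fL by (intro card_mono) auto
      moreover have "walk_dist x l' \<le> walk_dist x l" using that(3) by (auto simp: lexl_def)
      ultimately show "walk_dist x l' + true_rank x l' \<le> t" unfolding t_def by simp
    qed (use that in auto)
    have incur: "(walk_dist x l', l') \<in> cur ?A" if "l' \<in> L" "reach x l'" "l' = l \<or> lexl (walk_dist x l', l') ?p" for l'
      using inA[OF that] tdist_sound walk_dist_le unfolding cur_def by blast
    have "{q \<in> cur ?A. lexl q ?p} = (\<lambda>l'. (walk_dist x l', l')) ` {l' \<in> L. reach x l' \<and> lexl (walk_dist x l', l') ?p}"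
    proof
      show "{q \<in> cur ?A. lexl q ?p} \<subseteq> (\<lambda>l'. (walk_dist x l', l')) ` {l' \<in> L. reach x l' \<and> lexl (walk_dist x l', l') ?p}"
      proof
        fix q assume q: "q \<in> {q \<in> cur ?A. lexl q ?p}"
        obtain d l' where ql: "q = (d, l')" by (cases q)
        have qA: "(d, l') \<in> ?A" using q ql by (auto simp: cur_def)
        have s: "l' \<in> L" "reach x l'" "walk_dist x l' \<le> d" using tdist_sound[OF qA] walk_dist_le unfolding reach_def by auto
        have lx: "lexl (walk_dist x l', l') ?p" using q ql s(3) by (auto simp: lexl_def)
        have "d \<le> walk_dist x l'" using inA[OF s(1,2)] lx q ql by (auto simp: cur_def)
        then show "q \<in> (\<lambda>l'. (walk_dist x l', l')) ` {l' \<in> L. reach x l' \<and> lexl (walk_dist x l', l') ?p}"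
          using s lx ql by auto
      qed
    qed (use incur in blast)
    then have "cur_rank ?A ?p = card ((\<lambda>l'. (walk_dist x l', l')) ` {l' \<in> L. reach x l' \<and> lexl (walk_dist x l', l') ?p})"
      unfolding cur_rank_def by simp
    also have "\<dots> = true_rank x l" unfolding true_rank_def by (rule card_image) (auto simp: inj_on_def)
    finally have "sched_pick t ?A = Some ?p"
      using incur[OF less.prems(1) x(2)] by (intro sched_pick_unique tdist_fin) (auto simp: t_def)
    then have "(walk_dist x l + c (v, x), l) \<in> tdist E c L (Suc t) v"
      using x(1) by (auto intro!: image_eqI[of _ _ x])
    moreover have "tdist E c L (Suc t) v \<subseteq> tdist E c L j v" using lt by (intro tdist_mono) (simp add: t_def)
    ultimately show ?thesis using x(3) by (simp only: add.commute subset_iff)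
  qed
qed

lemma tdist_bound:
  assumes "l \<in> L" "walk E c v l d" "d + card L \<le> j"
  shows "\<exists>d'\<le>d. (d', l) \<in> tdist E c L j v"
proof -
  have "reach v l" using assms(2) unfolding reach_def by blast
  moreover have "walk_dist v l \<le> d" using walk_dist_le assms(2) by blast
  ultimately show ?thesis using tdist_complete[OF assms(1), of v j] true_rank_le[of v l] assms(3) by auto
qed

end

section \<open>Distance computations at all scales\<close>

lemma nth_map_upt0: "i < n \<Longrightarrow> map f [0..<n] ! i = f i"
  by simp

text \<open>Detours avoid all edges of \<open>P\<close>, not only the failing one, so one
  computation serves every \<open>i\<close>.\<close>

definition rest :: "inst \<Rightarrow> (nat \<times> nat) set" where "rest I = EE I - set (edges_of (PP I))"

locale rnet = pnet G cI z kk for G cI z kk +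
  fixes cW e0 Ck :: nat
  assumes e0: "e0 \<ge> 1"
    and wts: "\<And>I e. I \<in> G \<Longrightarrow> e \<in> EE I \<Longrightarrow> 0 < ww I e \<and> ww I e \<le> nn I ^ cW"
    and z_le: "\<And>n. n \<ge> 2 \<Longrightarrow> z n \<le> n" and kk_le: "\<And>n. n \<ge> 2 \<Longrightarrow> kk n \<le> Ck * n"
begin

text \<open>At scale \<open>sg\<close>, one unit of rounded cost stands for length \<open>2 ^ sg / N0 n\<close>; a path of at most \<open>z n\<close> edges and
  length at least \<open>2 ^ sg\<close> is distorted by a factor of at most \<open>1 + 1 / e0\<close>. All costs below are multiplied by \<open>N0 n\<close>.\<close>

definition N0 :: "nat \<Rightarrow> nat" where "N0 n = e0 * z n"
definition scales :: "nat \<Rightarrow> nat" where "scales n = (cW + 1) * lg n"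
text \<open>Rounding up adds at most one unit per edge, so \<open>z n\<close> edges of total length
  below \<open>2 * 2 ^ sg\<close> have at most this rounded cost.\<close>

definition cost_bound :: "nat \<Rightarrow> nat" where "cost_bound n = 2 * N0 n + z n"
text \<open>The ceiling of \<open>wt * N0 n / 2 ^ sg\<close>.\<close>

definition round_wt :: "nat \<Rightarrow> nat \<Rightarrow> nat \<Rightarrow> nat" where "round_wt n sg wt = (wt * N0 n + 2 ^ sg - 1) div 2 ^ sg"
definition scaled_cost :: "inst \<Rightarrow> nat \<Rightarrow> nat \<times> nat \<Rightarrow> nat" where "scaled_cost I sg e = round_wt (nn I) sg (ww I e)"

lemma N0_pos: "N0 n > 0" using e0 z_pos[of n] by (simp add: N0_def)

lemma round_wt_bounds: "wt * N0 n \<le> round_wt n sg wt * 2 ^ sg" "round_wt n sg wt * 2 ^ sg \<le> wt * N0 n + 2 ^ sg"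
proof -
  let ?a = "wt * N0 n" and ?b = "2 ^ sg :: nat"
  have b: "?b > 0" by simp
  have eq: "(?a + ?b - 1) div ?b * ?b + (?a + ?b - 1) mod ?b = ?a + ?b - 1" by (rule div_mult_mod_eq)
  have "(?a + ?b - 1) mod ?b < ?b" using b by (rule mod_less_divisor)
  then show "wt * N0 n \<le> round_wt n sg wt * 2 ^ sg" unfolding round_wt_def using eq b by linarith
  show "round_wt n sg wt * 2 ^ sg \<le> wt * N0 n + 2 ^ sg" unfolding round_wt_def using eq b by linarith
qed

lemma round_wt_pos: "wt > 0 \<Longrightarrow> round_wt n sg wt > 0"
  using round_wt_bounds(1)[of wt n sg] N0_pos[of n] by (cases "round_wt n sg wt") auto

lemma scaled_cost_pos: "I \<in> G \<Longrightarrow> e \<in> rest I \<Longrightarrow> scaled_cost I sg e > 0"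
  using round_wt_pos wts unfolding scaled_cost_def rest_def by auto

lemma rest_V: "I \<in> G \<Longrightarrow> rest I \<subseteq> VV I \<times> VV I"
  using conn_instD(4)[OF conn] unfolding rest_def by auto

lemma plog_SS: "plog (\<lambda>n. Suc (scales n))"
  unfolding scales_def Suc_eq_plus1 by (intro plog_add plog_mult plog_const plog_lg)

definition in_wt :: "loc \<Rightarrow> nat \<Rightarrow> nat" where "in_wt l u = (THE wt. (u, wt) \<in> l_in l)"
definition out_wt :: "loc \<Rightarrow> nat \<Rightarrow> nat" where "out_wt l u = (THE wt. (u, wt) \<in> l_out l)"
definition in_rest :: "loc \<Rightarrow> nat set" where "in_rest l = {u. u \<in> fst ` l_in l \<and> (u, l_id l) \<notin> l_pe l}"
definition out_rest :: "loc \<Rightarrow> nat set" where "out_rest l = {u. u \<in> fst ` l_out l \<and> (l_id l, u) \<notin> l_pe l}"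

lemma in_out_rest:
  assumes "I \<in> G"
  shows "in_rest (loc I v) = {u. (u, v) \<in> rest I}" "out_rest (loc I v) = {u. (v, u) \<in> rest I}"
    "(u, v) \<in> rest I \<Longrightarrow> in_wt (loc I v) u = ww I (u, v)" "(v, u) \<in> rest I \<Longrightarrow> out_wt (loc I v) u = ww I (v, u)"
  using l_out_in[OF conn[OF assms], of v]
  by (auto simp: in_rest_def out_rest_def rest_def in_wt_def out_wt_def image_iff)

lemma rest_nbr: "I \<in> G \<Longrightarrow> (v, x) \<in> rest I \<Longrightarrow> x \<in> nbrs (EE I) v"
  unfolding rest_def nbrs_def und_edges_def by auto

definition far_table :: "inst \<Rightarrow> (nat \<Rightarrow> nat) \<Rightarrow> nat \<Rightarrow> nat \<Rightarrow> nat list list" where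
  "far_table I val j v = map (\<lambda>sg. map (\<lambda>d. far (rest I) (scaled_cost I sg) val d v) [0..<Suc j]) [0..<Suc (scales (nn I))]"

lemma far_table_nth: "sg \<le> scales (nn I) \<Longrightarrow> d \<le> j \<Longrightarrow> far_table I val j v ! sg ! d = far (rest I) (scaled_cost I sg) val d v"
  unfolding far_table_def by (simp del: upt_Suc)

text \<open>The head of an edge also knows its weight, so it looks up the one budget that the tail
  needs and sends a single number per scale. Positive rounded weights guarantee that this entry is
  already there. Round \<open>j\<close> completes budget \<open>j + 1\<close>.\<close>

lemma knows_FL:
  fixes x :: "inst \<Rightarrow> nat \<Rightarrow> 'x::countable"
  assumes x: "knows T x"
    and val: "\<And>I v. I \<in> G \<Longrightarrow> v \<in> VV I \<Longrightarrow> val I v = vf (base I v) (x I v)"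
    and bnd: "\<And>I v. I \<in> G \<Longrightarrow> v \<in> VV I \<Longrightarrow> val I v \<le> 2 * nn I ^ K"
  shows "knows (\<lambda>I. T I + cost_bound (nn I)) (\<lambda>I v. (x I v, far_table I (val I) (cost_bound (nn I)) v))"
proof (rule knows_rounds[where r = "\<lambda>n _. cost_bound n" and Y = "\<lambda>I. far_table I (val I)"
      and yi = "\<lambda>b x. map (\<lambda>sg. [vf b x]) [0..<Suc (scales (fst (fst b)))]"
      and sd = "\<lambda>j b x y u. if u \<in> in_rest (fst b) then
          map (\<lambda>sg. let r = round_wt (fst (fst b)) sg (in_wt (fst b) u) in if r \<le> Suc j then y ! sg ! (Suc j - r) else 0)
            [0..<Suc (scales (fst (fst b)))] else []"
      and up = "\<lambda>j b x y ib. map (\<lambda>sg. y ! sg @ [Max (insert (vf b x)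
          ((\<lambda>u. the (ib u) ! sg) ` out_rest (fst b)))]) [0..<Suc (scales (fst (fst b)))]"
      and M = "\<lambda>n. {xs. set xs \<subseteq> {..2 * n ^ K} \<and> length xs \<le> Suc (scales n)}", OF x])
  show "small (\<lambda>n. {xs. set xs \<subseteq> {..2 * n ^ K} \<and> length xs \<le> Suc (scales n)})"
    by (intro small_lists small_atMost_poly plog_SS)
  fix I v assume IG: "I \<in> G" and v: "v \<in> VV I"
  note fV = conn_instD(2)[OF conn[OF IG]] and rV = rest_V[OF IG]
  have Fle: "far (rest I) (scaled_cost I sg) (val I) d v' \<le> 2 * nn I ^ K" if "v' \<in> VV I" for sg d v'
    unfolding far_le_iff[OF fV rV that] using bnd[OF IG] walk_V[OF _ rV that] by blast
  have d0: "walk (rest I) (scaled_cost I sg) v b 0 \<longleftrightarrow> b = v" for sg b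
  proof
    assume "walk (rest I) (scaled_cost I sg) v b 0"
    then show "b = v"
    proof cases
      case (walk_step x d)
      then show ?thesis using scaled_cost_pos[OF IG walk_step(2), of sg] by simp
    qed simp
  qed (auto intro: walk_refl)
  have "far (rest I) (scaled_cost I sg) (val I) 0 v = val I v" for sg
    by (rule nat_eq_by_ub) (auto simp: far_le_iff[OF fV rV v] d0)
  then show "far_table I (val I) 0 v = map (\<lambda>sg. [vf (base I v) (x I v)]) [0..<Suc (scales (fst (fst (base I v))))]"
    by (simp add: far_table_def val[OF IG v] del: upt_Suc) simp
  fix j assume j: "j < cost_bound (nn I)"
  have msg: "(if v \<in> in_rest (loc I u) then map (\<lambda>sg. let r = round_wt (nn I) sg (in_wt (loc I u) v) in
       if r \<le> Suc j then far_table I (val I) j u ! sg ! (Suc j - r) else 0) [0..<Suc (scales (nn I))] else []) =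
     (if (v, u) \<in> rest I then map (\<lambda>sg. if scaled_cost I sg (v, u) \<le> Suc j
        then far (rest I) (scaled_cost I sg) (val I) (Suc j - scaled_cost I sg (v, u)) u else 0) [0..<Suc (scales (nn I))] else [])" for u v
  proof (cases "(v, u) \<in> rest I")
    case True
    have "Suc j - scaled_cost I sg (v, u) \<le> j" for sg using scaled_cost_pos[OF IG True, of sg] by simp
    then show ?thesis using True by (auto simp: in_out_rest[OF IG] Let_def scaled_cost_def[symmetric] far_table_nth less_Suc_eq_le)
  qed (simp add: in_out_rest[OF IG])
  show "(if u \<in> in_rest (fst (base I v)) then
          map (\<lambda>sg. let r = round_wt (fst (fst (base I v))) sg (in_wt (fst (base I v)) u) in
            if r \<le> Suc j then far_table I (val I) j v ! sg ! (Suc j - r) else 0)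
            [0..<Suc (scales (fst (fst (base I v))))] else []) \<in> {xs. set xs \<subseteq> {..2 * nn I ^ K} \<and> length xs \<le> Suc (scales (nn I))}" for u
    unfolding fst_base fst_loc msg using Fle[OF v] by (auto simp del: upt_Suc)
  show "far_table I (val I) (Suc j) v = map (\<lambda>sg. far_table I (val I) j v ! sg @ [Max (insert (vf (base I v) (x I v))
      ((\<lambda>u. the (if u \<in> nbrs (EE I) v then Some (if v \<in> in_rest (fst (base I u)) then
          map (\<lambda>sg. let r = round_wt (fst (fst (base I u))) sg (in_wt (fst (base I u)) v) in
            if r \<le> Suc j then far_table I (val I) j u ! sg ! (Suc j - r) else 0)
            [0..<Suc (scales (fst (fst (base I u))))] else []) else None) ! sg) ` out_rest (fst (base I v))))])
     [0..<Suc (scales (fst (fst (base I v))))]"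
    unfolding fst_base fst_loc msg
  proof -
    show "far_table I (val I) (Suc j) v = map (\<lambda>sg. far_table I (val I) j v ! sg @ [Max (insert (vf (base I v) (x I v))
      ((\<lambda>u. the (if u \<in> nbrs (EE I) v then Some (if (v, u) \<in> rest I then map (\<lambda>sg. if scaled_cost I sg (v, u) \<le> Suc j
        then far (rest I) (scaled_cost I sg) (val I) (Suc j - scaled_cost I sg (v, u)) u else 0) [0..<Suc (scales (nn I))] else []) else None) ! sg)
         ` out_rest (loc I v)))]) [0..<Suc (scales (nn I))]" (is "_ = map ?f _")
    proof (rule nth_equalityI)
      fix sg assume "sg < length (far_table I (val I) (Suc j) v)"
      then have sg: "sg < Suc (scales (nn I))" by (simp add: far_table_def)
      have "(\<lambda>u. the (if u \<in> nbrs (EE I) v then Some (if (v, u) \<in> rest I then map (\<lambda>sg. if scaled_cost I sg (v, u) \<le> Suc j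
        then far (rest I) (scaled_cost I sg) (val I) (Suc j - scaled_cost I sg (v, u)) u else 0) [0..<Suc (scales (nn I))] else []) else None) ! sg)
         ` out_rest (loc I v) = (\<lambda>u. if scaled_cost I sg (v, u) \<le> Suc j
        then far (rest I) (scaled_cost I sg) (val I) (Suc j - scaled_cost I sg (v, u)) u else 0) ` {u. (v, u) \<in> rest I}"
        unfolding in_out_rest[OF IG]
        by (rule image_cong) (use sg rest_nbr[OF IG] in \<open>auto simp del: upt_Suc\<close>)
      then have "?f sg = far_table I (val I) j v ! sg @ [far (rest I) (scaled_cost I sg) (val I) (Suc j) v]"
        unfolding far_rec[OF fV rV v, of _ _ "Suc j"] val[OF IG v, symmetric] by simp
      also have "\<dots> = far_table I (val I) (Suc j) v ! sg"
        using sg unfolding far_table_def by (simp add: nth_append del: upt_Suc) simp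
      finally show "far_table I (val I) (Suc j) v ! sg = map ?f [0..<Suc (scales (nn I))] ! sg"
        using sg by (simp del: upt_Suc)
    qed (simp add: far_table_def)
  qed
qed

definition tdist_table :: "inst \<Rightarrow> nat \<Rightarrow> nat \<Rightarrow> (nat \<times> nat) list list" where
  "tdist_table I j v = map (\<lambda>sg. list_of (tdist (rest I) (scaled_cost I sg) (LL I) j v)) [0..<Suc (scales (nn I))]"

lemma LL_fin: "I \<in> G \<Longrightarrow> finite (LL I)" using pinD(7) conn_instD(2)[OF conn] finite_subset by blast

lemma rest_fin: "I \<in> G \<Longrightarrow> finite (rest I)" using conn_instD(6)[OF conn] by (simp add: rest_def)

lemma tdist_table_nth: "I \<in> G \<Longrightarrow> sg \<le> scales (nn I) \<Longrightarrow> set (tdist_table I j v ! sg) = tdist (rest I) (scaled_cost I sg) (LL I) j v"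
  unfolding tdist_table_def using tdist_fin[OF rest_fin LL_fin] scaled_cost_pos by (simp del: upt_Suc)

text \<open>All scales run at once, each contributing at most one scheduled pair to a message. A
  pair sent in round \<open>j\<close> has distance at most \<open>j\<close>, so transmitted
  distances stay linear in \<open>n\<close>.\<close>

lemma knows_KD:
  fixes x :: "inst \<Rightarrow> nat \<Rightarrow> 'x::countable"
  assumes x: "knows T x"
  shows "knows (\<lambda>I. T I + (cost_bound (nn I) + kk (nn I))) (\<lambda>I v. (x I v, tdist_table I (cost_bound (nn I) + kk (nn I)) v))"
proof (rule knows_rounds[where r = "\<lambda>n _. cost_bound n + kk n" and Y = tdist_table
      and yi = "\<lambda>b x. map (\<lambda>sg. list_of (if l_L (fst b) then {(0, l_id (fst b))} else {})) [0..<Suc (scales (fst (fst b)))]"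
      and sd = "\<lambda>j b x y u. map (\<lambda>sg. sched_pick j (set (y ! sg))) [0..<Suc (scales (fst (fst b)))]"
      and up = "\<lambda>j b x y ib. map (\<lambda>sg. list_of (set (y ! sg) \<union>
          (\<lambda>u. case the (ib u) ! sg of Some (d, l) \<Rightarrow> (d + round_wt (fst (fst b)) sg (out_wt (fst b) u), l)) `
            {u \<in> out_rest (fst b). the (ib u) ! sg \<noteq> None})) [0..<Suc (scales (fst (fst b)))]"
      and M = "\<lambda>n. {xs. set xs \<subseteq> {None} \<union> Some ` ({..(3 * e0 + Ck) * n ^ 1} \<times> {..n ^ cI}) \<and> length xs \<le> Suc (scales n)}", OF x])
  show "small (\<lambda>n. {xs. set xs \<subseteq> {None} \<union> Some ` ({..(3 * e0 + Ck) * n ^ 1} \<times> {..n ^ cI}) \<and> length xs \<le> Suc (scales n)})"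
    by (intro small_lists small_Un small_single small_image small_Times small_atMost_poly plog_SS ids_small)
  fix I v assume IG: "I \<in> G" and v: "v \<in> VV I"
  note n2 = conn_instD(1)[OF conn[OF IG]]
  note fin = tdist_fin[OF rest_fin[OF IG] LL_fin[OF IG]]
  have snd: "sched_pick j (tdist (rest I) (scaled_cost I sg) (LL I) j v) \<in> {None} \<union> Some ` ({..j} \<times> {..nn I ^ cI})" for sg j v
  proof (cases "sched_pick j (tdist (rest I) (scaled_cost I sg) (LL I) j v)")
    case (Some p)
    obtain d l where p: "p = (d, l)" by (cases p)
    have "(d, l) \<in> tdist (rest I) (scaled_cost I sg) (LL I) j v" "d \<le> j"
      using sched_pick_cur[OF fin Some] scaled_cost_pos[OF IG] p by (auto simp: cur_def)
    then have "l \<in> LL I" "d \<le> j" using tdist_sound[OF rest_fin[OF IG] LL_fin[OF IG]] scaled_cost_pos[OF IG] by blast+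
    moreover have "l \<le> nn I ^ cI" using pinD(7,8)[OF IG] \<open>l \<in> LL I\<close> by (meson less_imp_le subsetD)
    ultimately show ?thesis using Some p by simp
  qed simp
  have nth: "set (tdist_table I j v ! sg) = tdist (rest I) (scaled_cost I sg) (LL I) j v" if "sg < Suc (scales (nn I))" for j v sg
    using tdist_table_nth[OF IG] that by simp
  show "tdist_table I 0 v = map (\<lambda>sg. list_of (if l_L (fst (base I v)) then {(0, l_id (fst (base I v)))} else {}))
      [0..<Suc (scales (fst (fst (base I v))))]"
    by (simp add: tdist_table_def)
  fix j assume j: "j < cost_bound (nn I) + kk (nn I)"
  show "map (\<lambda>sg. sched_pick j (set (tdist_table I j v ! sg))) [0..<Suc (scales (fst (fst (base I v))))]
     \<in> {xs. set xs \<subseteq> {None} \<union> Some ` ({..(3 * e0 + Ck) * nn I ^ 1} \<times> {..nn I ^ cI}) \<and> length xs \<le> Suc (scales (nn I))}"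
  proof -
    have "z (nn I) \<le> e0 * z (nn I)" using e0 by simp
    then have "cost_bound (nn I) \<le> 3 * (e0 * z (nn I))" unfolding cost_bound_def N0_def by simp
    also have "\<dots> \<le> 3 * (e0 * nn I)" using z_le[OF n2] by simp
    finally have "j \<le> (3 * e0 + Ck) * nn I ^ 1" using j kk_le[OF n2] by (simp add: algebra_simps)
    then have "{..j} \<subseteq> {..(3 * e0 + Ck) * nn I ^ 1}" by auto
    then have "sched_pick j (set (tdist_table I j v ! sg)) \<in> {None} \<union> Some ` ({..(3 * e0 + Ck) * nn I ^ 1} \<times> {..nn I ^ cI})"
      if "sg < Suc (scales (nn I))" for sg
      using snd[of j sg v] nth[OF that, of j v] by auto
    then have "(\<lambda>sg. sched_pick j (set (tdist_table I j v ! sg))) ` {0..<Suc (scales (nn I))}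
        \<subseteq> {None} \<union> Some ` ({..(3 * e0 + Ck) * nn I ^ 1} \<times> {..nn I ^ cI})"
      by (intro image_subsetI) simp
    then show ?thesis by (simp del: upt_Suc)
  qed
  show "tdist_table I (Suc j) v = map (\<lambda>sg. list_of (set (tdist_table I j v ! sg) \<union>
          (\<lambda>u. case the (if u \<in> nbrs (EE I) v then Some (map (\<lambda>sg. sched_pick j (set (tdist_table I j u ! sg)))
              [0..<Suc (scales (fst (fst (base I u))))]) else None) ! sg of
             Some (d, l) \<Rightarrow> (d + round_wt (fst (fst (base I v))) sg (out_wt (fst (base I v)) u), l)) `
            {u \<in> out_rest (fst (base I v)). the (if u \<in> nbrs (EE I) v then Some (map (\<lambda>sg. sched_pick j (set (tdist_table I j u ! sg)))
              [0..<Suc (scales (fst (fst (base I u))))]) else None) ! sg \<noteq> None})) [0..<Suc (scales (fst (fst (base I v))))]"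
    unfolding fst_base fst_loc
  proof (rule nth_equalityI)
    fix sg assume "sg < length (tdist_table I (Suc j) v)"
    then have sg: "sg < Suc (scales (nn I))" by (simp add: tdist_table_def)
    have m: "the (if u \<in> nbrs (EE I) v then Some (map (\<lambda>sg. sched_pick j (set (tdist_table I j u ! sg)))
              [0..<Suc (scales (nn I))]) else None) ! sg = sched_pick j (tdist (rest I) (scaled_cost I sg) (LL I) j u)"
      if "u \<in> out_rest (loc I v)" for u
    proof -
      have "u \<in> nbrs (EE I) v" using that rest_nbr[OF IG] by (simp add: in_out_rest[OF IG])
      then show ?thesis using sg nth[OF sg] by (simp del: upt_Suc)
    qed
    have "(\<lambda>u. case the (if u \<in> nbrs (EE I) v then Some (map (\<lambda>sg. sched_pick j (set (tdist_table I j u ! sg)))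
              [0..<Suc (scales (nn I))]) else None) ! sg of
             Some (d, l) \<Rightarrow> (d + round_wt (nn I) sg (out_wt (loc I v) u), l)) `
            {u \<in> out_rest (loc I v). the (if u \<in> nbrs (EE I) v then Some (map (\<lambda>sg. sched_pick j (set (tdist_table I j u ! sg)))
              [0..<Suc (scales (nn I))]) else None) ! sg \<noteq> None}
       = (\<lambda>x. case sched_pick j (tdist (rest I) (scaled_cost I sg) (LL I) j x) of Some (d, l) \<Rightarrow> (d + scaled_cost I sg (v, x), l)) `
       {x. (v, x) \<in> rest I \<and> sched_pick j (tdist (rest I) (scaled_cost I sg) (LL I) j x) \<noteq> None}"
    proof (rule image_cong)
      show "{u \<in> out_rest (loc I v). the (if u \<in> nbrs (EE I) v then Some (map (\<lambda>sg. sched_pick j (set (tdist_table I j u ! sg)))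
              [0..<Suc (scales (nn I))]) else None) ! sg \<noteq> None} =
        {x. (v, x) \<in> rest I \<and> sched_pick j (tdist (rest I) (scaled_cost I sg) (LL I) j x) \<noteq> None}"
      proof (rule Collect_cong, rule conj_cong)
        fix u show "u \<in> out_rest (loc I v) \<longleftrightarrow> (v, u) \<in> rest I" by (simp add: in_out_rest[OF IG])
        assume "(v, u) \<in> rest I"
        then have "u \<in> out_rest (loc I v)" by (simp add: in_out_rest[OF IG])
        then show "(the (if u \<in> nbrs (EE I) v then Some (map (\<lambda>sg. sched_pick j (set (tdist_table I j u ! sg)))
              [0..<Suc (scales (nn I))]) else None) ! sg \<noteq> None) \<longleftrightarrow> (sched_pick j (tdist (rest I) (scaled_cost I sg) (LL I) j u) \<noteq> None)"
          by (simp only: m)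
      qed
      fix x assume "x \<in> {x. (v, x) \<in> rest I \<and> sched_pick j (tdist (rest I) (scaled_cost I sg) (LL I) j x) \<noteq> None}"
      then have x: "x \<in> out_rest (loc I v)" "(v, x) \<in> rest I" by (auto simp: in_out_rest[OF IG])
      show "(case the (if x \<in> nbrs (EE I) v then Some (map (\<lambda>sg. sched_pick j (set (tdist_table I j x ! sg)))
              [0..<Suc (scales (nn I))]) else None) ! sg of
             Some (d, l) \<Rightarrow> (d + round_wt (nn I) sg (out_wt (loc I v) x), l)) =
          (case sched_pick j (tdist (rest I) (scaled_cost I sg) (LL I) j x) of Some (d, l) \<Rightarrow> (d + scaled_cost I sg (v, x), l))"
        unfolding m[OF x(1)] in_out_rest(4)[OF IG x(2)] scaled_cost_def ..
    qed
    then show "tdist_table I (Suc j) v ! sg = map (\<lambda>sg. list_of (set (tdist_table I j v ! sg) \<union>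
          (\<lambda>u. case the (if u \<in> nbrs (EE I) v then Some (map (\<lambda>sg. sched_pick j (set (tdist_table I j u ! sg)))
              [0..<Suc (scales (nn I))]) else None) ! sg of
             Some (d, l) \<Rightarrow> (d + round_wt (nn I) sg (out_wt (loc I v) u), l)) `
            {u \<in> out_rest (loc I v). the (if u \<in> nbrs (EE I) v then Some (map (\<lambda>sg. sched_pick j (set (tdist_table I j u ! sg)))
              [0..<Suc (scales (nn I))]) else None) ! sg \<noteq> None})) [0..<Suc (scales (nn I))] ! sg"
      unfolding nth_map_upt0[OF sg] nth[OF sg]
      by (simp only: tdist_table_def nth_map_upt0[OF sg] tdist.simps(2))
  qed (simp add: tdist_table_def)
qed

end

section \<open>Walks, paths and replacement distances\<close>

lemma walk_trans: "walk E c u v d \<Longrightarrow> walk E c v x d' \<Longrightarrow> walk E c u x (d + d')"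
proof (induction rule: walk.induct)
  case (walk_step v y b d)
  then show ?case using walk.walk_step[of v y E c x "d + d'"] by (simp add: add.assoc)
qed simp

lemma walk_mono: "walk E c u v d \<Longrightarrow> E \<subseteq> E' \<Longrightarrow> walk E' c u v d"
  by (induction rule: walk.induct) (auto intro: walk.intros)

lemma walk_edge: "(u, v) \<in> E \<Longrightarrow> walk E c u v (c (u, v))"
  using walk_step[OF _ walk_refl] by fastforce

lemma edges_of_Cons: "edges_of (x # y # p) = (x, y) # edges_of (y # p)"
  by (simp add: edges_of_def)

lemma edges_of_single [simp]: "edges_of [x] = []" "edges_of [] = []"
  by (simp_all add: edges_of_def)

lemma path_len_Cons: "path_len c (x # y # p) = c (x, y) + path_len c (y # p)"
  by (simp add: path_len_def edges_of_Cons)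

lemma path_len_single [simp]: "path_len c [x] = 0"
  by (simp add: path_len_def)

lemma path_wk: "p \<noteq> [] \<Longrightarrow> set (edges_of p) \<subseteq> E \<Longrightarrow> walk E c (hd p) (last p) (path_len c p)"
proof (induction p rule: induct_list012)
  case (3 x y p)
  then show ?case using walk_step[of x y E c "last (y # p)" "path_len c (y # p)"]
    by (simp add: edges_of_Cons path_len_Cons)
qed (auto intro: walk_refl)

lemma edges_of_append: "p \<noteq> [] \<Longrightarrow> edges_of (p @ q) = edges_of p @ (if q = [] then [] else (last p, hd q) # edges_of q)"
proof (induction p rule: induct_list012)
  case (2 x)
  then show ?case by (cases q) (auto simp: edges_of_Cons)
qed (auto simp: edges_of_Cons)

text \<open>Loop erasure: if the new first vertex already lies on the path, everything before it is
  dropped. Walks are closed under concatenation, whereas replacement lengths are defined by simple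
  paths.\<close>

lemma walk_path:
  assumes "walk E c v b d" "E \<subseteq> V \<times> V" "v \<in> V"
  shows "\<exists>p. is_path V E p \<and> hd p = v \<and> last p = b \<and> path_len c p \<le> d"
  using assms
proof (induction rule: walk.induct)
  case (walk_refl v)
  then show ?case by (intro exI[of _ "[v]"]) (simp add: is_path_def)
next
  case (walk_step v x b d)
  then obtain p where p: "is_path V E p" "hd p = x" "last p = b" "path_len c p \<le> d" by blast
  show ?case
  proof (cases "v \<in> set p")
    case False
    obtain p' where p': "p = x # p'" using p(1,2) by (cases p) (auto simp: is_path_def)
    then show ?thesis using p False walk_step by (intro exI[of _ "v # p"])
      (auto simp: is_path_def edges_of_Cons path_len_Cons)
  next
    case True
    then obtain p1 p2 where sp: "p = p1 @ v # p2" by (meson split_list)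
    have "set (edges_of (v # p2)) \<subseteq> set (edges_of p) \<and> path_len c (v # p2) \<le> path_len c p"
      using edges_of_append[of p1 "v # p2"] by (cases "p1 = []") (auto simp: sp path_len_def)
    then show ?thesis using p sp by (intro exI[of _ "v # p2"]) (auto simp: is_path_def)
  qed
qed

section \<open>Prefix lengths and the shape of replacement paths\<close>

definition prefix_len :: "inst \<Rightarrow> nat \<Rightarrow> nat" where "prefix_len I i = (\<Sum>k<i. ww I (PP I ! k, PP I ! Suc k))"
definition last_idx :: "inst \<Rightarrow> nat" where "last_idx I = length (PP I) - 1"
definition total_len :: "inst \<Rightarrow> nat" where "total_len I = prefix_len I (last_idx I)"

lemma path_len_sum: "path_len c p = (\<Sum>k<length p - 1. c (p ! k, p ! Suc k))"
proof (induction p rule: induct_list012)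
  case (3 x y p)
  have "(\<Sum>k<Suc (length p). c ((x # y # p) ! k, (x # y # p) ! Suc k))
    = c (x, y) + (\<Sum>k<length p. c ((y # p) ! k, (y # p) ! Suc k))"
    by (subst sum.lessThan_Suc_shift) simp
  then show ?case using 3 by (simp add: path_len_Cons)
qed (auto simp: path_len_def)

lemma prefix_len_mono: "i \<le> j \<Longrightarrow> prefix_len I i \<le> prefix_len I j"
  unfolding prefix_len_def by (rule sum_mono2) auto

definition sp_inst :: "inst \<Rightarrow> bool" where
  "sp_inst I \<longleftrightarrow> PP I \<noteq> [] \<and> distinct (PP I) \<and> set (PP I) \<subseteq> VV I \<and> finite (VV I) \<and>
     set (edges_of (PP I)) \<subseteq> EE I \<and> EE I \<subseteq> VV I \<times> VV I \<and> PP I ! 0 = ss I \<and> last (PP I) = tt I \<and>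
     (\<forall>e\<in>EE I. 0 < ww I e) \<and> enat (path_len (ww I) (PP I)) = sp_dist (VV I) (EE I) (ww I) (ss I) (tt I)"

context
  fixes I assumes I: "sp_inst I"
begin

lemma spD: "PP I \<noteq> []" "distinct (PP I)" "set (PP I) \<subseteq> VV I" "set (edges_of (PP I)) \<subseteq> EE I" "EE I \<subseteq> VV I \<times> VV I"
  "PP I ! 0 = ss I" "PP I ! last_idx I = tt I" "\<And>e. e \<in> EE I \<Longrightarrow> 0 < ww I e" "last_idx I < length (PP I)"
  "\<And>k. k < last_idx I \<Longrightarrow> (PP I ! k, PP I ! Suc k) \<in> EE I" "ss I \<in> VV I"
proof -
  show *: "PP I \<noteq> []" "distinct (PP I)" "set (PP I) \<subseteq> VV I" "set (edges_of (PP I)) \<subseteq> EE I" "EE I \<subseteq> VV I \<times> VV I"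
  "PP I ! 0 = ss I" "\<And>e. e \<in> EE I \<Longrightarrow> 0 < ww I e" "last_idx I < length (PP I)"
    using I unfolding sp_inst_def last_idx_def by auto
  show "PP I ! last_idx I = tt I" using I last_conv_nth unfolding sp_inst_def last_idx_def by metis
  show "(PP I ! k, PP I ! Suc k) \<in> EE I" if "k < last_idx I" for k
  proof -
    have "(PP I ! k, PP I ! Suc k) \<in> set (edges_of (PP I))"
      unfolding in_edges_of using that by (intro exI[of _ k]) (simp add: last_idx_def)
    then show ?thesis using * by blast
  qed
  show "ss I \<in> VV I" using * nth_mem[of 0 "PP I"] by auto
qed

lemma nth_P_eq: "i \<le> last_idx I \<Longrightarrow> j \<le> last_idx I \<Longrightarrow> PP I ! i = PP I ! j \<longleftrightarrow> i = j"
  using spD(2,9) by (simp add: nth_eq_iff_index_eq)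

lemma P_V: "i \<le> last_idx I \<Longrightarrow> PP I ! i \<in> VV I"
  using spD(3,9) by (meson le_less_trans nth_mem subsetD)

lemma walk_P:
  assumes "i \<le> j" "j \<le> last_idx I" "\<And>k. i \<le> k \<Longrightarrow> k < j \<Longrightarrow> (PP I ! k, PP I ! Suc k) \<in> E"
  shows "walk E (ww I) (PP I ! i) (PP I ! j) (prefix_len I j - prefix_len I i)"
  using assms
proof (induction j)
  case 0
  then show ?case by (auto intro: walk_refl)
next
  case (Suc j)
  show ?case
  proof (cases "i = Suc j")
    case True
    then show ?thesis by (auto intro: walk_refl)
  next
    case False
    then have ij: "i \<le> j" using Suc.prems by simp
    have "walk E (ww I) (PP I ! i) (PP I ! j) (prefix_len I j - prefix_len I i)" using Suc ij by simp
    moreover have "walk E (ww I) (PP I ! j) (PP I ! Suc j) (ww I (PP I ! j, PP I ! Suc j))"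
      using Suc.prems ij by (intro walk_edge) simp
    ultimately have "walk E (ww I) (PP I ! i) (PP I ! Suc j) (prefix_len I j - prefix_len I i + ww I (PP I ! j, PP I ! Suc j))"
      by (rule walk_trans)
    then show ?thesis using prefix_len_mono[OF ij, of I] by (simp add: prefix_len_def)
  qed
qed

lemma total_len_path_len: "path_len (ww I) (PP I) = total_len I"
  by (simp add: path_len_sum total_len_def prefix_len_def last_idx_def)

lemma walk_ge_tot:
  assumes "walk (EE I) (ww I) (ss I) (tt I) d" shows "total_len I \<le> d"
proof -
  obtain p where p: "is_path (VV I) (EE I) p" "hd p = ss I" "last p = tt I" "path_len (ww I) p \<le> d"
    using walk_path[OF assms spD(5) spD(11)] by blast
  have "sp_dist (VV I) (EE I) (ww I) (ss I) (tt I) \<le> enat (path_len (ww I) p)"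
    unfolding sp_dist_def by (rule Inf_lower) (use p in auto)
  then have "enat (total_len I) \<le> enat (path_len (ww I) p)"
    using I total_len_path_len unfolding sp_inst_def by simp
  then show ?thesis using p(4) by simp
qed

text \<open>Prefixes of a shortest path are shortest: a shorter walk, continued along
  \<open>P\<close>, would beat \<open>P\<close>.\<close>

lemma walk_ge_pd:
  assumes "walk (EE I) (ww I) (ss I) (PP I ! a) d" "a \<le> last_idx I" shows "prefix_len I a \<le> d"
proof -
  have "walk (EE I) (ww I) (PP I ! a) (PP I ! last_idx I) (prefix_len I (last_idx I) - prefix_len I a)"
    by (rule walk_P) (use assms spD(10) in auto)
  then have "total_len I \<le> d + (prefix_len I (last_idx I) - prefix_len I a)" using walk_ge_tot[OF walk_trans[OF assms(1)]] spD(7) by simp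
  then show ?thesis using prefix_len_mono[OF assms(2), of I] by (simp add: total_len_def)
qed

lemma walk_ge_suf:
  assumes "walk (EE I) (ww I) (PP I ! b) (tt I) d" "b \<le> last_idx I" shows "total_len I - prefix_len I b \<le> d"
proof -
  have "walk (EE I) (ww I) (PP I ! 0) (PP I ! b) (prefix_len I b - prefix_len I 0)"
    by (rule walk_P) (use assms spD(10) in auto)
  then have "total_len I \<le> prefix_len I b + d" using walk_ge_tot[OF walk_trans[OF _ assms(1)]] spD(6) by (simp add: prefix_len_def)
  then show ?thesis by simp
qed

abbreviation repl where "repl i \<equiv> repl_dist (VV I) (EE I) (ww I) (ss I) (tt I) (PP I ! i, PP I ! Suc i)"

text \<open>Prefix and suffix avoid edge \<open>i\<close> because \<open>P\<close> repeats no
  vertex, the detour because it avoids all of \<open>P\<close>; a simple path is then extracted from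
  their concatenation.\<close>

lemma repl_le:
  assumes a: "a \<le> i" "i < b" "b \<le> last_idx I" and w: "walk (rest I) (ww I) (PP I ! a) (PP I ! b) l"
  shows "repl i \<le> enat (prefix_len I a + l + (total_len I - prefix_len I b))"
proof -
  let ?e = "(PP I ! i, PP I ! Suc i)"
  let ?E = "EE I - {?e}"
  have e: "?e \<in> set (edges_of (PP I))"
    unfolding in_edges_of using a by (intro exI[of _ i]) (simp add: last_idx_def)
  have ne: "(PP I ! k, PP I ! Suc k) \<in> ?E" if "k < last_idx I" "k \<noteq> i" for k
    using spD(10)[OF that(1)] nth_P_eq[of k i] that a by auto
  have "walk ?E (ww I) (PP I ! 0) (PP I ! a) (prefix_len I a - prefix_len I 0)"
    using a by (intro walk_P ne) simp_all
  moreover have "walk ?E (ww I) (PP I ! a) (PP I ! b) l"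
    by (rule walk_mono[OF w]) (use e in \<open>auto simp: rest_def\<close>)
  moreover have "walk ?E (ww I) (PP I ! b) (PP I ! last_idx I) (prefix_len I (last_idx I) - prefix_len I b)"
    using a by (intro walk_P ne) simp_all
  ultimately have "walk ?E (ww I) (ss I) (tt I) (prefix_len I a + l + (total_len I - prefix_len I b))"
    using walk_trans spD(6,7) by (simp add: prefix_len_def[of _ 0] total_len_def) (metis walk_trans)
  moreover have "?E \<subseteq> VV I \<times> VV I" using spD(5) by auto
  ultimately obtain p where p: "is_path (VV I) ?E p" "hd p = ss I" "last p = tt I"
      "path_len (ww I) p \<le> prefix_len I a + l + (total_len I - prefix_len I b)"
    using walk_path spD(11) by blast
  have "repl i \<le> enat (path_len (ww I) p)"
    unfolding repl_dist_def by (rule Inf_lower) (use p in \<open>auto simp: is_path_def\<close>)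
  then show ?thesis using p(4) by (meson enat_ord_simps(1) order_trans)
qed

text \<open>The induction prepends edges, so the walk is read from \<open>t\<close> backwards in
  search of a stretch off \<open>P\<close> that jumps over edge \<open>i\<close>. In
  \<open>?A\<close> the stretch still extends to the current vertex, in \<open>?B\<close> its start
  \<open>a\<close> has been found. A path edge before \<open>i\<close> fixes \<open>a\<close>; at a
  path edge after \<open>i\<close> the stretch is restarted with \<open>b = k\<close>, since the
  suffix of \<open>P\<close> is shortest.\<close>

lemma detour_split:
  assumes i: "i < last_idx I" and "walk (EE I - {(PP I ! i, PP I ! Suc i)}) (ww I) v x d" "x = tt I"
  shows "(\<exists>b l. i < b \<and> b \<le> last_idx I \<and> walk (rest I) (ww I) v (PP I ! b) l \<and> l + (total_len I - prefix_len I b) \<le> d) \<or>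
    (\<exists>a b l d0. a \<le> i \<and> i < b \<and> b \<le> last_idx I \<and> walk (rest I) (ww I) (PP I ! a) (PP I ! b) l \<and>
       walk (EE I) (ww I) v (PP I ! a) d0 \<and> d0 + l + (total_len I - prefix_len I b) \<le> d)" (is "?A v d \<or> ?B v d")
  using assms(2,3)
proof (induction rule: walk.induct)
  case (walk_refl v)
  then show ?case using i spD(7) walk.walk_refl[of "rest I" "ww I" v]
    by (intro disjI1 exI[of _ "last_idx I"] exI[of _ 0]) (auto simp: total_len_def)
next
  case (walk_step v x y d)
  let ?e = "(PP I ! i, PP I ! Suc i)"
  have vx: "(v, x) \<in> EE I" "(v, x) \<noteq> ?e" using walk_step by auto
  note ed = walk_edge[OF vx(1), of "ww I"]
  from walk_step.IH[OF walk_step.prems] show ?case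
  proof
    assume "?B x d"
    then obtain a b l d0 where 1: "a \<le> i" "i < b" "b \<le> last_idx I" "walk (rest I) (ww I) (PP I ! a) (PP I ! b) l"
       "walk (EE I) (ww I) x (PP I ! a) d0" "d0 + l + (total_len I - prefix_len I b) \<le> d" by blast
    then have "walk (EE I) (ww I) v (PP I ! a) (ww I (v, x) + d0)" using walk_trans[OF ed] by blast
    then show ?thesis using 1 by (intro disjI2 exI[of _ a] exI[of _ b] exI[of _ l] exI[of _ "ww I (v, x) + d0"]) auto
  next
    assume "?A x d"
    then obtain b l where 1: "i < b" "b \<le> last_idx I" "walk (rest I) (ww I) x (PP I ! b) l" "l + (total_len I - prefix_len I b) \<le> d" by blast
    show ?thesis
    proof (cases "(v, x) \<in> rest I")
      case True
      then show ?thesis using 1 walk.walk_step[OF True 1(3)]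
        by (intro disjI1 exI[of _ b] exI[of _ "ww I (v, x) + l"]) auto
    next
      case False
      then obtain k where k: "Suc k < length (PP I)" "v = PP I ! k" "x = PP I ! Suc k"
        using vx unfolding rest_def by (auto simp: in_edges_of)
      have kh: "k < last_idx I" using k by (simp add: last_idx_def)
      have "k \<noteq> i" using k vx by auto
      show ?thesis
      proof (cases "k < i")
        case True
        then show ?thesis using 1 ed k
          by (intro disjI2 exI[of _ "Suc k"] exI[of _ b] exI[of _ l] exI[of _ "ww I (v, x)"]) auto
      next
        case False
        have "walk (EE I) (ww I) v y (ww I (v, x) + d)"
          using walk_trans[OF ed walk_mono[OF walk_step.hyps(2)]] by auto
        then have "total_len I - prefix_len I k \<le> ww I (v, x) + d" using walk_ge_suf[of k] kh k(2) walk_step.prems by simp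
        then show ?thesis using False \<open>k \<noteq> i\<close> kh k(2) walk.walk_refl[of "rest I" "ww I" v]
          by (intro disjI1 exI[of _ k] exI[of _ 0]) auto
      qed
    qed
  qed
qed

lemma repl_attained:
  assumes i: "i < last_idx I" and X: "repl i = enat X"
  shows "\<exists>a b l. a \<le> i \<and> i < b \<and> b \<le> last_idx I \<and> walk (rest I) (ww I) (PP I ! a) (PP I ! b) l \<and>
    prefix_len I a + l + (total_len I - prefix_len I b) \<le> X"
    and "total_len I \<le> X" and "\<exists>p. is_path (VV I) (EE I) p \<and> path_len (ww I) p = X"
proof -
  let ?e = "(PP I ! i, PP I ! Suc i)"
  let ?S = "{enat (path_len (ww I) p) |p. is_path (VV I) (EE I) p \<and> hd p = ss I \<and> last p = tt I \<and> ?e \<notin> set (edges_of p)}"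
  have ne: "?S \<noteq> {}"
  proof
    assume "?S = {}"
    then have "repl i = \<infinity>" unfolding repl_dist_def by (simp add: Inf_enat_def)
    then show False using X by simp
  qed
  then have "Inf ?S \<in> ?S" unfolding Inf_enat_def using LeastI_ex[of "\<lambda>x. x \<in> ?S"] by auto
  then have "enat X \<in> ?S" using X unfolding repl_dist_def by simp
  then obtain p where p: "path_len (ww I) p = X" "is_path (VV I) (EE I) p" "hd p = ss I" "last p = tt I"
      "?e \<notin> set (edges_of p)" by auto
  then show "\<exists>p. is_path (VV I) (EE I) p \<and> path_len (ww I) p = X" by blast
  have w: "walk (EE I - {?e}) (ww I) (ss I) (tt I) X"
    using path_wk[of p "EE I - {?e}" "ww I"] p by (auto simp: is_path_def)
  then show "total_len I \<le> X" using walk_ge_tot walk_mono by blast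
  from detour_split[OF i w refl]
  show "\<exists>a b l. a \<le> i \<and> i < b \<and> b \<le> last_idx I \<and> walk (rest I) (ww I) (PP I ! a) (PP I ! b) l \<and>
    prefix_len I a + l + (total_len I - prefix_len I b) \<le> X"
  proof (elim disjE exE conjE)
    fix b l assume "i < b" "b \<le> last_idx I" "walk (rest I) (ww I) (ss I) (PP I ! b) l" "l + (total_len I - prefix_len I b) \<le> X"
    then show ?thesis using spD(6) by (intro exI[of _ 0] exI[of _ b] exI[of _ l]) (simp add: prefix_len_def[of _ 0])
  next
    fix a b l d0 assume 1: "a \<le> i" "i < b" "b \<le> last_idx I" "walk (rest I) (ww I) (PP I ! a) (PP I ! b) l"
       "walk (EE I) (ww I) (ss I) (PP I ! a) d0" "d0 + l + (total_len I - prefix_len I b) \<le> X"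
    then have "prefix_len I a \<le> d0" using walk_ge_pd[OF 1(5)] by simp
    then show ?thesis using 1 by (intro exI[of _ a] exI[of _ b] exI[of _ l]) simp
  qed
qed

lemma total_len_pos: "last_idx I > 0 \<Longrightarrow> total_len I > 0"
proof -
  assume h: "last_idx I > 0"
  have "prefix_len I 1 \<le> total_len I" unfolding total_len_def by (rule prefix_len_mono) (use h in simp)
  moreover have "prefix_len I 1 > 0" using spD(8)[OF spD(10)[OF h]] by (simp add: prefix_len_def)
  ultimately show ?thesis by simp
qed

lemma prefix_len_strict: "i < j \<Longrightarrow> j \<le> last_idx I \<Longrightarrow> prefix_len I i < prefix_len I j"
proof -
  assume ij: "i < j" "j \<le> last_idx I"
  have "prefix_len I i < prefix_len I (Suc i)" using spD(8)[OF spD(10)[of i]] ij by (simp add: prefix_len_def)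
  also have "\<dots> \<le> prefix_len I j" by (rule prefix_len_mono) (use ij in simp)
  finally show ?thesis .
qed

end

lemma path_len_bound:
  assumes "is_path V E p" "finite V" "\<And>e. e \<in> E \<Longrightarrow> c e \<le> B"
  shows "path_len c p \<le> card V * B"
proof -
  have "path_len c p = (\<Sum>k<length p - 1. c (p ! k, p ! Suc k))" by (rule path_len_sum)
  also have "\<dots> \<le> (\<Sum>k<length p - 1. B)"
  proof (rule sum_mono)
    fix k assume "k \<in> {..<length p - 1}"
    then have "(p ! k, p ! Suc k) \<in> set (edges_of p)" unfolding in_edges_of by (intro exI[of _ k]) auto
    then show "c (p ! k, p ! Suc k) \<le> B" using assms(1,3) unfolding is_path_def by blast
  qed
  also have "\<dots> = (length p - 1) * B" by simp
  also have "length p \<le> card V"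
    using assms(1,2) unfolding is_path_def by (metis card_mono distinct_card)
  then have "(length p - 1) * B \<le> card V * B" by (intro mult_right_mono) auto
  finally show ?thesis .
qed

text \<open>The choice depends on the graph only, never on \<open>LL\<close>, so the paths to be hit
  are fixed before the coins and a union bound over pairs applies.\<close>

definition detour :: "inst \<Rightarrow> nat \<Rightarrow> nat \<Rightarrow> nat list" where
  "detour I u v = (ARG_MIN (path_len (ww I)) p. is_path (VV I) (rest I) p \<and> hd p = u \<and> last p = v)"

lemma detour:
  assumes "walk (rest I) (ww I) u v l" "EE I \<subseteq> VV I \<times> VV I" "u \<in> VV I"
  shows "is_path (VV I) (rest I) (detour I u v)" "hd (detour I u v) = u" "last (detour I u v) = v"
    "path_len (ww I) (detour I u v) \<le> l"
proof -
  have "rest I \<subseteq> VV I \<times> VV I" using assms(2) by (auto simp: rest_def)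
  from walk_path[OF assms(1) this assms(3)] obtain p where
    p: "is_path (VV I) (rest I) p \<and> hd p = u \<and> last p = v" "path_len (ww I) p \<le> l" by blast
  have "(is_path (VV I) (rest I) (detour I u v) \<and> hd (detour I u v) = u \<and> last (detour I u v) = v) \<and>
      path_len (ww I) (detour I u v) \<le> path_len (ww I) p"
    unfolding detour_def using arg_min_nat_lemma[of "\<lambda>p. is_path (VV I) (rest I) p \<and> hd p = u \<and> last p = v" p "path_len (ww I)"] p
    by blast
  then show "is_path (VV I) (rest I) (detour I u v)" "hd (detour I u v) = u" "last (detour I u v) = v"
    "path_len (ww I) (detour I u v) \<le> l" using p(2) by auto
qed

section \<open>The replacement path protocol\<close>

lemma power_lg_le: "n \<ge> 1 \<Longrightarrow> 2 ^ lg n \<le> 2 * n"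
proof -
  assume n: "n \<ge> 1"
  have "real (lg n) \<le> log 2 (real n) + 1" unfolding lg_def using n by (simp add: of_nat_nat)
  then have "2 powr real (lg n) \<le> 2 powr (log 2 (real n) + 1)" by (intro powr_mono) auto
  then have "real (2 ^ lg n) \<le> real (2 * n)" using n by (simp add: powr_realpow powr_add)
  then show ?thesis by linarith
qed

text \<open>Each vertex closes its own items and the broadcast ones under concatenation by local
  computation: hops to landmarks, then one hop back to \<open>P\<close>.\<close>

inductive reaches :: "(nat \<times> (nat + nat) \<times> nat) set \<Rightarrow> nat \<Rightarrow> nat \<Rightarrow> nat \<Rightarrow> bool" for It where
  reaches_base: "(u, Inr b, c) \<in> It \<Longrightarrow> reaches It u b c"
| reaches_step: "(u, Inl l, c) \<in> It \<Longrightarrow> reaches It l b c' \<Longrightarrow> reaches It u b (c + c')"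

locale fnet = rnet G cI z kk cW e0 Ck for G cI z kk cW e0 Ck +
  fixes rr :: real and levels :: "nat \<Rightarrow> nat"
  assumes sp: "\<And>I. I \<in> G \<Longrightarrow> sp_inst I"
    and hitsC: "\<And>I u v l. I \<in> G \<Longrightarrow> u \<in> VV I \<Longrightarrow> v \<in> VV I \<Longrightarrow> walk (rest I) (ww I) u v l \<Longrightarrow>
       hits (z (nn I)) (LL I) (detour I u v)"
    and rr: "rr > 1" and rrQ: "\<And>n. n \<ge> 2 \<Longrightarrow> real ((e0 * z n + 2 * z n) * n ^ (cW + 1)) \<le> rr ^ levels n"
    and plogQ: "plog levels"
begin

section \<open>Prefix lengths, the length of the path, and the distance tables as knowledge\<close>

definition win :: "inst \<Rightarrow> nat \<Rightarrow> nat" where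
  "win I v = (let l = loc I v in if l_src l then 0 else in_wt l (THE u. (u, l_id l) \<in> l_pe l))"

lemma in_wt_EE: "I \<in> G \<Longrightarrow> (u, v) \<in> EE I \<Longrightarrow> in_wt (loc I v) u = ww I (u, v)"
  using l_out_in(2)[OF conn] by (auto simp: in_wt_def)

lemma last_idx_len: "I \<in> G \<Longrightarrow> i < length (PP I) \<longleftrightarrow> i \<le> last_idx I"
  using pinD(1) by (cases "PP I") (auto simp: last_idx_def)

lemma win_nth:
  assumes I: "I \<in> G" and i: "Suc i < length (PP I)"
  shows "win I (PP I ! Suc i) = ww I (PP I ! i, PP I ! Suc i)"
proof -
  note D = pinD[OF I]
  have "PP I ! Suc i \<noteq> ss I" using D(1,2,5) i by (metis length_greater_0_conv nat.distinct(1) nth_eq_iff_index_eq)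
  moreover have "(THE u. (u, PP I ! Suc i) \<in> set (edges_of (PP I))) = PP I ! i"
    using i D(2) by (intro the_equality) (auto simp: in_edges_of nth_eq_iff_index_eq)
  moreover have "(PP I ! i, PP I ! Suc i) \<in> EE I" using i D(4) in_edges_of by blast
  ultimately show ?thesis using in_wt_EE[OF I] by (simp add: win_def Let_def)
qed

lemma prefix_fold_win: "I \<in> G \<Longrightarrow> i < length (PP I) \<Longrightarrow> prefix_fold (+) I (win I) i = prefix_len I i"
proof (induction i)
  case 0
  then show ?case using pinD(5) by (simp add: win_def prefix_len_def)
next
  case (Suc i)
  then show ?case using win_nth[of I i] by (simp add: prefix_len_def)
qed

text \<open>Summing from a segment start omits terms, so segment sums inherit the polynomial bound
  on prefix lengths; they are what the scan transmits.\<close>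

lemma seg_fold_le_pref: "seg_fold (+) I y i \<le> (prefix_fold (+) I y i :: nat)"
  by (induction i) auto

lemma n2: "I \<in> G \<Longrightarrow> nn I \<ge> 2" using conn_instD(1)[OF conn] .

lemma path_len_le: "I \<in> G \<Longrightarrow> is_path (VV I) (EE I) p \<Longrightarrow> path_len (ww I) p \<le> nn I ^ (cW + 1)"
  using path_len_bound[of "VV I" "EE I" p "ww I" "nn I ^ cW"] conn_instD(2,3)[OF conn] wts by simp

lemma prefix_len_le: "I \<in> G \<Longrightarrow> i \<le> last_idx I \<Longrightarrow> prefix_len I i \<le> nn I ^ (cW + 1)"
proof -
  assume I: "I \<in> G" and i: "i \<le> last_idx I"
  have "prefix_len I i \<le> total_len I" unfolding total_len_def by (rule prefix_len_mono[OF i])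
  also have "\<dots> = path_len (ww I) (PP I)" using total_len_path_len[OF sp[OF I]] by simp
  also have "\<dots> \<le> nn I ^ (cW + 1)"
    by (rule path_len_le[OF I]) (use pinD[OF I] in \<open>simp add: is_path_def\<close>)
  finally show ?thesis .
qed

definition prefix_len_at :: "inst \<Rightarrow> nat \<Rightarrow> nat" where "prefix_len_at I v = (if v \<in> set (PP I) then prefix_len I (idx I v) else 0)"

lemma prefix_len_at_nth: "I \<in> G \<Longrightarrow> i \<le> last_idx I \<Longrightarrow> prefix_len_at I (PP I ! i) = prefix_len I i"
  using pinD(2) last_idx_len by (simp add: prefix_len_at_def)

lemma idx_le: "I \<in> G \<Longrightarrow> v \<in> set (PP I) \<Longrightarrow> idx I v \<le> last_idx I \<and> PP I ! idx I v = v"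
  using pinD(2) last_idx_len by (metis idx_nth in_set_conv_nth)

definition T1 where "T1 I = 3 * ecc I + 2 + z (nn I) + (kk (nn I) + 2 * ecc I)"

lemma knows_pdl: "knows T1 prefix_len_at"
proof -
  have "knows (\<lambda>I. 3 * ecc I + 2 + z (nn I) + (kk (nn I) + 2 * ecc I))
    (\<lambda>I v. ((), if v \<in> set (PP I) then prefix_fold (+) I (win I) (idx I v) else undefined))"
  proof (rule knows_scan[OF knows_start, where M = "\<lambda>n. {..1 * n ^ (cW + 1)}"
        and yf = "\<lambda>b _. if l_src (fst b) then 0 else in_wt (fst b) (THE u. (u, l_id (fst b)) \<in> l_pe (fst b))"])
    show "small (\<lambda>n. {..1 * n ^ (cW + 1)})" by (rule small_atMost_poly)
    show "seg_fold (+) I (win I) i \<in> {..1 * nn I ^ (cW + 1)}" if "I \<in> G" "i < length (PP I)" for I i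
      using seg_fold_le_pref[of I "win I" i] prefix_fold_win[OF that] prefix_len_le[OF that(1), of i] last_idx_len[OF that(1), of i] that by simp
  qed (auto simp: win_def Let_def)
  then have "knows T1 (\<lambda>I v. ((), if v \<in> set (PP I) then prefix_fold (+) I (win I) (idx I v) else undefined))"
    unfolding T1_def .
  then show ?thesis
  proof (rule knows_map[where g = "\<lambda>b (_, p). if onP (fst b) then p else 0"])
    fix I v assume IG: "I \<in> G"
    show "prefix_len_at I v = (case ((), if v \<in> set (PP I) then prefix_fold (+) I (win I) (idx I v) else undefined) of
       (_, p) \<Rightarrow> if onP (fst (base I v)) then p else 0)"
      using onP_loc[OF pin[OF IG], of v] prefix_fold_win[OF IG, of "idx I v"] idx_le[OF IG, of v] last_idx_len[OF IG]
      by (auto simp: prefix_len_at_def)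
  qed
qed

definition T2 where "T2 I = T1 I + (1 + 2 * ecc I)"

text \<open>Only \<open>t\<close> contributes an item: its own prefix length is the length of
  \<open>P\<close>.\<close>

lemma knows_tot: "knows T2 (\<lambda>I v. (prefix_len_at I v, total_len I))"
proof -
  define items where "items I v = (if v = tt I then {prefix_len_at I v} else {})" for I v
  have U: "(\<Union>v\<in>VV I. items I v) = {total_len I}" if "I \<in> G" for I
  proof -
    have t: "PP I ! last_idx I = tt I" using spD(7)[OF sp[OF that]] .
    have "tt I \<in> VV I" using P_V[OF sp[OF that], of "last_idx I"] t by simp
    moreover have "prefix_len_at I (tt I) = total_len I" using prefix_len_at_nth[OF that, of "last_idx I"] t by (simp add: total_len_def)
    ultimately show ?thesis by (auto simp: items_def)
  qed
  have "knows (\<lambda>I. T1 I + ((\<lambda>_. 1) (nn I) + 2 * ecc I)) (\<lambda>I v. (prefix_len_at I v, list_of (\<Union>v\<in>VV I. items I v)))"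
  proof (rule knows_broadcast[OF knows_pdl, where M = "\<lambda>n. {..1 * n ^ (cW + 1)}"
       and itf = "\<lambda>b p. if l_trg (fst b) then {p} else {}"])
    show "small (\<lambda>n. {..1 * n ^ (cW + 1)})" by (rule small_atMost_poly)
    fix I assume IG: "I \<in> G"
    show "items I v \<subseteq> {..1 * nn I ^ (cW + 1)}" if "v \<in> VV I" for v
    proof -
      have "items I v \<subseteq> {total_len I}" using U[OF IG] that by blast
      moreover have "total_len I \<le> 1 * nn I ^ (cW + 1)" using prefix_len_le[OF IG, of "last_idx I"] unfolding total_len_def by simp
      ultimately show ?thesis by blast
    qed
    show "card (\<Union>v\<in>VV I. items I v) \<le> 1" using U[OF IG] by simp
  qed (auto simp: items_def)
  then have "knows T2 (\<lambda>I v. (prefix_len_at I v, list_of (\<Union>v\<in>VV I. items I v)))" by (simp add: T2_def[abs_def])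
  then show ?thesis
    by (rule knows_map[where g = "\<lambda>b (p, l). (p, the_elem (set l))"]) (simp add: U)
qed

text \<open>Positions on \<open>P\<close> are identified with prefix lengths, which increase
  strictly along \<open>P\<close> and are known locally. The value \<open>0\<close> is left for
  vertices off \<open>P\<close>.\<close>

definition val :: "inst \<Rightarrow> nat \<Rightarrow> nat" where "val I v = (if v \<in> set (PP I) then Suc (prefix_len_at I v) else 0)"

lemma val_le: "I \<in> G \<Longrightarrow> val I v \<le> 2 * nn I ^ (cW + 1)"
proof -
  assume I: "I \<in> G"
  have "nn I ^ (cW + 1) \<ge> 1" using n2[OF I] by simp
  moreover have "prefix_len_at I v \<le> nn I ^ (cW + 1)" if "v \<in> set (PP I)"
    using prefix_len_le[OF I, of "idx I v"] idx_le[OF I that] that unfolding prefix_len_at_def by metis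
  ultimately have "v \<in> set (PP I) \<Longrightarrow> Suc (prefix_len_at I v) \<le> 2 * nn I ^ (cW + 1)" by linarith
  then show ?thesis unfolding val_def by (cases "v \<in> set (PP I)") (simp_all only: if_True if_False zero_le)
qed

abbreviation far_at where "far_at I v \<equiv> far_table I (val I) (cost_bound (nn I)) v"
abbreviation tdist_at where "tdist_at I v \<equiv> tdist_table I (cost_bound (nn I) + kk (nn I)) v"

definition T3 where "T3 I = T2 I + cost_bound (nn I) + (cost_bound (nn I) + kk (nn I))"

lemma knows_dists: "knows T3 (\<lambda>I v. (((prefix_len_at I v, total_len I), far_at I v), tdist_at I v))"
proof -
  have "knows (\<lambda>I. T2 I + cost_bound (nn I)) (\<lambda>I v. ((prefix_len_at I v, total_len I), far_table I (val I) (cost_bound (nn I)) v))"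
    by (rule knows_FL[OF knows_tot _ val_le, where vf = "\<lambda>b (p, t). if onP (fst b) then Suc p else 0"])
       (simp_all add: val_def onP_loc[OF pin])
  from knows_KD[OF this] show ?thesis unfolding T3_def .
qed

text \<open>An item \<open>(u, Inl l, c)\<close> says that landmark \<open>l\<close> is reachable from \<open>u\<close> at cost \<open>c\<close>, and \<open>(u, Inr b, c)\<close> that the point
  at position \<open>b\<close> of \<open>P\<close> is. For the latter only the costs \<open>j * z n * 2 ^ sg\<close> are tabulated.\<close>

definition own_items_of :: "nat \<Rightarrow> nat \<Rightarrow> nat list list \<Rightarrow> (nat \<times> nat) list list \<Rightarrow> (nat \<times> (nat + nat) \<times> nat) set" where
  "own_items_of n u F K =
    {(u, Inl l, c) |l c. \<exists>sg d. sg \<le> scales n \<and> d \<le> cost_bound n \<and> (d, l) \<in> set (K ! sg) \<and> c = d * 2 ^ sg \<and>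
       (\<forall>sg' d'. sg' \<le> scales n \<and> d' \<le> cost_bound n \<and> (d', l) \<in> set (K ! sg') \<longrightarrow> c \<le> d' * 2 ^ sg')} \<union>
    {(u, Inr b, j * z n * 2 ^ sg) |b j sg. sg \<le> scales n \<and> j \<le> 2 * e0 + 1 \<and> F ! sg ! (j * z n) = Suc b}"

definition own :: "inst \<Rightarrow> nat \<Rightarrow> (nat \<times> (nat + nat) \<times> nat) set" where
  "own I u = own_items_of (nn I) u (far_at I u) (tdist_at I u)"

lemma jz_le: "j \<le> 2 * e0 + 1 \<Longrightarrow> j * z n \<le> cost_bound n"
proof -
  assume "j \<le> 2 * e0 + 1"
  then have "j * z n \<le> (2 * e0 + 1) * z n" by (rule mult_right_mono) simp
  then show ?thesis by (simp add: cost_bound_def N0_def algebra_simps)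
qed

lemma own_fst: "(a, x, c) \<in> own I u \<Longrightarrow> a = u"
  unfolding own_def own_items_of_def by auto

lemma tdist_wk: "I \<in> G \<Longrightarrow> (d, l) \<in> tdist (rest I) (scaled_cost I sg) (LL I) j u \<Longrightarrow> l \<in> LL I \<and> walk (rest I) (scaled_cost I sg) u l d"
  using tdist_sound[OF rest_fin LL_fin] scaled_cost_pos by blast

lemma own_Inl: "I \<in> G \<Longrightarrow> (u, Inl l, c) \<in> own I u \<Longrightarrow>
  \<exists>sg d. sg \<le> scales (nn I) \<and> d \<le> cost_bound (nn I) \<and> c = d * 2 ^ sg \<and> l \<in> LL I \<and> walk (rest I) (scaled_cost I sg) u l d"
  unfolding own_def own_items_of_def using tdist_table_nth tdist_wk by fastforce

lemma own_Inr: "I \<in> G \<Longrightarrow> u \<in> VV I \<Longrightarrow> (u, Inr b, c) \<in> own I u \<Longrightarrow>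
  \<exists>sg j. sg \<le> scales (nn I) \<and> j \<le> 2 * e0 + 1 \<and> c = j * z (nn I) * 2 ^ sg \<and>
     far (rest I) (scaled_cost I sg) (val I) (j * z (nn I)) u = Suc b"
  unfolding own_def own_items_of_def using far_table_nth[OF _ jz_le] by fastforce

lemma far_le_val: "I \<in> G \<Longrightarrow> u \<in> VV I \<Longrightarrow> far (rest I) c (val I) d u \<le> 2 * nn I ^ (cW + 1)"
  using far_le_iff[OF conn_instD(2)[OF conn] rest_V] val_le by blast

definition Cc :: nat where "Cc = 3 * e0 * 2 ^ (cW + 1)"

lemma cost_le: "n \<ge> 2 \<Longrightarrow> d \<le> cost_bound n \<Longrightarrow> sg \<le> scales n \<Longrightarrow> d * 2 ^ sg \<le> Cc * n ^ (cW + 2)"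
proof -
  assume n: "n \<ge> 2" and d: "d \<le> cost_bound n" and sg: "sg \<le> scales n"
  have "z n \<le> e0 * z n" using e0 by simp
  then have "cost_bound n \<le> 3 * (e0 * z n)" unfolding cost_bound_def N0_def by simp
  also have "\<dots> \<le> 3 * (e0 * n)" using z_le[OF n] by simp
  finally have 1: "d \<le> 3 * e0 * n" using d by simp
  have "(2::nat) ^ sg \<le> 2 ^ scales n" using sg by (intro power_increasing) auto
  also have "\<dots> = (2 ^ lg n) ^ (cW + 1)" unfolding scales_def by (metis mult.commute power_mult)
  also have "\<dots> \<le> (2 * n) ^ (cW + 1)" using power_lg_le[of n] n by (intro power_mono) auto
  finally have "(2::nat) ^ sg \<le> 2 ^ (cW + 1) * n ^ (cW + 1)" by (simp only: power_mult_distrib)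
  then have "d * 2 ^ sg \<le> (3 * e0 * n) * (2 ^ (cW + 1) * n ^ (cW + 1))" by (rule mult_mono[OF 1]) auto
  then show ?thesis by (simp add: Cc_def algebra_simps)
qed

definition num_items :: "nat \<Rightarrow> nat" where "num_items n = kk n * (kk n + (scales n + 1) * (2 * e0 + 2))"

text \<open>There is one item per landmark at most, as only the least cost over all scales is kept,
  and one per scale and multiple of \<open>z\<close>. The coarse multiples matter: tabulating every
  cost would give about \<open>z\<close> items per landmark, too many to broadcast.\<close>

lemma own_card:
  assumes "I \<in> G"
  shows "finite (own I u) \<and> card (own I u) \<le> kk (nn I) + (scales (nn I) + 1) * (2 * e0 + 2)"
proof -
  let ?n = "nn I"
  define g where "g l = (THE c. (u, Inl l, c) \<in> own I u)" for l
  have uniq: "c = c'" if "(u, Inl l, c) \<in> own I u" "(u, Inl l, c') \<in> own I u" for l c c'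
  proof -
    have "c \<le> c'" "c' \<le> c" using that unfolding own_def own_items_of_def by blast+
    then show ?thesis by simp
  qed
  let ?A = "(\<lambda>l. (u, Inl l :: nat + nat, g l)) ` LL I"
  let ?h = "\<lambda>(j, sg). (u, Inr (far_at I u ! sg ! (j * z ?n) - 1) :: nat + nat, j * z ?n * 2 ^ sg)"
  let ?B = "?h ` ({..2 * e0 + 1} \<times> {..scales ?n})"
  have "own I u \<subseteq> ?A \<union> ?B"
  proof
    fix e assume e: "e \<in> own I u"
    then consider l c where "e = (u, Inl l, c)" | b j sg where "e = (u, Inr b, j * z ?n * 2 ^ sg)"
      "sg \<le> scales ?n" "j \<le> 2 * e0 + 1" "far_at I u ! sg ! (j * z ?n) = Suc b"
      unfolding own_def own_items_of_def by blast
    then show "e \<in> ?A \<union> ?B"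
    proof cases
      case (1 l c)
      have "g l = c" unfolding g_def by (rule the_equality) (use e 1 uniq in auto)
      moreover have "l \<in> LL I" using own_Inl[OF assms] e 1 by blast
      ultimately show ?thesis using 1 by auto
    next
      case (2 b j sg)
      then have "e = ?h (j, sg)" by simp
      then show ?thesis using 2 by blast
    qed
  qed
  moreover have fin: "finite (?A \<union> ?B)" using LL_fin[OF assms] by simp
  moreover have "card (?A \<union> ?B) \<le> kk ?n + (scales ?n + 1) * (2 * e0 + 2)"
  proof -
    have "card ?A \<le> kk ?n" using card_image_le[OF LL_fin[OF assms]] cardL[OF assms] order_trans by blast
    moreover have "card ?B \<le> card ({..2 * e0 + 1} \<times> {..scales ?n})" by (rule card_image_le) simp
    ultimately show ?thesis using card_Un_le[of ?A ?B] by (simp add: algebra_simps)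
  qed
  ultimately show ?thesis by (meson card_mono finite_subset order_trans)
qed

definition lm_items :: "inst \<Rightarrow> (nat \<times> (nat + nat) \<times> nat) set" where "lm_items I = (\<Union>u\<in>LL I. own I u)"

definition T4 where "T4 I = T3 I + (num_items (nn I) + 2 * ecc I)"

lemma knows_items: "knows T4 (\<lambda>I v. ((((prefix_len_at I v, total_len I), far_at I v), tdist_at I v), list_of (lm_items I)))"
proof -
  define items where "items I v = (if v \<in> LL I then own I v else {})" for I v
  have U: "(\<Union>v\<in>VV I. items I v) = lm_items I" if "I \<in> G" for I
    using pinD(7)[OF that] by (auto simp: items_def lm_items_def split: if_splits)
  have "knows (\<lambda>I. T3 I + (num_items (nn I) + 2 * ecc I))
     (\<lambda>I v. ((((prefix_len_at I v, total_len I), far_at I v), tdist_at I v), list_of (\<Union>v\<in>VV I. items I v)))"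
  proof (rule knows_broadcast[OF knows_dists, where
        M = "\<lambda>n. {..n ^ cI} \<times> (Inl ` {..n ^ cI} \<union> Inr ` {..2 * n ^ (cW + 1)}) \<times> {..Cc * n ^ (cW + 2)}"
       and itf = "\<lambda>b (((p, t), F), K). if l_L (fst b) then own_items_of (fst (fst b)) (l_id (fst b)) F K else {}"])
    show "small (\<lambda>n. {..n ^ cI} \<times> (Inl ` {..n ^ cI} \<union> Inr ` {..2 * n ^ (cW + 1)}) \<times> {..Cc * n ^ (cW + 2)})"
      by (intro small_Times small_Un small_image ids_small small_atMost_poly)
    fix I assume IG: "I \<in> G"
    show "items I v \<subseteq> {..nn I ^ cI} \<times> (Inl ` {..nn I ^ cI} \<union> Inr ` {..2 * nn I ^ (cW + 1)}) \<times> {..Cc * nn I ^ (cW + 2)}"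
      if v: "v \<in> VV I" for v
    proof
      fix e assume "e \<in> items I v"
      then have "e \<in> own I v" by (simp add: items_def split: if_splits)
      moreover obtain u x c where e: "e = (u, x, c)" by (cases e)
      ultimately have o: "(v, x, c) \<in> own I v" "u = v" using own_fst by blast+
      have vi: "v \<le> nn I ^ cI" using pinD(8)[OF IG v] by simp
      show "e \<in> {..nn I ^ cI} \<times> (Inl ` {..nn I ^ cI} \<union> Inr ` {..2 * nn I ^ (cW + 1)}) \<times> {..Cc * nn I ^ (cW + 2)}"
      proof (cases x)
        case (Inl l)
        then obtain sg d where sd: "sg \<le> scales (nn I)" "d \<le> cost_bound (nn I)" "c = d * 2 ^ sg" "l \<in> LL I"
          using own_Inl[OF IG] o by blast
        have "l \<le> nn I ^ cI" using pinD(7,8)[OF IG] sd(4) by (meson less_imp_le subsetD)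
        then show ?thesis using e o vi Inl sd cost_le[OF n2[OF IG] sd(2,1)] by simp
      next
        case (Inr b)
        then obtain sg j where sd: "sg \<le> scales (nn I)" "j \<le> 2 * e0 + 1" "c = j * z (nn I) * 2 ^ sg"
            "far (rest I) (scaled_cost I sg) (val I) (j * z (nn I)) v = Suc b"
          using own_Inr[OF IG v] o by blast
        have "b \<le> 2 * nn I ^ (cW + 1)" using far_le_val[OF IG v, of "scaled_cost I sg" "j * z (nn I)"] sd(4) by simp
        then show ?thesis using e o vi Inr sd cost_le[OF n2[OF IG] jz_le[OF sd(2)] sd(1)] by simp
      qed
    qed
    have "card (lm_items I) \<le> (\<Sum>u\<in>LL I. card (own I u))"
      unfolding lm_items_def by (rule card_UN_le[OF LL_fin[OF IG]])
    also have "\<dots> \<le> (\<Sum>u\<in>LL I. kk (nn I) + (scales (nn I) + 1) * (2 * e0 + 2))"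
      using own_card[OF IG] by (intro sum_mono) blast
    also have "\<dots> \<le> num_items (nn I)" unfolding num_items_def using cardL[OF IG] by (simp only: sum_constant of_nat_id mult_le_mono1)
    finally show "card (\<Union>v\<in>VV I. items I v) \<le> num_items (nn I)" using U[OF IG] by simp
  qed (auto simp: items_def own_def)
  then show ?thesis unfolding T4_def
    by (rule knows_map[where g = "\<lambda>b x. x"]) (simp add: U)
qed

text \<open>Entry \<open>q\<close> is one more than the farthest position to which one can jump from position \<open>p\<close> if the whole
  replacement path may cost \<open>rr ^ q\<close>.\<close>

definition level_far_of :: "nat \<Rightarrow> nat \<Rightarrow> nat \<Rightarrow> nat \<Rightarrow> (nat \<times> (nat + nat) \<times> nat) set \<Rightarrow> nat list" where
  "level_far_of n v p t It = map (\<lambda>q. Max (insert 0 {Suc b |b c. reaches It v b c \<and> real (N0 n * p + c + N0 n * (t - b)) \<le> rr ^ q}))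
     [0..<Suc (levels n)]"

definition level_far :: "inst \<Rightarrow> nat \<Rightarrow> nat list" where "level_far I v = level_far_of (nn I) v (prefix_len_at I v) (total_len I) (own I v \<union> lm_items I)"

section \<open>Soundness and completeness of the distances composed from items\<close>

lemma walk_unround: "walk (rest I) (scaled_cost I sg) u v d \<Longrightarrow> \<exists>l. walk (rest I) (ww I) u v l \<and> N0 (nn I) * l \<le> d * 2 ^ sg"
proof (induction rule: walk.induct)
  case (walk_refl v)
  then show ?case by (intro exI[of _ 0]) (simp add: walk.walk_refl)
next
  case (walk_step v x b d)
  then obtain l where l: "walk (rest I) (ww I) x b l" "N0 (nn I) * l \<le> d * 2 ^ sg" by blast
  have "walk (rest I) (ww I) v b (ww I (v, x) + l)" using walk.walk_step[OF walk_step(1) l(1)] .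
  moreover have "N0 (nn I) * (ww I (v, x) + l) \<le> (scaled_cost I sg (v, x) + d) * 2 ^ sg"
    using l(2) round_wt_bounds(1)[of "ww I (v, x)" "nn I" sg] by (simp add: scaled_cost_def algebra_simps)
  ultimately show ?case by blast
qed

text \<open>Costs are rounded up, never down, so every entry that a vertex derives is backed by a
  real walk of no larger length. This is what makes the output an upper bound.\<close>

lemma reaches_sound:
  assumes I: "I \<in> G" and a: "a \<in> VV I" and r: "reaches (own I a \<union> lm_items I) u b c" and u: "u \<in> VV I"
  shows "\<exists>i l. i \<le> last_idx I \<and> b = prefix_len I i \<and> walk (rest I) (ww I) u (PP I ! i) l \<and> N0 (nn I) * l \<le> c"
  using r u
proof (induction rule: reaches.induct)
  case (reaches_base u b c)
  then have o: "(u, Inr b, c) \<in> own I u" using own_fst unfolding lm_items_def by blast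
  obtain sg j where sd: "c = j * z (nn I) * 2 ^ sg" "far (rest I) (scaled_cost I sg) (val I) (j * z (nn I)) u = Suc b"
    using own_Inr[OF I reaches_base(2) o] by blast
  obtain x d' where x: "walk (rest I) (scaled_cost I sg) u x d'" "d' \<le> j * z (nn I)" "Suc b = val I x"
    using far_attained[OF conn_instD(2)[OF conn[OF I]] rest_V[OF I] reaches_base(2), of "scaled_cost I sg" "val I" "j * z (nn I)"] sd(2) by auto
  have xP: "x \<in> set (PP I)" "b = prefix_len_at I x" using x(3) by (auto simp: val_def split: if_splits)
  obtain l where l: "walk (rest I) (ww I) u x l" "N0 (nn I) * l \<le> d' * 2 ^ sg" using walk_unround[OF x(1)] by blast
  have "d' * 2 ^ sg \<le> c" unfolding sd(1) using x(2) by simp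
  then show ?case using idx_le[OF I xP(1)] xP l by (intro exI[of _ "idx I x"] exI[of _ l]) (auto simp: prefix_len_at_def)
next
  case (reaches_step u l c b c')
  then have o: "(u, Inl l, c) \<in> own I u" using own_fst unfolding lm_items_def by blast
  obtain sg d where sd: "c = d * 2 ^ sg" "l \<in> LL I" "walk (rest I) (scaled_cost I sg) u l d" using own_Inl[OF I o] by blast
  obtain l1 where l1: "walk (rest I) (ww I) u l l1" "N0 (nn I) * l1 \<le> c" using walk_unround[OF sd(3)] sd(1) by blast
  have "l \<in> VV I" using sd(2) pinD(7)[OF I] by blast
  then obtain i l2 where 2: "i \<le> last_idx I" "b = prefix_len I i" "walk (rest I) (ww I) l (PP I ! i) l2" "N0 (nn I) * l2 \<le> c'"
    using reaches_step.IH by blast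
  have "walk (rest I) (ww I) u (PP I ! i) (l1 + l2)" using walk_trans[OF l1(1) 2(3)] .
  then show ?case using 2 l1(2) by (intro exI[of _ i] exI[of _ "l1 + l2"]) (auto simp: algebra_simps)
qed

lemma path_round:
  "path_len (scaled_cost I sg) p * 2 ^ sg \<le> N0 (nn I) * path_len (ww I) p + (length p - 1) * 2 ^ sg"
proof (induction p rule: induct_list012)
  case (3 x y p)
  have "scaled_cost I sg (x, y) * 2 ^ sg \<le> ww I (x, y) * N0 (nn I) + 2 ^ sg"
    using round_wt_bounds(2) by (simp add: scaled_cost_def)
  then show ?case using 3 by (simp add: path_len_Cons algebra_simps)
qed (auto simp: path_len_def)

text \<open>The scale is chosen by \<open>2 ^ sg \<le> length < 2 ^ (sg + 1)\<close>: coarse enough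
  for the rounded cost to respect \<open>cost_bound\<close>, fine enough for one unit per edge to be
  a share of \<open>1 / e0\<close>. The extra \<open>z\<close> in the first bound is room for
  rounding the cost up to a multiple of \<open>z\<close>.\<close>

lemma scale:
  assumes I: "I \<in> G" and p: "is_path (VV I) (rest I) p" and len: "length p \<le> z (nn I) + 1"
  obtains sg d where "sg \<le> scales (nn I)" "d \<le> cost_bound (nn I)" "walk (rest I) (scaled_cost I sg) (hd p) (last p) d"
    "(d + z (nn I)) * 2 ^ sg \<le> (N0 (nn I) + 2 * z (nn I)) * path_len (ww I) p \<or> d = 0"
    "d * 2 ^ sg \<le> (N0 (nn I) + 2 * z (nn I)) * path_len (ww I) p"
proof -
  let ?n = "nn I" and ?l = "path_len (ww I) p"
  have pE: "set (edges_of p) \<subseteq> rest I" "p \<noteq> []" using p by (auto simp: is_path_def)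
  show ?thesis
  \<comment> \<open>Weights are positive, so length \<open>0\<close> means a single vertex. There
    the extra \<open>z\<close> could not be paid for, hence the alternative
    \<open>d = 0\<close>.\<close>
  proof (cases "?l = 0")
    case True
    have "length p = 1"
    proof (rule ccontr)
      assume "length p \<noteq> 1"
      then obtain x y q where q: "p = x # y # q" using pE(2) by (cases p; cases "tl p") auto
      then have "(x, y) \<in> EE I" using pE(1) by (simp add: edges_of_Cons rest_def)
      then have "0 < ww I (x, y)" using wts[OF I] by blast
      then show False using True q by (simp add: path_len_Cons)
    qed
    then obtain x where "p = [x]" by (cases p) auto
    then show ?thesis using that[of 0 0] walk_refl[of "rest I" "scaled_cost I 0" x] by simp
  next
    case False
    then have l1: "?l \<ge> 1" by simp
    obtain sg where sg: "2 ^ sg \<le> ?l" "?l < 2 ^ Suc sg" using ex_power_ivl1[of 2 ?l] l1 by auto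
    define d where "d = path_len (scaled_cost I sg) p"
    have "is_path (VV I) (EE I) p" using p by (auto simp: is_path_def rest_def)
    then have "(2::nat) ^ sg \<le> ?n ^ (cW + 1)" using path_len_le[OF I] sg(1) order_trans by blast
    also have "\<dots> \<le> (2 ^ lg ?n) ^ (cW + 1)" using le_power_lg[of ?n] n2[OF I] by (intro power_mono) auto
    also have "\<dots> = 2 ^ scales ?n" unfolding scales_def by (metis mult.commute power_mult)
    finally have s1: "sg \<le> scales ?n" by (simp add: power_increasing_iff)
    have w: "walk (rest I) (scaled_cost I sg) (hd p) (last p) d" unfolding d_def by (rule path_wk) (use pE in auto)
    have r: "d * 2 ^ sg \<le> N0 ?n * ?l + (length p - 1) * 2 ^ sg" unfolding d_def by (rule path_round)
    also have "\<dots> \<le> N0 ?n * ?l + z ?n * 2 ^ sg" using len by (intro add_left_mono mult_right_mono) auto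
    finally have r2: "d * 2 ^ sg \<le> N0 ?n * ?l + z ?n * 2 ^ sg" .
    have "N0 ?n * ?l \<le> N0 ?n * 2 ^ Suc sg" using sg(2) by (intro mult_le_mono2) simp
    also have "\<dots> = 2 * N0 ?n * 2 ^ sg" by simp
    finally have "d * 2 ^ sg \<le> 2 * N0 ?n * 2 ^ sg + z ?n * 2 ^ sg" using r2 by linarith
    then have "d * 2 ^ sg \<le> (2 * N0 ?n + z ?n) * 2 ^ sg" by (simp only: distrib_right)
    then have s2: "d \<le> cost_bound ?n" by (simp add: cost_bound_def)
    have z: "z ?n * 2 ^ sg \<le> z ?n * ?l" using sg(1) by simp
    have "(d + z ?n) * 2 ^ sg \<le> (N0 ?n + 2 * z ?n) * ?l" using r2 z unfolding distrib_right mult.assoc by linarith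
    moreover have "d * 2 ^ sg \<le> (N0 ?n + 2 * z ?n) * ?l" using r2 z unfolding distrib_right mult.assoc by linarith
    ultimately show ?thesis using that[OF s1 s2 w] by blast
  qed
qed

text \<open>The table records only the farthest point, so the item may lead beyond \<open>b\<close>;
  its position \<open>b'\<close> then leaves an even shorter suffix.\<close>

lemma own_Inr_complete:
  assumes I: "I \<in> G" and p: "is_path (VV I) (rest I) p" and len: "length p \<le> z (nn I) + 1"
    and b: "last p = PP I ! b" "b \<le> last_idx I"
  shows "\<exists>b' c. (hd p, Inr b', c) \<in> own I (hd p) \<and> prefix_len I b \<le> b' \<and>
    c \<le> (N0 (nn I) + 2 * z (nn I)) * path_len (ww I) p"
proof -
  let ?n = "nn I"
  obtain sg d where s: "sg \<le> scales ?n" "d \<le> cost_bound ?n" "walk (rest I) (scaled_cost I sg) (hd p) (last p) d"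
    "(d + z ?n) * 2 ^ sg \<le> (N0 ?n + 2 * z ?n) * path_len (ww I) p \<or> d = 0"
    using scale[OF I p len] by metis
  have u: "hd p \<in> VV I" using p by (auto simp: is_path_def)
  \<comment> \<open>The ceiling of \<open>d / z\<close>; rounding up to this multiple adds less than
    \<open>z\<close> units.\<close>
  define j where "j = (d + z ?n - 1) div z ?n"
  have z: "z ?n \<ge> 1" by (rule z_pos)
  have eq: "j * z ?n + (d + z ?n - 1) mod z ?n = d + z ?n - 1" unfolding j_def by (rule div_mult_mod_eq)
  have "(d + z ?n - 1) mod z ?n < z ?n" using z by (intro mod_less_divisor) simp
  then have j1: "d \<le> j * z ?n" "j * z ?n \<le> d + z ?n - 1" using eq z by linarith+
  have j2: "j \<le> 2 * e0 + 1"
  proof -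
    have "d \<le> (2 * e0 + 1) * z ?n" using s(2) by (simp add: cost_bound_def N0_def algebra_simps)
    then have "j * z ?n < (2 * e0 + 2) * z ?n" using j1(2) z by (simp add: algebra_simps)
    then have "j < 2 * e0 + 2" using mult_less_cancel2 by blast
    then show ?thesis by simp
  qed
  have "PP I ! b \<in> set (PP I)" using b last_idx_len[OF I] by simp
  then have "val I (PP I ! b) = Suc (prefix_len I b)" using prefix_len_at_nth[OF I b(2)] by (simp add: val_def)
  then have F: "Suc (prefix_len I b) \<le> far (rest I) (scaled_cost I sg) (val I) (j * z ?n) (hd p)"
    using far_ge[OF conn_instD(2)[OF conn[OF I]] rest_V[OF I] u s(3) j1(1), of "val I"] b by simp
  then obtain b' where b': "far (rest I) (scaled_cost I sg) (val I) (j * z ?n) (hd p) = Suc b'" "prefix_len I b \<le> b'"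
    by (metis Suc_le_D Suc_le_mono)
  then have "far_at I (hd p) ! sg ! (j * z ?n) = Suc b'" using far_table_nth[OF s(1) jz_le[OF j2]] by simp
  then have "(hd p, Inr b', j * z ?n * 2 ^ sg) \<in> own I (hd p)"
    unfolding own_def own_items_of_def using s(1) j2 by blast
  moreover have "j * z ?n * 2 ^ sg \<le> (N0 ?n + 2 * z ?n) * path_len (ww I) p"
  proof (cases "d = 0")
    case True
    then have "j = 0" unfolding j_def using z by simp
    then show ?thesis by simp
  next
    case False
    have "j * z ?n * 2 ^ sg \<le> (d + z ?n) * 2 ^ sg" using j1(2) by (intro mult_right_mono) auto
    also have "\<dots> \<le> (N0 ?n + 2 * z ?n) * path_len (ww I) p" using s(4) False by blast
    finally show ?thesis .
  qed
  ultimately show ?thesis using b'(2) by blast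
qed

lemma own_Inl_complete:
  assumes I: "I \<in> G" and p: "is_path (VV I) (rest I) p" and len: "length p \<le> z (nn I) + 1"
    and b: "last p \<in> LL I"
  shows "\<exists>c. (hd p, Inl (last p), c) \<in> own I (hd p) \<and> c \<le> (N0 (nn I) + 2 * z (nn I)) * path_len (ww I) p"
proof -
  let ?n = "nn I" and ?l = "last p"
  obtain sg d where s: "sg \<le> scales ?n" "d \<le> cost_bound ?n" "walk (rest I) (scaled_cost I sg) (hd p) ?l d"
    "d * 2 ^ sg \<le> (N0 ?n + 2 * z ?n) * path_len (ww I) p"
    using scale[OF I p len] by metis
  have "d + card (LL I) \<le> cost_bound ?n + kk ?n" using s(2) cardL[OF I] by simp
  then obtain d' where d': "d' \<le> d" "(d', ?l) \<in> tdist (rest I) (scaled_cost I sg) (LL I) (cost_bound ?n + kk ?n) (hd p)"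
    using tdist_bound[OF rest_fin[OF I] LL_fin[OF I] _ b s(3)] scaled_cost_pos[OF I] by blast
  define Pr where "Pr c \<longleftrightarrow> (\<exists>sg d. sg \<le> scales ?n \<and> d \<le> cost_bound ?n \<and> (d, ?l) \<in> set (tdist_at I (hd p) ! sg) \<and> c = d * 2 ^ sg)" for c
  have P0: "Pr (d' * 2 ^ sg)" unfolding Pr_def using s d' tdist_table_nth[OF I s(1)] by (intro exI[of _ sg] exI[of _ d']) auto
  define c where "c = (LEAST c. Pr c)"
  have c1: "Pr c" unfolding c_def using P0 by (rule LeastI)
  have c2: "c \<le> c'" if "Pr c'" for c' unfolding c_def using that by (rule Least_le)
  have "(hd p, Inl ?l, c) \<in> own I (hd p)"
    unfolding own_def own_items_of_def using c1 c2 unfolding Pr_def by blast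
  moreover have "c \<le> d * 2 ^ sg" using c2[OF P0] d'(1) by (meson le_trans mult_le_mono1)
  ultimately show ?thesis using s(4) by (intro exI[of _ c]) auto
qed

text \<open>A long path is cut at a landmark among its entries \<open>1\<close> to \<open>z\<close>.
  Entry \<open>0\<close> is excluded so that the remainder is shorter, and the piece cut off has at
  most \<open>z\<close> edges. Each piece starts at \<open>a\<close> or at a landmark, so its item
  is available to \<open>a\<close>; each loses the same factor, so the losses do not
  compound.\<close>

lemma reaches_complete:
  assumes I: "I \<in> G" and b: "b \<le> last_idx I"
  shows "is_path (VV I) (rest I) p \<Longrightarrow> hits (z (nn I)) (LL I) p \<Longrightarrow> last p = PP I ! b \<Longrightarrow>
    hd p \<in> insert a (LL I) \<Longrightarrow>
    \<exists>b' c. reaches (own I a \<union> lm_items I) (hd p) b' c \<and> prefix_len I b \<le> b' \<and> c \<le> (N0 (nn I) + 2 * z (nn I)) * path_len (ww I) p"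
proof (induction "length p" arbitrary: p rule: less_induct)
  case less
  let ?n = "nn I"
  note p = less.prems(1)
  have sub: "own I (hd p) \<subseteq> own I a \<union> lm_items I" using less.prems(4) by (auto simp: lm_items_def)
  show ?case
  proof (cases "length p \<le> z ?n + 1")
    case True
    then show ?thesis using own_Inr_complete[OF I p True less.prems(3) b] sub reaches_base by blast
  next
    case False
    then have "1 + z ?n \<le> length p" by simp
    then obtain j where j: "1 \<le> j" "j < 1 + z ?n" "p ! j \<in> LL I" using less.prems(2) unfolding hits_def by blast
    have jl: "Suc j < length p" using j False by simp
    define p1 p2 where "p1 = take (Suc j) p" and "p2 = drop j p"
    have p12: "p1 \<noteq> []" "p2 \<noteq> []" "hd p1 = hd p" "last p1 = p ! j" "hd p2 = p ! j" "last p2 = last p"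
      "length p1 = Suc j" "length p2 < length p"
      using jl j(1) by (auto simp: p1_def p2_def hd_take hd_drop_conv_nth)
        (simp add: take_Suc_conv_app_nth)
    have sp: "p = p1 @ tl p2"
      unfolding p1_def p2_def using append_take_drop_id[of "Suc j" p] by (simp add: drop_Suc tl_drop)
    have ed: "edges_of p = edges_of p1 @ edges_of p2"
    proof -
      obtain y ys where y: "p2 = y # ys" using p12(2) by (cases p2) auto
      have "edges_of p2 = (if ys = [] then [] else (y, hd ys) # edges_of ys)"
        unfolding y by (cases ys) (auto simp: edges_of_Cons)
      then show ?thesis using edges_of_append[OF p12(1), of "tl p2"] sp p12(4,5) y by simp
    qed
    have pl: "path_len (ww I) p = path_len (ww I) p1 + path_len (ww I) p2" by (simp add: path_len_def ed)
    have q1: "is_path (VV I) (rest I) p1" and q2: "is_path (VV I) (rest I) p2"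
      using p p12(1,2) ed set_take_subset[of "Suc j" p] set_drop_subset[of j p]
      unfolding is_path_def p1_def p2_def by auto
    have h2: "hits (z ?n) (LL I) p2" unfolding hits_def
    proof (intro allI impI)
      fix i assume "i + z ?n \<le> length p2"
      then have "(i + j) + z ?n \<le> length p" using jl by (simp add: p2_def)
      then obtain k where k: "i + j \<le> k" "k < i + j + z ?n" "p ! k \<in> LL I" using less.prems(2) unfolding hits_def by blast
      then show "\<exists>k. i \<le> k \<and> k < i + z ?n \<and> p2 ! k \<in> LL I"
        using jl by (intro exI[of _ "k - j"]) (auto simp: p2_def)
    qed
    obtain b' c2 where r2: "reaches (own I a \<union> lm_items I) (p ! j) b' c2" "prefix_len I b \<le> b'"
        "c2 \<le> (N0 ?n + 2 * z ?n) * path_len (ww I) p2"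
      using less.hyps[OF p12(8) q2 h2] p12(5,6) less.prems(3) j(3) by auto
    obtain c1 where r1: "(hd p, Inl (p ! j), c1) \<in> own I (hd p)" "c1 \<le> (N0 ?n + 2 * z ?n) * path_len (ww I) p1"
      using own_Inl_complete[OF I q1] p12(3,4,7) j by auto
    have "reaches (own I a \<union> lm_items I) (hd p) b' (c1 + c2)" using reaches_step r1(1) sub r2(1) by blast
    then show ?thesis using r1(2) r2(2,3) pl
      by (intro exI[of _ b'] exI[of _ "c1 + c2"]) (auto simp: algebra_simps)
  qed
qed

section \<open>Approximate replacement lengths\<close>

abbreviation vmax :: "nat list \<Rightarrow> nat list \<Rightarrow> nat list" where "vmax \<equiv> map2 max"

text \<open>Holds for lists of any lengths, since \<open>zip\<close> cuts to the shortest in either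
  order; \<open>knows_scan\<close> demands associativity unconditionally.\<close>

lemma vmax_assoc: "vmax (vmax a b) c = vmax a (vmax b c)"
  by (rule nth_equalityI) (auto simp: max.assoc)

lemma level_far_len: "length (level_far I v) = Suc (levels (nn I))"
  unfolding level_far_def level_far_of_def by simp

lemma level_far_nth:
  assumes I: "I \<in> G" and v: "v \<in> VV I" and q: "q \<le> levels (nn I)"
  shows "level_far I v ! q \<le> 2 * nn I ^ (cW + 1)"
    and "level_far I v ! q > Suc y \<longleftrightarrow> (\<exists>b c. reaches (own I v \<union> lm_items I) v b c \<and> b > y \<and>
       real (N0 (nn I) * prefix_len_at I v + c + N0 (nn I) * (total_len I - b)) \<le> rr ^ q)"
proof -
  let ?A = "{Suc b |b c. reaches (own I v \<union> lm_items I) v b c \<and> real (N0 (nn I) * prefix_len_at I v + c + N0 (nn I) * (total_len I - b)) \<le> rr ^ q}"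
  have nth: "level_far I v ! q = Max (insert 0 ?A)" unfolding level_far_def level_far_of_def using q by (simp del: upt_Suc)
  have sub: "?A \<subseteq> {..2 * nn I ^ (cW + 1)}"
  proof
    fix x assume "x \<in> ?A"
    then obtain b c where b: "x = Suc b" "reaches (own I v \<union> lm_items I) v b c" by blast
    then obtain i where "i \<le> last_idx I" "b = prefix_len I i" using reaches_sound[OF I v b(2) v] by blast
    then have "b \<le> nn I ^ (cW + 1)" using prefix_len_le[OF I] by simp
    moreover have "nn I ^ (cW + 1) \<ge> 1" using n2[OF I] by simp
    ultimately have "x \<le> 2 * nn I ^ (cW + 1)" using b(1) by linarith
    then show "x \<in> {..2 * nn I ^ (cW + 1)}" by simp
  qed
  then have fin: "finite ?A" by (rule finite_subset) simp
  show "level_far I v ! q \<le> 2 * nn I ^ (cW + 1)" unfolding nth using fin sub by (subst Max_le_iff) auto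
  show "level_far I v ! q > Suc y \<longleftrightarrow> (\<exists>b c. reaches (own I v \<union> lm_items I) v b c \<and> b > y \<and>
       real (N0 (nn I) * prefix_len_at I v + c + N0 (nn I) * (total_len I - b)) \<le> rr ^ q)"
    unfolding nth using fin by (subst Max_gr_iff) auto
qed

lemma prefix_fold_vmax:
  assumes "\<And>v. length (y v) = m"
  shows "length (prefix_fold vmax I y i) = m \<and> (\<forall>q<m. prefix_fold vmax I y i ! q > x \<longleftrightarrow> (\<exists>a\<le>i. y (PP I ! a) ! q > x))"
  using assms by (induction i) (auto simp: less_max_iff_disj le_Suc_eq)

lemma seg_fold_vmax:
  assumes "\<And>v. length (y v) = m" "\<And>v q. v \<in> set (PP I) \<Longrightarrow> q < m \<Longrightarrow> y v ! q \<le> B" "i < length (PP I)"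
  shows "length (seg_fold vmax I y i) = m \<and> (\<forall>q<m. seg_fold vmax I y i ! q \<le> B)"
  using assms by (induction i) auto

definition T5 where "T5 I = T4 I + z (nn I) + (kk (nn I) + 2 * ecc I)"

text \<open>Budgets count \<open>N0 n\<close> times the length, hence the quotient. Rounding it down
  stays above the replacement length because that is an integer. Entries are successors of
  positions, so \<open>> Suc p\<close> means strictly beyond position \<open>p\<close>.\<close>

definition rp_level :: "nat \<Rightarrow> nat \<Rightarrow> nat list \<Rightarrow> enat" where
  "rp_level n p xs = (if \<exists>q\<le>levels n. xs ! q > Suc p
     then enat (nat \<lfloor>rr ^ (LEAST q. q \<le> levels n \<and> xs ! q > Suc p) / real (N0 n)\<rfloor>) else \<infinity>)"

definition rp_out :: "inst \<Rightarrow> nat \<Rightarrow> enat" where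
  "rp_out I v = rp_level (nn I) (prefix_len_at I v) (if v \<in> set (PP I) then prefix_fold vmax I (level_far I) (idx I v) else undefined)"

lemma computable_out: "computable G T5 rp_out"
proof -
  have "knows (\<lambda>I. T4 I + z (nn I) + (kk (nn I) + 2 * ecc I))
    (\<lambda>I v. (((((prefix_len_at I v, total_len I), far_at I v), tdist_at I v), list_of (lm_items I)),
      if v \<in> set (PP I) then prefix_fold vmax I (level_far I) (idx I v) else undefined))"
  proof (rule knows_scan[OF knows_items vmax_assoc, where
      M = "\<lambda>n. {xs. set xs \<subseteq> {..2 * n ^ (cW + 1)} \<and> length xs \<le> Suc (levels n)}"
      and yf = "\<lambda>b ((((p, t), F), K), It). level_far_of (fst (fst b)) (l_id (fst b)) p t (own_items_of (fst (fst b)) (l_id (fst b)) F K \<union> set It)"],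
      goal_cases)
    case (1 I v)
    then have "finite (lm_items I)" unfolding lm_items_def using LL_fin own_card by blast
    then show ?case by (simp add: level_far_def own_def)
  next
    case 2
    show ?case using plog_add[OF plogQ plog_const[of 1]] by (intro small_lists small_atMost_poly) simp
  next
    case (3 I i)
    have "level_far I v ! q \<le> 2 * nn I ^ (cW + 1)" if "v \<in> set (PP I)" "q < Suc (levels (nn I))" for v q
      using level_far_nth(1)[OF 3(1), of v q] pinD(3)[OF 3(1)] that by auto
    then have "length (seg_fold vmax I (level_far I) i) = Suc (levels (nn I)) \<and>
        (\<forall>q<Suc (levels (nn I)). seg_fold vmax I (level_far I) i ! q \<le> 2 * nn I ^ (cW + 1))"
      using 3 by (intro seg_fold_vmax) (auto simp: level_far_len)
    then show ?case by (auto simp: in_set_conv_nth)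
  qed
  then show ?thesis unfolding knows_def T5_def
    by (rule computable_map[where g = "\<lambda>(b, (((((p, t), F), K), It), xs)). rp_level (fst (fst b)) p xs"])
       (simp add: rp_out_def)
qed

text \<open>Every successful level is backed by an actual replacement path, so the output is never
  too small. Conversely the level just above the budget of an optimal replacement path succeeds;
  \<open>1 + 2 / e0\<close> is the loss in that budget, \<open>rr\<close> the loss in passing to the
  next power.\<close>

theorem out_correct:
  assumes I: "I \<in> G" and i: "i < last_idx I"
  shows "approx_ok (rr * (1 + 2 / real e0) - 1)
     (repl_dist (VV I) (EE I) (ww I) (ss I) (tt I) (PP I ! i, PP I ! Suc i)) (rp_out I (PP I ! i))"
proof -
  let ?n = "nn I" and ?R = "repl_dist (VV I) (EE I) (ww I) (ss I) (tt I) (PP I ! i, PP I ! Suc i)"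
  note S = sp[OF I]
  define xs where "xs = prefix_fold vmax I (level_far I) i"
  have out: "rp_out I (PP I ! i) = rp_level ?n (prefix_len I i) xs"
    using prefix_len_at_nth[OF I, of i] last_idx_len[OF I, of i] i pinD(2)[OF I] by (simp add: rp_out_def xs_def)
  have N0r: "real (N0 ?n) > 0" using N0_pos by simp
  have xsq: "xs ! q > Suc (prefix_len I i) \<longleftrightarrow> (\<exists>a\<le>i. \<exists>b c. reaches (own I (PP I ! a) \<union> lm_items I) (PP I ! a) b c \<and> b > prefix_len I i \<and>
       real (N0 ?n * prefix_len I a + c + N0 ?n * (total_len I - b)) \<le> rr ^ q)" if q: "q \<le> levels ?n" for q
  proof -
    have "xs ! q > Suc (prefix_len I i) \<longleftrightarrow> (\<exists>a\<le>i. level_far I (PP I ! a) ! q > Suc (prefix_len I i))"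
      using prefix_fold_vmax[of "level_far I" "Suc (levels ?n)" I i "Suc (prefix_len I i)", OF level_far_len] q by (simp add: xs_def)
    also have "\<dots> \<longleftrightarrow> (\<exists>a\<le>i. \<exists>b c. reaches (own I (PP I ! a) \<union> lm_items I) (PP I ! a) b c \<and> b > prefix_len I i \<and>
       real (N0 ?n * prefix_len I a + c + N0 ?n * (total_len I - b)) \<le> rr ^ q)"
    proof -
      have "level_far I (PP I ! a) ! q > Suc (prefix_len I i) \<longleftrightarrow> (\<exists>b c. reaches (own I (PP I ! a) \<union> lm_items I) (PP I ! a) b c \<and> b > prefix_len I i \<and>
       real (N0 ?n * prefix_len I a + c + N0 ?n * (total_len I - b)) \<le> rr ^ q)" if "a \<le> i" for a
        using level_far_nth(2)[OF I P_V[OF S, of a] q, of "prefix_len I i"] prefix_len_at_nth[OF I, of a] that i by simp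
      then show ?thesis by blast
    qed
    finally show ?thesis .
  qed
  have lower: "?R \<le> enat (nat \<lfloor>rr ^ q / real (N0 ?n)\<rfloor>)" if q: "q \<le> levels ?n" "xs ! q > Suc (prefix_len I i)" for q
  proof -
    obtain a b c where a: "a \<le> i" "reaches (own I (PP I ! a) \<union> lm_items I) (PP I ! a) b c" "b > prefix_len I i"
       "real (N0 ?n * prefix_len I a + c + N0 ?n * (total_len I - b)) \<le> rr ^ q" using xsq[OF q(1)] q(2) by blast
    have aV: "PP I ! a \<in> VV I" using P_V[OF S, of a] a i by simp
    obtain k l where k: "k \<le> last_idx I" "b = prefix_len I k" "walk (rest I) (ww I) (PP I ! a) (PP I ! k) l" "N0 ?n * l \<le> c"
      using reaches_sound[OF I aV a(2) aV] by blast
    have ik: "i < k" using a(3) k(2) prefix_len_mono[of k i I] by (metis leD le_less_linear)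
    have "?R \<le> enat (prefix_len I a + l + (total_len I - prefix_len I k))" by (rule repl_le[OF S a(1) ik k(1,3)])
    moreover have "real (prefix_len I a + l + (total_len I - prefix_len I k)) \<le> rr ^ q / real (N0 ?n)"
    proof -
      have "N0 ?n * (prefix_len I a + l + (total_len I - prefix_len I k)) \<le> N0 ?n * prefix_len I a + c + N0 ?n * (total_len I - b)"
        using k by (simp add: algebra_simps)
      then have "real (N0 ?n * (prefix_len I a + l + (total_len I - prefix_len I k))) \<le> rr ^ q" using a(4) by linarith
      then have "real (prefix_len I a + l + (total_len I - prefix_len I k)) * real (N0 ?n) \<le> rr ^ q"
        by (simp only: of_nat_mult mult.commute)
      then show ?thesis using N0r by (simp only: pos_le_divide_eq)
    qed
    then have "prefix_len I a + l + (total_len I - prefix_len I k) \<le> nat \<lfloor>rr ^ q / real (N0 ?n)\<rfloor>"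
      by (simp only: le_nat_floor)
    ultimately show ?thesis by (meson enat_ord_simps(1) order_trans)
  qed
  show ?thesis
  proof (cases ?R)
    case infinity
    have "\<not> (\<exists>q\<le>levels ?n. xs ! q > Suc (prefix_len I i))" using lower infinity by fastforce
    then have "rp_out I (PP I ! i) = \<infinity>" using out by (simp add: rp_level_def)
    then show ?thesis using infinity by (simp add: approx_ok_def)
  next
    case (enat X)
    obtain a b l where ab: "a \<le> i" "i < b" "b \<le> last_idx I" "walk (rest I) (ww I) (PP I ! a) (PP I ! b) l"
        "prefix_len I a + l + (total_len I - prefix_len I b) \<le> X" using repl_attained(1)[OF S i enat] by blast
    have X1: "X \<ge> 1" using repl_attained(2)[OF S i enat] total_len_pos[OF S] i by simp
    obtain p0 where "is_path (VV I) (EE I) p0" "path_len (ww I) p0 = X" using repl_attained(3)[OF S i enat] by blast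
    then have XB: "X \<le> ?n ^ (cW + 1)" using path_len_le[OF I] by blast
    define p where "p = detour I (PP I ! a) (PP I ! b)"
    have aV: "PP I ! a \<in> VV I" and bV: "PP I ! b \<in> VV I" using P_V[OF S] ab i by auto
    note p = detour[OF ab(4) spD(5)[OF S] aV, folded p_def]
    have hp: "hits (z ?n) (LL I) p" unfolding p_def by (rule hitsC[OF I aV bV ab(4)])
    obtain b' c where r: "reaches (own I (PP I ! a) \<union> lm_items I) (PP I ! a) b' c" "prefix_len I b \<le> b'"
        "c \<le> (N0 ?n + 2 * z ?n) * path_len (ww I) p"
      using reaches_complete[OF I ab(3) p(1) hp p(3), of "PP I ! a"] p(2) by auto
    \<comment> \<open>The factor \<open>N0 + 2 * z\<close> contains the rounding loss of the detour;
      charging it to the exact prefix and suffix as well gives a bound in terms of \<open>X\<close>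
      alone.\<close>
    define Y where "Y = (N0 ?n + 2 * z ?n) * X"
    have "N0 ?n * prefix_len I a + c + N0 ?n * (total_len I - b') \<le> Y"
    proof -
      have "c \<le> (N0 ?n + 2 * z ?n) * l" using r(3) p(4) by (meson le_trans mult_le_mono2)
      moreover have "N0 ?n * prefix_len I a \<le> (N0 ?n + 2 * z ?n) * prefix_len I a" by simp
      moreover have "N0 ?n * (total_len I - b') \<le> (N0 ?n + 2 * z ?n) * (total_len I - prefix_len I b)"
        using r(2) by (intro mult_mono) auto
      ultimately have "N0 ?n * prefix_len I a + c + N0 ?n * (total_len I - b') \<le>
          (N0 ?n + 2 * z ?n) * (prefix_len I a + l + (total_len I - prefix_len I b))" by (simp add: algebra_simps)
      also have "\<dots> \<le> Y" unfolding Y_def using ab(5) by (rule mult_le_mono2)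
      finally show ?thesis .
    qed
    then have good: "xs ! q > Suc (prefix_len I i)" if "q \<le> levels ?n" "real Y \<le> rr ^ q" for q
    proof -
      have "real (N0 ?n * prefix_len I a + c + N0 ?n * (total_len I - b')) \<le> rr ^ q"
        using \<open>N0 ?n * prefix_len I a + c + N0 ?n * (total_len I - b') \<le> Y\<close> that(2) by linarith
      moreover have "b' > prefix_len I i" using prefix_len_strict[OF S ab(2,3)] r(2) by simp
      ultimately show ?thesis using xsq[OF that(1)] ab(1) r(1) by blast
    qed
    have Y1: "Y \<ge> 1" unfolding Y_def using X1 N0_pos[of ?n] by simp
    have "real Y \<le> rr ^ levels ?n"
    proof -
      have "Y \<le> (e0 * z ?n + 2 * z ?n) * ?n ^ (cW + 1)"
        unfolding Y_def N0_def using XB by (rule mult_le_mono2)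
      then show ?thesis using rrQ[OF n2[OF I]] by linarith
    qed
    \<comment> \<open>The first power of \<open>rr\<close> that covers \<open>Y\<close>; by
      minimality it overshoots by a factor of at most \<open>rr\<close>.\<close>
    define q0 where "q0 = (LEAST q. real Y \<le> rr ^ q)"
    have q0: "real Y \<le> rr ^ q0" "q0 \<le> levels ?n"
      unfolding q0_def using \<open>real Y \<le> rr ^ levels ?n\<close> by (rule LeastI, rule Least_le)
    have q0u: "rr ^ q0 \<le> rr * real Y"
    proof (cases q0)
      case 0
      have "1 * 1 \<le> rr * real Y" using rr Y1 by (intro mult_mono) auto
      then show ?thesis using 0 by simp
    next
      case (Suc k)
      have "\<not> real Y \<le> rr ^ k" using not_less_Least[of k "\<lambda>q. real Y \<le> rr ^ q"] Suc unfolding q0_def by simp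
      then show ?thesis using Suc rr by simp
    qed
    define q where "q = (LEAST q. q \<le> levels ?n \<and> xs ! q > Suc (prefix_len I i))"
    have ex: "q0 \<le> levels ?n \<and> xs ! q0 > Suc (prefix_len I i)" using good q0 by blast
    have q: "q \<le> levels ?n \<and> xs ! q > Suc (prefix_len I i)" "q \<le> q0"
      unfolding q_def using ex by (rule LeastI, rule Least_le)
    define x where "x = nat \<lfloor>rr ^ q / real (N0 ?n)\<rfloor>"
    have o: "rp_out I (PP I ! i) = enat x" unfolding out rp_level_def q_def x_def using ex by auto
    have "?R \<le> enat x" unfolding x_def using lower q by blast
    moreover have "real x \<le> (rr * (1 + 2 / real e0)) * real X"
    proof -
      have "rr ^ q / real (N0 ?n) \<ge> 0" using rr N0r by simp
      then have "real x \<le> rr ^ q / real (N0 ?n)" unfolding x_def by linarith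
      also have "\<dots> \<le> rr ^ q0 / real (N0 ?n)" using rr q(2) N0r by (intro divide_right_mono power_increasing) auto
      also have "\<dots> \<le> rr * real Y / real (N0 ?n)" using q0u N0r by (intro divide_right_mono) auto
      also have "\<dots> = (rr * (1 + 2 / real e0)) * real X"
        using z_pos[of ?n] e0 by (simp add: Y_def N0_def field_simps)
      finally show ?thesis .
    qed
    ultimately show ?thesis using enat o by (simp add: approx_ok_def)
  qed
qed

end

section \<open>Random landmarks\<close>

lemma prob_all_False:
  assumes "finite V" "S \<subseteq> V" "0 \<le> p" "p \<le> 1"
  shows "measure_pmf.prob (Pi_pmf V False (\<lambda>_. bernoulli_pmf p)) {f. \<forall>v\<in>S. \<not> f v} = (1 - p) ^ card S"
proof -
  define B where "B v = (if v \<in> S then {False} else UNIV)" for v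
  have "{f. \<forall>v\<in>S. \<not> f v} = Pi V B" using assms(2) by (auto simp: B_def Pi_def split: if_splits)
  then have "measure_pmf.prob (Pi_pmf V False (\<lambda>_. bernoulli_pmf p)) {f. \<forall>v\<in>S. \<not> f v}
      = (\<Prod>v\<in>V. measure_pmf.prob (bernoulli_pmf p) (B v))"
    using measure_Pi_pmf_Pi[OF assms(1)] by simp
  also have "\<dots> = (\<Prod>v\<in>V. if v \<in> S then 1 - p else 1)"
    using assms by (intro prod.cong) (auto simp: B_def measure_pmf_single)
  also have "\<dots> = (1 - p) ^ card S"
    using assms by (simp add: prod.If_cases Int_absorb1)
  finally show ?thesis .
qed

text \<open>Markov's inequality for \<open>2 ^ X\<close>, where \<open>X\<close> counts the heads:
  independence gives the expectation \<open>(1 + p) ^ card V\<close>, which is at most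
  \<open>exp (card V * p)\<close>.\<close>

lemma prob_many_True:
  assumes V: "finite V" and p: "0 \<le> p" "p \<le> 1"
  shows "measure_pmf.prob (Pi_pmf V False (\<lambda>_. bernoulli_pmf p)) {f. card {v \<in> V. f v} \<ge> k}
    \<le> exp (real (card V) * p) / 2 ^ k"
proof -
  let ?D = "Pi_pmf V False (\<lambda>_. bernoulli_pmf p)"
  let ?u = "\<lambda>f. \<Prod>v\<in>V. (if f v then 2 else 1 :: real)"
  have u: "?u f = 2 ^ card {v \<in> V. f v}" for f
    using V by (simp add: prod.If_cases Int_def conj_commute)
  have int1: "integrable (measure_pmf (bernoulli_pmf p)) (\<lambda>b. if b then 2 else 1 :: real)"
    by (rule integrable_measure_pmf_finite) (simp add: finite_subset[of _ "UNIV :: bool set"])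
  have "measure_pmf.expectation ?D ?u = (\<Prod>v\<in>V. measure_pmf.expectation (bernoulli_pmf p) (\<lambda>b. if b then 2 else 1))"
    using V int1 by (intro expectation_prod_Pi_pmf) auto
  also have "\<dots> = (1 + p) ^ card V" using p by (simp add: algebra_simps)
  also have "\<dots> \<le> exp p ^ card V" using p exp_ge_add_one_self[of p] by (intro power_mono) auto
  also have "\<dots> = exp (real (card V) * p)" by (simp add: exp_of_nat_mult)
  finally have E: "measure_pmf.expectation ?D ?u \<le> exp (real (card V) * p)" .
  have "{f. card {v \<in> V. f v} \<ge> k} \<subseteq> {f. ?u f \<ge> 2 ^ k}"
    unfolding u by (auto intro: power_increasing)
  then have "measure_pmf.prob ?D {f. card {v \<in> V. f v} \<ge> k} \<le> measure_pmf.prob ?D {f. ?u f \<ge> 2 ^ k}"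
    by (intro measure_pmf.finite_measure_mono) auto
  also have "\<dots> \<le> measure_pmf.expectation ?D ?u / 2 ^ k"
  proof -
    have "integrable (measure_pmf ?D) ?u"
      using V int1 by (intro integrable_prod_Pi_pmf) auto
    from integral_Markov_inequality_measure[OF this, of UNIV "2 ^ k"]
    show ?thesis by (simp add: prod_nonneg)
  qed
  also have "\<dots> \<le> exp (real (card V) * p) / 2 ^ k" using E by (intro divide_right_mono) auto
  finally show ?thesis .
qed

section \<open>Choice of the window length, the sampling rate and the bound on the landmarks\<close>

definition seg_len :: "nat \<Rightarrow> nat" where "seg_len n = max 1 (nat \<lceil>real n powr (2/3)\<rceil>)"
text \<open>The constant \<open>10\<close> lets a fixed window of \<open>seg_len n\<close> vertices
  be missed with probability at most \<open>1 / n ^ 10\<close>, enough for a union bound over about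
  \<open>n ^ 3\<close> windows. In \<open>lm_bound\<close>, as
  \<open>2 ^ k \<ge> exp (k / 2)\<close>, the term \<open>2 * n * p\<close> absorbs the expectation
  and \<open>8 * ln n\<close> leaves probability \<open>1 / n ^ 4\<close>.\<close>

definition lm_prob :: "nat \<Rightarrow> real" where "lm_prob n = min 1 (10 * ln (real n) / real (seg_len n))"
definition lm_bound :: "nat \<Rightarrow> nat" where "lm_bound n = nat \<lceil>2 * real n * lm_prob n + 8 * ln (real n)\<rceil>"

lemma lm_prob_01: "0 \<le> lm_prob n" "lm_prob n \<le> 1"
proof -
  have "ln (real n) \<ge> 0" by (cases "n = 0") auto
  then show "0 \<le> lm_prob n" "lm_prob n \<le> 1" unfolding lm_prob_def by auto
qed

lemma seg_len_bounds: "n \<ge> 2 \<Longrightarrow> real n powr (2/3) \<le> real (seg_len n)" "n \<ge> 2 \<Longrightarrow> real (seg_len n) \<le> 2 * real n powr (2/3)"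
  "n \<ge> 2 \<Longrightarrow> seg_len n \<le> n" "seg_len n \<ge> 1"
proof -
  show "seg_len n \<ge> 1" by (simp add: seg_len_def)
  assume n: "n \<ge> 2"
  have p1: "real n powr (2/3) \<ge> 1" using n by (intro ge_one_powr_ge_zero) auto
  have pn: "real n powr (2/3) \<le> real n" using powr_mono[of "2/3" 1 "real n"] n by simp
  have z: "seg_len n = nat \<lceil>real n powr (2/3)\<rceil>" unfolding seg_len_def using p1 by linarith
  show "real n powr (2/3) \<le> real (seg_len n)" unfolding z using p1 by linarith
  show "real (seg_len n) \<le> 2 * real n powr (2/3)" unfolding z using p1 by linarith
  show "seg_len n \<le> n" unfolding z using pn by linarith
qed

lemma ln_le_lg: "n \<ge> 2 \<Longrightarrow> ln (real n) \<le> real (lg n) \<and> 1 \<le> real (lg n) \<and> log 2 (real n) \<le> real (lg n)"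
proof -
  assume n: "n \<ge> 2"
  have l: "log 2 (real n) \<le> real (lg n)" unfolding lg_def using n by linarith
  have "ln 2 \<le> (1::real)" using ln_2_less_1 by simp
  then have "ln (real n) \<le> log 2 (real n)" using n by (simp add: log_def field_simps mult_left_le)
  then show ?thesis using l log2_ge_1[OF n] by simp
qed

lemma lm_bound_bounds: assumes n: "n \<ge> 2"
  shows "real (lm_bound n) \<le> 29 * (real n powr (1/3) * real (lg n))" "lm_bound n \<le> 11 * n"
    "real (lm_bound n) \<ge> 2 * real n * lm_prob n + 8 * ln (real n)"
proof -
  let ?a = "real n powr (1/3)"
  have a1: "?a \<ge> 1" using n by (intro ge_one_powr_ge_zero) auto
  have l0: "ln (real n) \<ge> 0" using n by simp
  have "0 \<le> 2 * real n * lm_prob n + 8 * ln (real n)" using lm_prob_01[of n] l0 by simp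
  then have k: "real (lm_bound n) \<le> 2 * real n * lm_prob n + 8 * ln (real n) + 1"
    "real (lm_bound n) \<ge> 2 * real n * lm_prob n + 8 * ln (real n)" unfolding lm_bound_def by linarith+
  then show "real (lm_bound n) \<ge> 2 * real n * lm_prob n + 8 * ln (real n)" by simp
  have "real n = ?a * real n powr (2/3)" using n by (simp add: powr_add[symmetric])
  then have nz: "real n \<le> ?a * real (seg_len n)" using seg_len_bounds(1)[OF n] a1
    by (metis mult_left_mono order_trans zero_le_one)
  have "real n * lm_prob n \<le> real n * (10 * ln (real n) / real (seg_len n))"
    unfolding lm_prob_def by (intro mult_left_mono) auto
  also have "\<dots> \<le> (?a * real (seg_len n)) * (10 * ln (real n) / real (seg_len n))"
    using nz l0 by (intro mult_right_mono) auto
  also have "\<dots> = 10 * (?a * ln (real n))" using seg_len_bounds(4)[of n] by simp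
  finally have 1: "real n * lm_prob n \<le> 10 * (?a * ln (real n))" .
  note L = ln_le_lg[OF n]
  have 2: "?a * ln (real n) \<le> ?a * real (lg n)" using L a1 by (intro mult_left_mono) auto
  have 3: "ln (real n) \<le> ?a * real (lg n)" using mult_mono[of 1 ?a "ln (real n)" "real (lg n)"] L a1 l0 by simp
  have 4: "1 \<le> ?a * real (lg n)" using mult_mono[of 1 ?a 1 "real (lg n)"] L a1 by simp
  \<comment> \<open>\<open>29 = 20 + 8 + 1\<close>: twice the expected number, the logarithmic term,
    and the rounding.\<close>
  show "real (lm_bound n) \<le> 29 * (?a * real (lg n))" using k(1) 1 2 3 4 by linarith
  have "real n * lm_prob n \<le> real n" using mult_left_mono[OF lm_prob_01(2)[of n], of "real n"] by simp
  moreover have "ln (real n) \<le> real n" using ln_le_minus_one[of "real n"] n by simp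
  ultimately have "real (lm_bound n) \<le> 11 * real n" using k(1) n by linarith
  then show "lm_bound n \<le> 11 * n" by linarith
qed

lemma miss_prob: assumes n: "n \<ge> 2" shows "(1 - lm_prob n) ^ seg_len n \<le> 1 / real n ^ 10"
proof (cases "lm_prob n = 1")
  case True
  then show ?thesis using seg_len_bounds(4)[of n] by (simp add: zero_power)
next
  case False
  then have p: "lm_prob n = 10 * ln (real n) / real (seg_len n)" unfolding lm_prob_def by (simp add: min_def split: if_splits)
  have "(1 - lm_prob n) ^ seg_len n \<le> exp (- lm_prob n) ^ seg_len n"
    using exp_ge_add_one_self[of "- lm_prob n"] lm_prob_01[of n] by (intro power_mono) auto
  also have "\<dots> = exp (- (real (seg_len n) * lm_prob n))" by (simp add: exp_of_nat_mult[symmetric])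
  also have "real (seg_len n) * lm_prob n = 10 * ln (real n)" using seg_len_bounds(4)[of n] by (simp add: p)
  also have "exp (- (10 * ln (real n))) = 1 / real n ^ 10"
    using n exp_of_nat_mult[of 10 "ln (real n)"] by (simp add: exp_minus inverse_eq_divide)
  finally show ?thesis .
qed

lemma many_prob: assumes n: "n \<ge> 2" shows "exp (real n * lm_prob n) / 2 ^ lm_bound n \<le> 1 / real n ^ 4"
proof -
  have "ln 2 \<ge> (1/2::real)" using ln_le_minus_one[of "1/2::real"] by (simp add: ln_div)
  then have "real (lm_bound n) * (1/2) \<le> real (lm_bound n) * ln 2" by (intro mult_left_mono) auto
  then have le: "real n * lm_prob n - real (lm_bound n) * ln 2 \<le> - (4 * ln (real n))" using lm_bound_bounds(3)[OF n] by linarith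
  have "(2::real) ^ lm_bound n = exp (real (lm_bound n) * ln 2)" by (simp add: exp_of_nat_mult)
  then have "exp (real n * lm_prob n) / 2 ^ lm_bound n = exp (real n * lm_prob n - real (lm_bound n) * ln 2)" by (simp add: exp_diff)
  also have "\<dots> \<le> exp (- (4 * ln (real n)))" using le by simp
  also have "\<dots> = 1 / real n ^ 4"
    using n exp_of_nat_mult[of 4 "ln (real n)"] by (simp add: exp_minus inverse_eq_divide)
  finally show ?thesis .
qed

text \<open>For unreachable pairs \<open>detour\<close> is an unspecified list, hence the premise on
  the existence of a walk.\<close>

definition landmarks_ok :: "inst \<Rightarrow> bool" where
  "landmarks_ok I \<longleftrightarrow> LL I \<subseteq> VV I \<and> card (LL I) \<le> lm_bound (nn I) \<and> hits (seg_len (nn I)) (LL I) (PP I) \<and>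
    (\<forall>u\<in>VV I. \<forall>v\<in>VV I. (\<exists>l. walk (rest I) (ww I) u v l) \<longrightarrow> hits (seg_len (nn I)) (LL I) (detour I u v))"

text \<open>Union bound: \<open>P\<close> and one detour per pair give at most
  \<open>n ^ 2 + 1\<close> paths with at most \<open>n\<close> windows each, every window missed
  with probability at most \<open>1 / n ^ 10\<close>; an excess of landmarks adds
  \<open>1 / n ^ 4\<close>.\<close>

lemma landmarks_ok_prob:
  assumes I: "nn I \<ge> 2" "finite (VV I)" "card (VV I) = nn I" "EE I \<subseteq> VV I \<times> VV I"
    "distinct (PP I)" "set (PP I) \<subseteq> VV I"
  shows "measure_pmf.prob (Pi_pmf (VV I) False (\<lambda>_. bernoulli_pmf (lm_prob (nn I))))
     {f. landmarks_ok (I\<lparr>LL := {v \<in> VV I. f v}\<rparr>)} \<ge> 1 - 1 / real (nn I)"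
proof -
  let ?n = "nn I" and ?V = "VV I"
  let ?D = "Pi_pmf ?V False (\<lambda>_. bernoulli_pmf (lm_prob ?n))"
  define Q where "Q = insert (PP I) ((\<lambda>(u, v). detour I u v) ` {(u, v) \<in> ?V \<times> ?V. \<exists>l. walk (rest I) (ww I) u v l})"
  have Qfin: "finite Q" and Qcard: "card Q \<le> ?n * ?n + 1"
  proof -
    have f: "finite {(u, v) \<in> ?V \<times> ?V. \<exists>l. walk (rest I) (ww I) u v l}"
      by (rule finite_subset[of _ "?V \<times> ?V"]) (use I in auto)
    then show "finite Q" by (simp add: Q_def)
    have "card ((\<lambda>(u, v). detour I u v) ` {(u, v) \<in> ?V \<times> ?V. \<exists>l. walk (rest I) (ww I) u v l}) \<le> card (?V \<times> ?V)"
      by (rule order_trans[OF card_image_le[OF f]], rule card_mono) (use I in auto)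
    then show "card Q \<le> ?n * ?n + 1"
      unfolding Q_def using card_insert_le_m1 I(3) f by (simp add: card_insert_if card_cartesian_product)
  qed
  have Qd: "distinct q \<and> set q \<subseteq> ?V" if "q \<in> Q" for q
  proof -
    from that consider "q = PP I" | u v l where "q = detour I u v" "u \<in> ?V" "walk (rest I) (ww I) u v l"
      unfolding Q_def by auto
    then show ?thesis
    proof cases
      case 2
      then show ?thesis using detour(1)[OF 2(3) I(4) 2(2)] by (simp add: is_path_def)
    qed (use I in simp)
  qed
  define W where "W = (\<lambda>(q, i). {f :: nat \<Rightarrow> bool. \<forall>v\<in>set (take (seg_len ?n) (drop i q)). \<not> f v})"
  define K where "K = {(q, i). q \<in> Q \<and> i < ?n \<and> i + seg_len ?n \<le> length q}"
  have Ksub: "K \<subseteq> Q \<times> {..<?n}" by (auto simp: K_def)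
  then have Kfin: "finite K" using Qfin finite_subset by blast
  have Kcard: "card K \<le> (?n * ?n + 1) * ?n"
  proof -
    have "card K \<le> card (Q \<times> {..<?n})" using Ksub Qfin by (intro card_mono) auto
    also have "\<dots> \<le> (?n * ?n + 1) * ?n" using mult_le_mono1[OF Qcard, of ?n] by (simp only: card_cartesian_product card_lessThan)
    finally show ?thesis .
  qed
  have bad: "{f. \<not> landmarks_ok (I\<lparr>LL := {v \<in> ?V. f v}\<rparr>)} \<subseteq> (\<Union>k\<in>K. W k) \<union> {f. card {v \<in> ?V. f v} \<ge> lm_bound ?n}"
  proof
    fix f assume "f \<in> {f. \<not> landmarks_ok (I\<lparr>LL := {v \<in> ?V. f v}\<rparr>)}"
    then have nok: "\<not> landmarks_ok (I\<lparr>LL := {v \<in> ?V. f v}\<rparr>)" by simp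
    show "f \<in> (\<Union>k\<in>K. W k) \<union> {f. card {v \<in> ?V. f v} \<ge> lm_bound ?n}"
    proof (rule ccontr)
      assume "f \<notin> (\<Union>k\<in>K. W k) \<union> {f. card {v \<in> ?V. f v} \<ge> lm_bound ?n}"
      then have c: "card {v \<in> ?V. f v} \<le> lm_bound ?n" and w: "\<And>k. k \<in> K \<Longrightarrow> f \<notin> W k" by auto
      have h: "hits (seg_len ?n) {v \<in> ?V. f v} q" if q: "q \<in> Q" for q
        unfolding hits_def
      proof (intro allI impI)
        fix i assume i: "i + seg_len ?n \<le> length q"
        have "length q \<le> ?n" using Qd[OF q] I(2,3) by (metis card_mono distinct_card)
        then have "i < ?n" using i seg_len_bounds(4)[of ?n] by simp
        then have "(q, i) \<in> K" using q i by (simp add: K_def)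
        then obtain v where v: "v \<in> set (take (seg_len ?n) (drop i q))" "f v" using w by (auto simp: W_def)
        then obtain j where j: "j < seg_len ?n" "v = q ! (i + j)" using i by (auto simp: in_set_conv_nth)
        have "v \<in> ?V" using Qd[OF q] j i by (metis add_less_cancel_left less_le_trans nth_mem subsetD)
        then show "\<exists>j. i \<le> j \<and> j < i + seg_len ?n \<and> q ! j \<in> {v \<in> ?V. f v}"
          using j v by (intro exI[of _ "i + j"]) auto
      qed
      \<comment> \<open>Neither \<open>rest\<close> nor \<open>detour\<close> depends on
        \<open>LL\<close>, so the paths in \<open>Q\<close> are the same for all outcomes of the
        coins.\<close>
      have r: "rest (I\<lparr>LL := {v \<in> ?V. f v}\<rparr>) = rest I" by (simp add: rest_def)
      have cp: "detour (I\<lparr>LL := {v \<in> ?V. f v}\<rparr>) = detour I" by (simp add: detour_def[abs_def] r)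
      have "landmarks_ok (I\<lparr>LL := {v \<in> ?V. f v}\<rparr>)"
        unfolding landmarks_ok_def r cp using c h[of "PP I"] h[of "detour I _ _"] unfolding Q_def by auto
      then show False using nok by simp
    qed
  qed
  have "measure_pmf.prob ?D (W k) \<le> 1 / real ?n ^ 10" if kK: "k \<in> K" for k
  proof -
    obtain q i where k: "k = (q, i)" "q \<in> Q" "i + seg_len ?n \<le> length q" using kK by (auto simp: K_def)
    let ?S = "set (take (seg_len ?n) (drop i q))"
    have "?S \<subseteq> ?V" using Qd[OF k(2)] by (meson in_set_dropD in_set_takeD subset_iff)
    moreover have "card ?S = seg_len ?n" using Qd[OF k(2)] k(3) by (subst distinct_card) auto
    ultimately show ?thesis using prob_all_False[OF I(2), of ?S "lm_prob ?n"] lm_prob_01[of ?n] miss_prob[OF I(1)]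
      by (simp add: W_def k)
  qed
  then have "(\<Sum>k\<in>K. measure_pmf.prob ?D (W k)) \<le> real (card K) * (1 / real ?n ^ 10)"
    by (rule sum_bounded_above)
  also have "\<dots> \<le> real ((?n * ?n + 1) * ?n) * (1 / real ?n ^ 10)"
    using Kcard by (intro mult_right_mono) (simp_all only: of_nat_le_iff, simp)
  finally have S: "(\<Sum>k\<in>K. measure_pmf.prob ?D (W k)) \<le> real ((?n * ?n + 1) * ?n) * (1 / real ?n ^ 10)" .
  have "measure_pmf.prob ?D {f. \<not> landmarks_ok (I\<lparr>LL := {v \<in> ?V. f v}\<rparr>)} \<le>
     measure_pmf.prob ?D ((\<Union>k\<in>K. W k) \<union> {f. card {v \<in> ?V. f v} \<ge> lm_bound ?n})"
    using bad by (intro measure_pmf.finite_measure_mono) auto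
  also have "\<dots> \<le> measure_pmf.prob ?D (\<Union>k\<in>K. W k) + measure_pmf.prob ?D {f. card {v \<in> ?V. f v} \<ge> lm_bound ?n}"
    by (rule measure_subadditive) auto
  also have "measure_pmf.prob ?D (\<Union>k\<in>K. W k) \<le> (\<Sum>k\<in>K. measure_pmf.prob ?D (W k))"
    using Kfin by (intro measure_pmf.finite_measure_subadditive_finite) auto
  also have "measure_pmf.prob ?D {f. card {v \<in> ?V. f v} \<ge> lm_bound ?n} \<le> 1 / real ?n ^ 4"
    using prob_many_True[OF I(2) lm_prob_01, of ?n "lm_bound ?n"] many_prob[OF I(1)] I(3) by simp
  finally have "measure_pmf.prob ?D {f. \<not> landmarks_ok (I\<lparr>LL := {v \<in> ?V. f v}\<rparr>)}
      \<le> real ((?n * ?n + 1) * ?n) * (1 / real ?n ^ 10) + 1 / real ?n ^ 4" using S by simp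
  also have "\<dots> \<le> 1 / real ?n"
  proof -
    let ?x = "real ?n"
    have x: "?x \<ge> 2" using I(1) by simp
    have x2: "?x ^ 2 \<ge> 4" using power_mono[OF x, of 2] by simp
    have x3: "?x ^ 3 \<ge> 8" using power_mono[OF x, of 3] by simp
    have "real ((?n * ?n + 1) * ?n) * (1 / ?x ^ 10) = (?x ^ 2 + 1) / ?x ^ 9"
      using x by (simp add: power2_eq_square field_simps) (simp add: power_numeral_reduce field_simps)
    also have "\<dots> \<le> (2 * ?x ^ 2) / ?x ^ 9" using x x2 by (intro divide_right_mono) auto
    also have "\<dots> = (2 / ?x ^ 6) * (1 / ?x)" using x by (simp add: power_numeral_reduce field_simps)
    also have "\<dots> \<le> (1/2) * (1 / ?x)"
    proof (rule mult_right_mono)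
      have "?x ^ 6 \<ge> 64" using power_mono[OF x, of 6] by simp
      then show "2 / ?x ^ 6 \<le> 1 / 2" using x by (simp add: field_simps)
    qed (use x in simp)
    finally have 1: "real ((?n * ?n + 1) * ?n) * (1 / ?x ^ 10) \<le> (1/2) * (1 / ?x)" .
    have "1 / ?x ^ 4 = (1 / ?x ^ 3) * (1 / ?x)" using x by (simp add: power_numeral_reduce field_simps)
    also have "\<dots> \<le> (1/2) * (1 / ?x)"
      using x x3 by (intro mult_right_mono) (auto simp: field_simps)
    finally show ?thesis using 1 by simp
  qed
  finally have "measure_pmf.prob ?D {f. \<not> landmarks_ok (I\<lparr>LL := {v \<in> ?V. f v}\<rparr>)} \<le> 1 / real ?n" .
  moreover have "measure_pmf.prob ?D {f. landmarks_ok (I\<lparr>LL := {v \<in> ?V. f v}\<rparr>)}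
      = 1 - measure_pmf.prob ?D {f. \<not> landmarks_ok (I\<lparr>LL := {v \<in> ?V. f v}\<rparr>)}"
    using measure_pmf.prob_compl[of "{f. \<not> landmarks_ok (I\<lparr>LL := {v \<in> ?V. f v}\<rparr>)}" ?D]
    by (simp add: Compl_eq_Diff_UNIV[symmetric] Collect_neg_eq[symmetric])
  ultimately show ?thesis by simp
qed

section \<open>Round complexity\<close>

lemma (in fnet) T5_eq: "T5 I = 11 * ecc I + 3 + 2 * z (nn I) + 3 * kk (nn I) + 2 * ((2 * e0 + 1) * z (nn I)) +
    kk (nn I) * (kk (nn I) + ((cW + 1) * lg (nn I) + 1) * (2 * e0 + 2))"
  unfolding T5_def T4_def T3_def T2_def T1_def num_items_def cost_bound_def N0_def scales_def by (simp add: algebra_simps)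

text \<open>The factor of \<open>n powr (2/3) + D\<close>. The product stems from broadcasting the
  landmark tables: \<open>29\<close> is the constant of \<open>lm_bound\<close>, and two factors
  \<open>n powr (1/3)\<close> have been moved out. \<open>87 = 3 * 29\<close> covers the two scans
  and the schedule, and \<open>14\<close> also dominates the factor \<open>11\<close> of the
  eccentricity.\<close>

definition rounds_plog :: "nat \<Rightarrow> nat \<Rightarrow> nat \<Rightarrow> nat" where
  "rounds_plog cW e0 n = 14 + 4 * (2 * e0 + 2) + 87 * lg n +
     29 * lg n * (29 * lg n + ((cW + 1) * lg n + 1) * (2 * e0 + 2))"

lemma plog_rounds: "plog (rounds_plog cW e0)"
  unfolding rounds_plog_def[abs_def] by (intro plog_add plog_mult plog_const plog_lg)

lemma rounds_bound:
  assumes n: "n \<ge> 2" and e: "ec \<le> D"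
  shows "real (11 * ec + 3 + 2 * seg_len n + 3 * lm_bound n + 2 * ((2 * e0 + 1) * seg_len n) +
    lm_bound n * (lm_bound n + ((cW + 1) * lg n + 1) * (2 * e0 + 2))) \<le> (real n powr (2/3) + real D) * real (rounds_plog cW e0 n)"
proof -
  let ?a = "real n powr (1/3)" and ?b = "real n powr (2/3)" and ?l = "real (lg n)"
  let ?s = "real (((cW + 1) * lg n + 1) * (2 * e0 + 2))"
  have a1: "?a \<ge> 1" "?b \<ge> 1" using n by (auto intro!: ge_one_powr_ge_zero)
  have ab: "?a * ?a = ?b" by (simp add: powr_add[symmetric])
  have aleb: "?a \<le> ?b" using a1 mult_left_mono[of 1 ?a ?a] ab by simp
  have l1: "?l \<ge> 1" using ln_le_lg[OF n] by simp
  have z: "real (seg_len n) \<le> 2 * ?b" using seg_len_bounds(2)[OF n] .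
  have k: "real (lm_bound n) \<le> ?a * (29 * ?l)" using lm_bound_bounds(1)[OF n] by (simp add: mult_ac)
  have k': "real (lm_bound n) \<le> ?b * (29 * ?l)"
    using k mult_right_mono[OF aleb, of "29 * ?l"] l1 by linarith
  have "real (lm_bound n) + ?s \<le> ?a * (29 * ?l) + ?a * ?s"
    using k a1 by (intro add_mono) (auto intro: mult_right_mono[of 1 ?a ?s, simplified])
  then have ks: "real (lm_bound n) + ?s \<le> ?a * (29 * ?l + ?s)" by (simp only: distrib_left)
  have "real (lm_bound n) * (real (lm_bound n) + ?s) \<le> (?a * (29 * ?l)) * (?a * (29 * ?l + ?s))"
    using k ks by (intro mult_mono) auto
  also have "\<dots> = ?b * (29 * ?l * (29 * ?l + ?s))" by (simp only: ab[symmetric] mult_ac)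
  finally have kk: "real (lm_bound n) * (real (lm_bound n) + ?s) \<le> ?b * (29 * ?l * (29 * ?l + ?s))" .
  have zz: "(2 + 2 * (2 * real e0 + 1)) * real (seg_len n) \<le> (2 + 2 * (2 * real e0 + 1)) * (2 * ?b)"
    using z by (intro mult_left_mono) auto
  have h: "real (rounds_plog cW e0 n) = 14 + 4 * (2 * real e0 + 2) + 87 * ?l + 29 * ?l * (29 * ?l + ?s)"
    unfolding rounds_plog_def by (simp only: of_nat_add of_nat_mult of_nat_numeral)
  have pos: "0 \<le> 29 * ?l * (29 * ?l + ?s)" by simp
  have D: "11 * real ec \<le> real D * real (rounds_plog cW e0 n)"
  proof -
    have "11 * real ec \<le> real D * 11" using e by simp
    also have "\<dots> \<le> real D * real (rounds_plog cW e0 n)" unfolding h using pos l1 by (intro mult_left_mono) auto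
    finally show ?thesis .
  qed
  have "real (11 * ec + 3 + 2 * seg_len n + 3 * lm_bound n + 2 * ((2 * e0 + 1) * seg_len n) +
    lm_bound n * (lm_bound n + ((cW + 1) * lg n + 1) * (2 * e0 + 2))) =
      11 * real ec + 3 + (2 + 2 * (2 * real e0 + 1)) * real (seg_len n) + 3 * real (lm_bound n) + real (lm_bound n) * (real (lm_bound n) + ?s)"
    by (simp add: algebra_simps)
  also have "\<dots> \<le> real D * real (rounds_plog cW e0 n) + 3 * ?b + (2 + 2 * (2 * real e0 + 1)) * (2 * ?b)
      + 3 * (?b * (29 * ?l)) + ?b * (29 * ?l * (29 * ?l + ?s))"
    using D zz k' kk a1 by linarith
  also have "\<dots> \<le> real D * real (rounds_plog cW e0 n) +
     (?b * (14 + 4 * (2 * real e0 + 2)) + ?b * (87 * ?l) + ?b * (29 * ?l * (29 * ?l + ?s)))"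
  proof -
    have "3 * ?b + (2 + 2 * (2 * real e0 + 1)) * (2 * ?b) \<le> ?b * (14 + 4 * (2 * real e0 + 2))"
      using a1 by (simp add: algebra_simps)
    moreover have "3 * (?b * (29 * ?l)) = ?b * (87 * ?l)" by simp
    ultimately show ?thesis by linarith
  qed
  also have "\<dots> = (?b + real D) * real (rounds_plog cW e0 n)"
    unfolding h by (simp only: distrib_left distrib_right add_ac)
  finally show ?thesis .
qed

lemma approx_ok_mono: "approx_ok e d x \<Longrightarrow> e \<le> e' \<Longrightarrow> approx_ok e' d x"
proof -
  assume a: "approx_ok e d x" and e: "e \<le> e'"
  have "(1 + e) * real (the_enat d) \<le> (1 + e') * real (the_enat d)" using e by (intro mult_right_mono) auto
  then show ?thesis using a unfolding approx_ok_def by (meson order_trans)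
qed

text \<open>The base \<open>rr\<close> is a constant, so the logarithm of a polynomial is
  \<open>O(log n)\<close>. The argument dominates the largest budget of an optimal replacement path,
  as \<open>seg_len n \<le> n\<close>.\<close>

lemma level_count:
  fixes rr :: real and e0 cW :: nat
  assumes rr: "rr > 1"
  defines "Q \<equiv> \<lambda>n. nat \<lceil>log rr (real ((e0 + 2) * n ^ (cW + 2)))\<rceil>"
  shows "plog Q" and "n \<ge> 2 \<Longrightarrow> real ((e0 * seg_len n + 2 * seg_len n) * n ^ (cW + 1)) \<le> rr ^ Q n"
proof -
  show "plog Q"
  proof (rule plog_real)
    fix n :: nat assume n: "n \<ge> 2"
    have "n ^ (cW + 2) > 0" "e0 + 2 > 0" using n by simp_all
    then have "(e0 + 2) * n ^ (cW + 2) > 0" by (rule mult_pos_pos[rotated])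
    then have "real ((e0 + 2) * n ^ (cW + 2)) \<ge> 1" by linarith
    then have l0: "log rr (real ((e0 + 2) * n ^ (cW + 2))) \<ge> 0" using rr by simp
    have "log rr (real ((e0 + 2) * n ^ (cW + 2))) = log rr (real (e0 + 2)) + real (cW + 2) * log rr (real n)"
    proof -
      have "log rr (real ((e0 + 2) * n ^ (cW + 2))) = log rr (real (e0 + 2) * real n ^ (cW + 2))"
        by (simp only: of_nat_mult of_nat_power)
      also have "\<dots> = log rr (real (e0 + 2)) + log rr (real n ^ (cW + 2))"
        by (rule log_mult_pos) (use n in simp_all)
      also have "log rr (real n ^ (cW + 2)) = real (cW + 2) * log rr (real n)"
        by (rule log_nat_power) (use n in simp)
      finally show ?thesis .
    qed
    also have "log rr (real n) = log rr 2 * log 2 (real n)" using rr n by (simp add: log_def)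
    finally show "real (Q n) \<le> (real (cW + 2) * log rr 2) * log 2 (real n) + (log rr (real (e0 + 2)) + 1)"
      using l0 unfolding Q_def by linarith
  qed
  assume n: "n \<ge> 2"
  let ?y = "real ((e0 + 2) * n ^ (cW + 2))"
  have "n ^ (cW + 2) > 0" "e0 + 2 > 0" using n by simp_all
  then have "(e0 + 2) * n ^ (cW + 2) > 0" by (rule mult_pos_pos[rotated])
  then have y: "?y > 0" by (simp only: of_nat_0_less_iff)
  have "(e0 * seg_len n + 2 * seg_len n) * n ^ (cW + 1) = (e0 + 2) * (seg_len n * n ^ (cW + 1))" by (simp add: algebra_simps)
  also have "\<dots> \<le> (e0 + 2) * (n * n ^ (cW + 1))" using seg_len_bounds(3)[OF n] by (intro mult_le_mono2 mult_le_mono1)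
  finally have "real ((e0 * seg_len n + 2 * seg_len n) * n ^ (cW + 1)) \<le> ?y" by (simp only: of_nat_le_iff) simp
  also have "?y = rr powr (log rr ?y)" using y rr by simp
  also have "\<dots> \<le> rr powr real (Q n)" using rr unfolding Q_def by (intro powr_mono) linarith+
  also have "\<dots> = rr ^ Q n" using rr by (simp add: powr_realpow)
  finally show "real ((e0 * seg_len n + 2 * seg_len n) * n ^ (cW + 1)) \<le> rr ^ Q n" .
qed

theorem theorem1p3:
  fixes eps :: real
  assumes "0 < eps" and "eps < 1"
  shows "\<forall>cW cI :: nat. \<exists>(A :: congest_alg) (B :: real) (C :: real) (k :: nat) (c :: real).
     0 < B \<and> 0 < c \<and>
     (\<forall>n V E w s t P.
        n \<ge> 2 \<longrightarrow> valid_instance n cW cI V E w s t P \<longrightarrow>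
        (let bw = nat \<lceil>B * log 2 (real n)\<rceil>;
             T = nat \<lceil>C * (real n powr (2/3) + real (diameter V E)) * (ln (real n)) ^ k\<rceil>
         in measure_pmf.prob (run A bw V E (local_input n E w s t P) T)
              {h. rpaths_success eps A V E w s t P h}
            \<ge> 1 - 1 / real n powr c))"
proof (intro allI)
  fix cW cI :: nat
  \<comment> \<open>Chosen such that \<open>2 / e0 \<le> eps / 4\<close>; with
    \<open>rr = 1 + eps / 4\<close> the total factor is at most \<open>(1 + eps / 4) ^ 2\<close>,
    which is below \<open>1 + eps\<close>.\<close>
  define e0 where "e0 = nat \<lceil>8 / eps\<rceil>"
  define rr where "rr = 1 + eps / 4"
  define levels where "levels = (\<lambda>n. nat \<lceil>log rr (real ((e0 + 2) * n ^ (cW + 2)))\<rceil>)"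
  \<comment> \<open>All sizes at once, since a single algorithm has to serve every instance;
    outcomes with bad landmarks are left out and paid for by probability.\<close>
  define G where "G = {I. nn I \<ge> 2 \<and> valid_instance (nn I) cW cI (VV I) (EE I) (ww I) (ss I) (tt I) (PP I) \<and> landmarks_ok I}"
  have "8 / eps > 0" using assms by simp
  then have e0r: "real e0 \<ge> 8 / eps" and e0: "e0 \<ge> 1" unfolding e0_def by linarith+
  have rr: "rr > 1" using assms by (simp add: rr_def)
  have hdP: "PP I \<noteq> [] \<Longrightarrow> hd (PP I) = PP I ! 0" for I by (simp add: hd_conv_nth)
  interpret fnet G cI seg_len lm_bound cW e0 11 rr levels
  proof
    fix I assume I: "I \<in> G"
    then show "conn_inst I" "path_inst cI I" "sp_inst I"
      "hits (seg_len (nn I)) (LL I) (PP I)" "card (LL I) \<le> lm_bound (nn I)"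
      by (auto simp: G_def conn_inst_def path_inst_def sp_inst_def valid_instance_def is_path_def landmarks_ok_def hdP)
    show "0 < ww I e \<and> ww I e \<le> nn I ^ cW" if "e \<in> EE I" for e
      using I that by (auto simp: G_def valid_instance_def)
    show "hits (seg_len (nn I)) (LL I) (detour I u v)"
      if "u \<in> VV I" "v \<in> VV I" "walk (rest I) (ww I) u v l" for u v l
      using I that unfolding G_def landmarks_ok_def by blast
  next
    show "plog levels" unfolding levels_def by (rule level_count(1)[OF rr])
    show "real ((e0 * seg_len n + 2 * seg_len n) * n ^ (cW + 1)) \<le> rr ^ levels n" if "n \<ge> 2" for n
      unfolding levels_def by (rule level_count(2)[OF rr that])
  qed (use e0 rr seg_len_bounds lm_bound_bounds in auto)
  have "\<And>n. 0 \<le> lm_prob n \<and> lm_prob n \<le> 1" using lm_prob_01 by simp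
  from computable_simulation[where p = lm_prob, OF wf computable_out this]
  obtain A W where W: "plog W" and A: "\<forall>n V E w s t P bw T'. n \<ge> 2 \<longrightarrow> finite V \<longrightarrow> E \<subseteq> V \<times> V \<longrightarrow> bw \<ge> 1 \<longrightarrow>
     (\<exists>hist. run A bw V E (local_input n E w s t P) T' =
            map_pmf hist (Pi_pmf V False (\<lambda>_. bernoulli_pmf (lm_prob n))) \<and>
        (\<forall>f I. I = \<lparr>nn = n, VV = V, EE = E, ww = w, ss = s, tt = t, PP = P, LL = {v \<in> V. f v}\<rparr> \<longrightarrow>
           I \<in> G \<longrightarrow> 1 + W n * T5 I \<le> T' \<longrightarrow> (\<forall>v\<in>V. committed A (hist f) v = Some (rp_out I v))))"
    by (elim exE conjE) (rule that)
  have pl: "plog (\<lambda>n. 1 + W n * rounds_plog cW e0 n)"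
    by (intro plog_add plog_mult plog_const W plog_rounds)
  obtain C k where "C \<ge> 0" and Ck: "\<And>n m. n \<ge> 2 \<Longrightarrow> m \<ge> k \<Longrightarrow> real (1 + W n * rounds_plog cW e0 n) \<le> C * log 2 (real n) ^ m"
    by (rule plogE[OF pl], rule that, assumption) blast
  \<comment> \<open>Turns powers of the logarithm to base 2 into powers of
    \<open>ln\<close>.\<close>
  define C' where "C' = C / ln 2 ^ k"
  show "\<exists>(A :: congest_alg) (B :: real) (C :: real) (k :: nat) (c :: real). 0 < B \<and> 0 < c \<and>
     (\<forall>n V E w s t P.
        n \<ge> 2 \<longrightarrow> valid_instance n cW cI V E w s t P \<longrightarrow>
        (let bw = nat \<lceil>B * log 2 (real n)\<rceil>;
             T = nat \<lceil>C * (real n powr (2/3) + real (diameter V E)) * (ln (real n)) ^ k\<rceil>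
         in measure_pmf.prob (run A bw V E (local_input n E w s t P) T)
              {h. rpaths_success eps A V E w s t P h}
            \<ge> 1 - 1 / real n powr c))"
    unfolding Let_def
  \<comment> \<open>\<open>B = 1\<close> is enough because the simulation sends one bit per edge
    direction and round; \<open>c = 1\<close> matches the failure probability \<open>1 / n\<close>
    of the landmarks.\<close>
  proof (rule exI[of _ A], rule exI[of _ 1], rule exI[of _ C'], rule exI[of _ k], rule exI[of _ 1], intro conjI allI impI)
    fix n V E w s t P
    assume n: "n \<ge> 2" and val: "valid_instance n cW cI V E w s t P"
    define bw where "bw = nat \<lceil>1 * log 2 (real n)\<rceil>"
    define T where "T = nat \<lceil>C' * (real n powr (2/3) + real (diameter V E)) * (ln (real n)) ^ k\<rceil>"
    have V: "finite V" "E \<subseteq> V \<times> V" "card V = n" "distinct P" "set P \<subseteq> V" "P \<noteq> []"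
      using val by (auto simp: valid_instance_def is_path_def)
    have bw: "bw \<ge> 1" unfolding bw_def using log2_ge_1[OF n] by linarith
    let ?I = "\<lambda>f. \<lparr>nn = n, VV = V, EE = E, ww = w, ss = s, tt = t, PP = P, LL = {v \<in> V. f v}\<rparr>"
    let ?D = "Pi_pmf V False (\<lambda>_. bernoulli_pmf (lm_prob n))"
    obtain hist where h: "run A bw V E (local_input n E w s t P) T = map_pmf hist ?D"
      "\<And>f. ?I f \<in> G \<Longrightarrow> 1 + W n * T5 (?I f) \<le> T \<Longrightarrow> \<forall>v\<in>V. committed A (hist f) v = Some (rp_out (?I f) v)"
      using A[rule_format, OF n V(1,2) bw, of w s t P T] by (elim exE conjE) (rule that, assumption, blast)
    have time: "1 + W n * T5 (?I f) \<le> T" if I: "?I f \<in> G" for f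
    proof -
      let ?r = "real n powr (2/3) + real (diameter V E)"
      have ec: "ecc (?I f) \<le> diameter V E" using ecc_le_diameter[OF conn[OF I]] by simp
      have r1: "?r \<ge> 1" using n ge_one_powr_ge_zero[of "real n" "2/3"] by simp
      have t5: "real (T5 (?I f)) \<le> ?r * real (rounds_plog cW e0 n)"
        unfolding T5_eq using rounds_bound[OF n ec, of e0 cW] by simp
      have "real (1 + W n * T5 (?I f)) = 1 + real (W n) * real (T5 (?I f))" by simp
      also have "\<dots> \<le> ?r * 1 + real (W n) * (?r * real (rounds_plog cW e0 n))"
        using r1 t5 by (intro add_mono mult_left_mono) auto
      also have "\<dots> = ?r * real (1 + W n * rounds_plog cW e0 n)" by (simp add: algebra_simps)
      also have "\<dots> \<le> ?r * (C * log 2 (real n) ^ k)" using r1 Ck[OF n, of k] by (intro mult_left_mono) auto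
      also have "\<dots> = C' * ?r * ln (real n) ^ k" by (simp add: C'_def log_def power_divide)
      finally show ?thesis unfolding T_def by linarith
    qed
    have succ: "rpaths_success eps A V E w s t P (hist f)" if I: "?I f \<in> G" for f
      unfolding rpaths_success_def
    proof (intro allI impI)
      fix i assume i: "i < length P - 1"
      have "i < length P" using i by simp
      then have "P ! i \<in> V" using V(5) nth_mem by blast
      then have "committed A (hist f) (P ! i) = Some (rp_out (?I f) (P ! i))" using h(2)[OF I time[OF I]] by blast
      moreover have "approx_ok eps (repl_dist V E w s t (P ! i, P ! Suc i)) (rp_out (?I f) (P ! i))"
      proof (rule approx_ok_mono)
        show "approx_ok (rr * (1 + 2 / real e0) - 1) (repl_dist V E w s t (P ! i, P ! Suc i)) (rp_out (?I f) (P ! i))"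
          using out_correct[OF I, of i] i by (simp add: last_idx_def)
        have "2 / real e0 \<le> eps / 4" using e0r assms e0 by (simp add: field_simps)
        then have "rr * (1 + 2 / real e0) \<le> (1 + eps / 4) * (1 + eps / 4)"
          unfolding rr_def using assms by (intro mult_left_mono) auto
        also have "\<dots> = 1 + eps / 2 + eps * eps / 16" by (simp add: field_simps)
        also have "\<dots> \<le> 1 + eps"
        proof -
          have "eps * eps \<le> eps * 1" using assms by (intro mult_left_mono) auto
          then show ?thesis using assms by linarith
        qed
        finally show "rr * (1 + 2 / real e0) - 1 \<le> eps" by simp
      qed
      ultimately show "\<exists>x. committed A (hist f) (P ! i) = Some x \<and> approx_ok eps (repl_dist V E w s t (P ! i, P ! Suc i)) x"
        by blast
    qed
    have "1 - 1 / real n \<le> measure_pmf.prob ?D {f. landmarks_ok (?I f)}"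
      using landmarks_ok_prob[of "?I (\<lambda>_. False)"] n V by simp
    also have "{f. landmarks_ok (?I f)} = {f. ?I f \<in> G}" using n val by (simp add: G_def)
    also have "measure_pmf.prob ?D {f. ?I f \<in> G} \<le> measure_pmf.prob ?D (hist -` {h. rpaths_success eps A V E w s t P h})"
      using succ by (intro measure_pmf.finite_measure_mono) auto
    also have "\<dots> = measure_pmf.prob (run A bw V E (local_input n E w s t P) T) {h. rpaths_success eps A V E w s t P h}"
      unfolding h(1) by simp
    finally have "1 - 1 / real n powr 1 \<le>
      measure_pmf.prob (run A bw V E (local_input n E w s t P) T) {h. rpaths_success eps A V E w s t P h}"
      using n by simp
    then show "measure_pmf.prob (run A (nat \<lceil>1 * log 2 (real n)\<rceil>) V E (local_input n E w s t P)
        (nat \<lceil>C' * (real n powr (2/3) + real (diameter V E)) * (ln (real n)) ^ k\<rceil>)) {h. rpaths_success eps A V E w s t P h}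
        \<ge> 1 - 1 / real n powr 1"
      unfolding bw_def T_def .
  qed auto
qed

end
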